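(* Let $\mathbb{F}_q$ be a fixed finite field with $q\equiv 1\pmod 4$. Then, as $g\to\infty$ (i.e. $\deg(D)=2g+1\to\infty$), $$\frac{1}{\#\mathcal{H}_{2g+1,q}}\sum_{D\in\mathcal{H}_{2g+1,q}}h_D\sim\frac{\sqrt{|D|}}{\sqrt{q}}\,\zeta_A(2)P(2),$$ where $|D|=q^{2g+1}$ on the right-hand side and $P(s)=\prod_{P}\left(1-\frac{1}{(|P|+1)|P|^{s}}\right)$, the product being over monic irreducible polynomials $P\in\mathbb{F}_q[T]$.
   Context: Let $A=\mathbb{F}_q[T]$. For nonzero $f\in A$ put $|f|=q^{\deg f}$. The zeta function of $A$ is $\zeta_A(s)=\sum_{f\ \mathrm{monic}}|f|^{-s}=1/(1-q^{1-s})$. For an integer $g\ge 1$, $\mathcal{H}_{2g+1,q}$ is the set of monic square-free polynomials $D\in A$ of degree $2g+1$. For such $D$, $\mathcal{O}_D=A[\sqrt{D}]$ is a Dedekind domain (the integral closure of $A$ in $\mathbb{F}_q(T)(\sqrt{D})$) and the class number is $h_D=|\mathrm{Pic}(\mathcal{O}_D)|$, the order of its Picard (ideal class) group. The notation $F(g)\sim G(g)$ means $F(g)/G(g)\to 1$ as $g\to\infty$, with $q$ fixed. *)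

theory Defs
  imports
    "HOL-Analysis.Analysis"
    "HOL-Computational_Algebra.Computational_Algebra"
    "HOL-Algebra.Subrings"
    "HOL-Algebra.Ideal_Product"
begin

text \<open>
  Throughout, the finite field with \<open>q\<close> elements is a type \<open>'a\<close> of sort
  \<open>{field, finite}\<close>, so that \<open>q = CARD('a)\<close> and \<open>A = \<bbbF>\<^sub>q[T]\<close> is \<open>'a poly\<close>.
\<close>

section \<open>The Picard group of a domain\<close>

text \<open>
  \<open>R\<close> is a subring of the field \<open>K\<close>, and \<open>K\<close> is the field of fractions of \<open>R\<close>.
  The product of two fractional ideals is the set of finite sums of products, taken in \<open>K\<close>;
  this is what \<^const>\<open>ideal_prod\<close> computes when applied to the ring \<open>K\<close>.
\<close>

definition fractional_ideal :: "('b, 'c) ring_scheme \<Rightarrow> 'b set \<Rightarrow> 'b set \<Rightarrow> bool" where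
  "fractional_ideal K R I \<longleftrightarrow>
     subgroup I (add_monoid K) \<and>
     (\<forall>r\<in>R. \<forall>x\<in>I. r \<otimes>\<^bsub>K\<^esub> x \<in> I) \<and>
     I \<noteq> {\<zero>\<^bsub>K\<^esub>} \<and>
     (\<exists>d\<in>R - {\<zero>\<^bsub>K\<^esub>}. \<forall>x\<in>I. d \<otimes>\<^bsub>K\<^esub> x \<in> R)"

definition invertible_fractional_ideal :: "('b, 'c) ring_scheme \<Rightarrow> 'b set \<Rightarrow> 'b set \<Rightarrow> bool" where
  "invertible_fractional_ideal K R I \<longleftrightarrow>
     fractional_ideal K R I \<and> (\<exists>J. fractional_ideal K R J \<and> I \<cdot>\<^bsub>K\<^esub> J = R)"

definition fractional_ideal_group :: "('b, 'c) ring_scheme \<Rightarrow> 'b set \<Rightarrow> 'b set monoid" where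
  "fractional_ideal_group K R =
     \<lparr>carrier = {I. invertible_fractional_ideal K R I}, mult = ideal_prod K, one = R\<rparr>"

definition principal_fractional_ideals :: "('b, 'c) ring_scheme \<Rightarrow> 'b set \<Rightarrow> 'b set set" where
  "principal_fractional_ideals K R = {(\<lambda>r. x \<otimes>\<^bsub>K\<^esub> r) ` R |x. x \<in> carrier K - {\<zero>\<^bsub>K\<^esub>}}"

definition picard_group :: "('b, 'c) ring_scheme \<Rightarrow> 'b set \<Rightarrow> 'b set set monoid" where
  "picard_group K R = fractional_ideal_group K R Mod principal_fractional_ideals K R"

text \<open>
  Under the standing assumptions on \<open>R\<close> and \<open>K\<close>, the invertible fractional ideals form an abelian
  group and the principal ones a subgroup of it, so that the quotient above is a genuine one.
\<close>

context field
begin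

lemma ideal_prod_subset_closed:
  assumes "I \<subseteq> carrier R" "J \<subseteq> carrier R"
  shows "I \<cdot> J \<subseteq> carrier R"
proof
  fix s assume "s \<in> I \<cdot> J"
  then show "s \<in> carrier R" by induction (use assms in auto)
qed

lemma ideal_prod_subset_comm_aux:
  assumes "I \<subseteq> carrier R" "J \<subseteq> carrier R"
  shows "I \<cdot> J \<subseteq> J \<cdot> I"
proof
  fix s assume "s \<in> I \<cdot> J"
  then show "s \<in> J \<cdot> I"
  proof induction
    case (prod i j)
    then have "i \<otimes> j = j \<otimes> i" using assms m_comm by blast
    then show ?case using ideal_prod.prod[of j J i I R] prod by simp
  qed (rule ideal_prod.sum)
qed

lemma ideal_prod_subset_comm:
  assumes "I \<subseteq> carrier R" "J \<subseteq> carrier R"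
  shows "I \<cdot> J = J \<cdot> I"
  using assms by (intro equalityI ideal_prod_subset_comm_aux)

lemma ideal_prod_subset_assoc_aux:
  assumes "I \<subseteq> carrier R" "J \<subseteq> carrier R" "L \<subseteq> carrier R"
  shows "(I \<cdot> J) \<cdot> L \<subseteq> I \<cdot> (J \<cdot> L)"
proof
  fix s assume "s \<in> (I \<cdot> J) \<cdot> L"
  then show "s \<in> I \<cdot> (J \<cdot> L)"
  proof induction
    case (prod t l)
    from prod(1) show ?case
    proof induction
      case (prod i j)
      have "i \<otimes> j \<otimes> l = i \<otimes> (j \<otimes> l)"
        using assms prod \<open>l \<in> L\<close> by (intro m_assoc) auto
      moreover have "i \<otimes> (j \<otimes> l) \<in> I \<cdot> (J \<cdot> L)"
        using prod \<open>l \<in> L\<close> by (intro ideal_prod.prod)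
      ultimately show ?case by simp
    next
      case (sum s1 s2)
      have "s1 \<in> carrier R" "s2 \<in> carrier R" "l \<in> carrier R"
        using sum \<open>l \<in> L\<close> ideal_prod_subset_closed[of I J] assms by auto
      then have "(s1 \<oplus> s2) \<otimes> l = s1 \<otimes> l \<oplus> s2 \<otimes> l" by (rule l_distr)
      then show ?case using ideal_prod.sum sum by metis
    qed
  qed (rule ideal_prod.sum)
qed

lemma ideal_prod_subset_assoc:
  assumes "I \<subseteq> carrier R" "J \<subseteq> carrier R" "L \<subseteq> carrier R"
  shows "(I \<cdot> J) \<cdot> L = I \<cdot> (J \<cdot> L)"
proof
  show "(I \<cdot> J) \<cdot> L \<subseteq> I \<cdot> (J \<cdot> L)" using assms by (rule ideal_prod_subset_assoc_aux)
  have "I \<cdot> (J \<cdot> L) = (L \<cdot> J) \<cdot> I"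
    using assms by (metis ideal_prod_subset_comm ideal_prod_subset_closed)
  also have "\<dots> \<subseteq> L \<cdot> (J \<cdot> I)" using assms by (intro ideal_prod_subset_assoc_aux)
  also have "\<dots> = (I \<cdot> J) \<cdot> L"
    using assms by (metis ideal_prod_subset_comm ideal_prod_subset_closed)
  finally show "I \<cdot> (J \<cdot> L) \<subseteq> (I \<cdot> J) \<cdot> L" .
qed

context
  fixes S assumes S: "subring S R"
begin

lemma fractional_ideal_carrier: "fractional_ideal R S I \<Longrightarrow> I \<subseteq> carrier R"
  using subgroup.subset[of I "add_monoid R"] by (simp add: fractional_ideal_def)

lemma fractional_ideal_zero: "fractional_ideal R S I \<Longrightarrow> \<zero> \<in> I"
  using subgroup.one_closed[of I "add_monoid R"] by (simp add: fractional_ideal_def)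

lemma fractional_ideal_S: "fractional_ideal R S S"
proof -
  have "\<one> \<in> S" "\<one> \<noteq> \<zero>" using subringE(3)[OF S] by auto
  moreover have "subgroup S (add_monoid R)" using S by (rule subring.axioms)
  ultimately show ?thesis
    unfolding fractional_ideal_def using subringE(1,6)[OF S] by (auto intro!: bexI[of _ \<one>])
qed

lemma fractional_ideal_prod_S:
  assumes "fractional_ideal R S I"
  shows "S \<cdot> I = I"
proof
  show "S \<cdot> I \<subseteq> I"
  proof
    fix s assume "s \<in> S \<cdot> I"
    then show "s \<in> I"
      by induction (use assms in \<open>auto simp: fractional_ideal_def dest: subgroup.m_closed\<close>)
  qed
  show "I \<subseteq> S \<cdot> I"
  proof
    fix x assume x: "x \<in> I"
    then have "\<one> \<otimes> x \<in> S \<cdot> I" using subringE(3)[OF S] by (intro ideal_prod.prod)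
    then show "x \<in> S \<cdot> I" using x fractional_ideal_carrier[OF assms] by auto
  qed
qed

lemma fractional_ideal_prod:
  assumes I: "fractional_ideal R S I" and J: "fractional_ideal R S J"
  shows "fractional_ideal R S (I \<cdot> J)"
proof -
  note car = fractional_ideal_carrier[OF I] fractional_ideal_carrier[OF J]
  note Scar = subringE(1)[OF S]
  have closed: "I \<cdot> J \<subseteq> carrier R" using car by (rule ideal_prod_subset_closed)
  have stable: "r \<otimes> s \<in> I \<cdot> J" if r: "r \<in> S" and s: "s \<in> I \<cdot> J" for r s
    using s
  proof induction
    case (prod i j)
    have "r \<otimes> (i \<otimes> j) = (r \<otimes> i) \<otimes> j"
      using car Scar r prod by (intro m_assoc[symmetric]) auto
    moreover have "r \<otimes> i \<in> I" using I r prod by (auto simp: fractional_ideal_def)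
    ultimately show ?case using prod ideal_prod.prod[of "r \<otimes> i" I j J R] by simp
  next
    case (sum s1 s2)
    then have "r \<otimes> (s1 \<oplus> s2) = r \<otimes> s1 \<oplus> r \<otimes> s2"
      using closed Scar r by (intro r_distr) auto
    then show ?case using sum ideal_prod.sum by metis
  qed
  have zero: "\<zero> \<in> I \<cdot> J"
    using ideal_prod.prod[OF fractional_ideal_zero[OF I] fractional_ideal_zero[OF J], of R] by simp
  have neg: "\<ominus> s \<in> I \<cdot> J" if s: "s \<in> I \<cdot> J" for s
  proof -
    have "\<ominus> \<one> \<in> S" using subringE(3,5)[OF S] by blast
    from stable[OF this s] show ?thesis using s closed by (auto simp: l_minus)
  qed
  have sub: "subgroup (I \<cdot> J) (add_monoid R)"
    by (rule add.subgroupI) (use closed zero neg ideal_prod.sum in \<open>auto simp: a_inv_def\<close>)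
  obtain i j where ij: "i \<in> I" "i \<noteq> \<zero>" "j \<in> J" "j \<noteq> \<zero>"
    using I J fractional_ideal_zero[OF I] fractional_ideal_zero[OF J]
    unfolding fractional_ideal_def by blast
  then have "i \<otimes> j \<noteq> \<zero>" using car integral_iff by blast
  then have nonzero: "I \<cdot> J \<noteq> {\<zero>}" using ij ideal_prod.prod[of i I j J R] by auto
  obtain d e where d: "d \<in> S - {\<zero>}" "\<And>x. x \<in> I \<Longrightarrow> d \<otimes> x \<in> S"
    and e: "e \<in> S - {\<zero>}" "\<And>x. x \<in> J \<Longrightarrow> e \<otimes> x \<in> S"
    using I J unfolding fractional_ideal_def by metis
  have dec: "d \<in> carrier R" "e \<in> carrier R" using d e Scar by auto
  have de: "d \<otimes> e \<in> S - {\<zero>}" using d e dec integral_iff subringE(6)[OF S] by blast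
  have "d \<otimes> e \<otimes> s \<in> S" if "s \<in> I \<cdot> J" for s
    using that
  proof induction
    case (prod i j)
    then have c: "i \<in> carrier R" "j \<in> carrier R" using car by auto
    have "d \<otimes> e \<otimes> (i \<otimes> j) = (d \<otimes> i) \<otimes> (e \<otimes> j)"
      using c dec by (simp add: m_ac)
    then show ?case using prod d e subringE(6)[OF S] by simp
  next
    case (sum s1 s2)
    then have "d \<otimes> e \<otimes> (s1 \<oplus> s2) = d \<otimes> e \<otimes> s1 \<oplus> d \<otimes> e \<otimes> s2"
      using closed dec by (intro r_distr) auto
    then show ?case using sum subringE(7)[OF S] by simp
  qed
  with sub stable nonzero de show ?thesis unfolding fractional_ideal_def by blast
qed

lemma comm_group_fractional_ideal_group: "comm_group (fractional_ideal_group R S)"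
proof (rule comm_groupI)
  note simps = fractional_ideal_group_def invertible_fractional_ideal_def
  note car = fractional_ideal_carrier
  show "\<one>\<^bsub>fractional_ideal_group R S\<^esub> \<in> carrier (fractional_ideal_group R S)"
    using fractional_ideal_S fractional_ideal_prod_S by (auto simp: simps)
  fix I assume "I \<in> carrier (fractional_ideal_group R S)"
  then obtain I' where I: "fractional_ideal R S I" "fractional_ideal R S I'" "I \<cdot> I' = S"
    by (auto simp: simps)
  show "\<one>\<^bsub>fractional_ideal_group R S\<^esub> \<otimes>\<^bsub>fractional_ideal_group R S\<^esub> I = I"
    using I fractional_ideal_prod_S by (simp add: simps)
  have "I' \<cdot> I = S" using I car ideal_prod_subset_comm by metis
  then show "\<exists>J\<in>carrier (fractional_ideal_group R S).
      J \<otimes>\<^bsub>fractional_ideal_group R S\<^esub> I = \<one>\<^bsub>fractional_ideal_group R S\<^esub>"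
    using I by (auto simp: simps)
  fix J assume "J \<in> carrier (fractional_ideal_group R S)"
  then obtain J' where J: "fractional_ideal R S J" "fractional_ideal R S J'" "J \<cdot> J' = S"
    by (auto simp: simps)
  show "I \<otimes>\<^bsub>fractional_ideal_group R S\<^esub> J = J \<otimes>\<^bsub>fractional_ideal_group R S\<^esub> I"
    using I J car by (simp add: simps ideal_prod_subset_comm)
  have c: "I \<subseteq> carrier R" "I' \<subseteq> carrier R" "J \<subseteq> carrier R" "J' \<subseteq> carrier R"
    using I J car by auto
  note cl = c ideal_prod_subset_closed
  have "(I \<cdot> J) \<cdot> (J' \<cdot> I') = I \<cdot> ((J \<cdot> J') \<cdot> I')"
    by (simp add: ideal_prod_subset_assoc cl)
  also have "\<dots> = S" using I J by (simp add: fractional_ideal_prod_S)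
  finally have "(I \<cdot> J) \<cdot> (J' \<cdot> I') = S" .
  then show "I \<otimes>\<^bsub>fractional_ideal_group R S\<^esub> J \<in> carrier (fractional_ideal_group R S)"
    using fractional_ideal_prod[OF I(1) J(1)] fractional_ideal_prod[OF J(2) I(2)]
    unfolding simps by auto
  fix L assume "L \<in> carrier (fractional_ideal_group R S)"
  then have "L \<subseteq> carrier R" using car by (auto simp: simps)
  with c show "I \<otimes>\<^bsub>fractional_ideal_group R S\<^esub> J \<otimes>\<^bsub>fractional_ideal_group R S\<^esub> L =
      I \<otimes>\<^bsub>fractional_ideal_group R S\<^esub> (J \<otimes>\<^bsub>fractional_ideal_group R S\<^esub> L)"
    by (simp add: simps ideal_prod_subset_assoc)
qed

lemma principal_prod:
  assumes x: "x \<in> carrier R" and y: "y \<in> carrier R"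
  shows "((\<otimes>) x ` S) \<cdot> ((\<otimes>) y ` S) = (\<otimes>) (x \<otimes> y) ` S"
proof
  note Scar = subringE(1)[OF S]
  show "((\<otimes>) x ` S) \<cdot> ((\<otimes>) y ` S) \<subseteq> (\<otimes>) (x \<otimes> y) ` S"
  proof
    fix s assume "s \<in> ((\<otimes>) x ` S) \<cdot> ((\<otimes>) y ` S)"
    then show "s \<in> (\<otimes>) (x \<otimes> y) ` S"
    proof induction
      case (prod i j)
      then obtain a b where ab: "a \<in> S" "b \<in> S" "i = x \<otimes> a" "j = y \<otimes> b" by auto
      then have "a \<in> carrier R" "b \<in> carrier R" using Scar by auto
      then have "i \<otimes> j = x \<otimes> y \<otimes> (a \<otimes> b)" using ab x y by (simp add: m_ac)
      then show ?case using ab subringE(6)[OF S] by blast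
    next
      case (sum s1 s2)
      then obtain a b where ab: "a \<in> S" "b \<in> S" "s1 = x \<otimes> y \<otimes> a" "s2 = x \<otimes> y \<otimes> b" by auto
      then have "a \<in> carrier R" "b \<in> carrier R" using Scar by auto
      then have "s1 \<oplus> s2 = x \<otimes> y \<otimes> (a \<oplus> b)" using ab x y by (simp add: r_distr)
      then show ?case using ab subringE(7)[OF S] by blast
    qed
  qed
  show "(\<otimes>) (x \<otimes> y) ` S \<subseteq> ((\<otimes>) x ` S) \<cdot> ((\<otimes>) y ` S)"
  proof
    fix s assume "s \<in> (\<otimes>) (x \<otimes> y) ` S"
    then obtain a where a: "a \<in> S" "s = x \<otimes> y \<otimes> a" by auto
    then have "s = (x \<otimes> a) \<otimes> (y \<otimes> \<one>)" using x y Scar by (auto simp: m_ac)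
    then show "s \<in> ((\<otimes>) x ` S) \<cdot> ((\<otimes>) y ` S)"
      using a subringE(3)[OF S] by (auto intro!: ideal_prod.prod)
  qed
qed

lemma subgroup_principal_fractional_ideals:
  assumes frac: "\<And>x. x \<in> carrier R \<Longrightarrow> \<exists>d\<in>S - {\<zero>}. d \<otimes> x \<in> S"
  shows "subgroup (principal_fractional_ideals R S) (fractional_ideal_group R S)"
proof -
  interpret G: comm_group "fractional_ideal_group R S"
    by (rule comm_group_fractional_ideal_group)
  note Scar = subringE(1)[OF S]
  have one: "(\<otimes>) \<one> ` S = S" using Scar by (force simp: image_iff)
  have fi: "fractional_ideal R S ((\<otimes>) x ` S)" if x: "x \<in> carrier R" "x \<noteq> \<zero>" for x
    unfolding fractional_ideal_def
  proof (intro conjI ballI)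
    show "subgroup ((\<otimes>) x ` S) (add_monoid R)"
    proof (rule add.subgroupI)
      show "(\<otimes>) x ` S \<subseteq> carrier R" using x Scar by auto
      show "(\<otimes>) x ` S \<noteq> {}" using subringE(2)[OF S] by auto
    next
      fix s assume "s \<in> (\<otimes>) x ` S"
      then obtain a where a: "a \<in> S" "s = x \<otimes> a" by auto
      then have "\<ominus> s = x \<otimes> (\<ominus> a)" using x Scar by (auto simp: r_minus)
      then show "\<ominus> s \<in> (\<otimes>) x ` S" using a subringE(5)[OF S] by blast
    next
      fix s t assume "s \<in> (\<otimes>) x ` S" "t \<in> (\<otimes>) x ` S"
      then obtain a b where a: "a \<in> S" "s = x \<otimes> a" "b \<in> S" "t = x \<otimes> b" by auto
      moreover have "a \<in> carrier R" "b \<in> carrier R" using a Scar by auto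
      ultimately have "s \<oplus> t = x \<otimes> (a \<oplus> b)" using x by (simp add: r_distr)
      then show "s \<oplus> t \<in> (\<otimes>) x ` S" using a subringE(7)[OF S] by blast
    qed
  next
    fix r s assume "r \<in> S" "s \<in> (\<otimes>) x ` S"
    then obtain a where a: "a \<in> S" "s = x \<otimes> a" by auto
    have "r \<in> carrier R" "a \<in> carrier R" using \<open>r \<in> S\<close> a Scar by auto
    then have "r \<otimes> s = x \<otimes> (r \<otimes> a)" using x a by (simp add: m_ac)
    then show "r \<otimes> s \<in> (\<otimes>) x ` S" using a \<open>r \<in> S\<close> subringE(6)[OF S] by blast
  next
    have "x \<otimes> \<one> \<in> (\<otimes>) x ` S" using subringE(3)[OF S] by blast
    then show "(\<otimes>) x ` S \<noteq> {\<zero>}" using x by auto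
  next
    obtain d where d: "d \<in> S - {\<zero>}" "d \<otimes> x \<in> S" using frac x by blast
    have "d \<otimes> s \<in> S" if s: "s \<in> (\<otimes>) x ` S" for s
    proof -
      obtain a where a: "a \<in> S" "s = x \<otimes> a" using s by auto
      moreover have "a \<in> carrier R" "d \<in> carrier R" using a d Scar by auto
      ultimately have "d \<otimes> s = d \<otimes> x \<otimes> a" using x by (simp add: m_assoc)
      then show ?thesis using a d subringE(6)[OF S] by simp
    qed
    with d show "\<exists>d\<in>S - {\<zero>}. \<forall>s\<in>(\<otimes>) x ` S. d \<otimes> s \<in> S" by blast
  qed
  have inverse: "((\<otimes>) x ` S) \<cdot> ((\<otimes>) (inv x) ` S) = S" "inv x \<in> carrier R" "inv x \<noteq> \<zero>"
    if x: "x \<in> carrier R" "x \<noteq> \<zero>" for x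
  proof -
    have u: "x \<in> Units R" using x field_Units by auto
    then show i: "inv x \<in> carrier R" by simp
    have xi: "x \<otimes> inv x = \<one>" using u by simp
    then show "((\<otimes>) x ` S) \<cdot> ((\<otimes>) (inv x) ` S) = S" using x i by (simp add: principal_prod one)
    show "inv x \<noteq> \<zero>" using xi x by auto
  qed
  have inc: "(\<otimes>) x ` S \<in> carrier (fractional_ideal_group R S)"
    if x: "x \<in> carrier R" "x \<noteq> \<zero>" for x
    using fi[OF x] inverse[OF x] fi[of "inv x"]
    by (auto simp: fractional_ideal_group_def invertible_fractional_ideal_def)
  have pI: "(\<otimes>) x ` S \<in> principal_fractional_ideals R S" if "x \<in> carrier R" "x \<noteq> \<zero>" for x
    using that unfolding principal_fractional_ideals_def by blast
  have pE: "\<exists>x. x \<in> carrier R \<and> x \<noteq> \<zero> \<and> I = (\<otimes>) x ` S"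
    if "I \<in> principal_fractional_ideals R S" for I
    using that unfolding principal_fractional_ideals_def by auto
  show ?thesis
  proof (rule G.subgroupI)
    show "principal_fractional_ideals R S \<subseteq> carrier (fractional_ideal_group R S)"
      using pE inc by blast
    show "principal_fractional_ideals R S \<noteq> {}" using pI[of \<one>] by auto
  next
    fix I assume I: "I \<in> principal_fractional_ideals R S"
    then obtain x where x: "x \<in> carrier R" "x \<noteq> \<zero>" "I = (\<otimes>) x ` S" using pE by blast
    have "inv\<^bsub>fractional_ideal_group R S\<^esub> I = (\<otimes>) (inv x) ` S"
    proof (rule G.inv_equality)
      have "((\<otimes>) (inv x) ` S) \<otimes>\<^bsub>fractional_ideal_group R S\<^esub> I =
          I \<otimes>\<^bsub>fractional_ideal_group R S\<^esub> ((\<otimes>) (inv x) ` S)"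
        using x inc inverse(2,3) by (intro G.m_comm) auto
      also have "\<dots> = \<one>\<^bsub>fractional_ideal_group R S\<^esub>"
        using inverse(1) x by (simp add: fractional_ideal_group_def)
      finally show "((\<otimes>) (inv x) ` S) \<otimes>\<^bsub>fractional_ideal_group R S\<^esub> I =
          \<one>\<^bsub>fractional_ideal_group R S\<^esub>" .
    qed (use x inc inverse(2,3) in auto)
    then show "inv\<^bsub>fractional_ideal_group R S\<^esub> I \<in> principal_fractional_ideals R S"
      using pI inverse(2,3) x by simp
    fix J assume "J \<in> principal_fractional_ideals R S"
    then obtain y where y: "y \<in> carrier R" "y \<noteq> \<zero>" "J = (\<otimes>) y ` S" using pE by blast
    have "I \<otimes>\<^bsub>fractional_ideal_group R S\<^esub> J = (\<otimes>) (x \<otimes> y) ` S"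
      using x y by (simp add: fractional_ideal_group_def principal_prod)
    then show "I \<otimes>\<^bsub>fractional_ideal_group R S\<^esub> J \<in> principal_fractional_ideals R S"
      using pI[of "x \<otimes> y"] x y integral_iff by simp
  qed
qed

end

end


section \<open>Quadratic orders over polynomial rings\<close>

text \<open>
  The pair \<open>(a, b)\<close> stands for \<open>a + b \<surd>D\<close>, with \<open>a\<close> and \<open>b\<close> in \<open>\<bbbF>\<^sub>q(T)\<close>.
  This is a field whenever \<open>D\<close> is not a square.
\<close>

definition quadratic_field :: "'a::field poly \<Rightarrow> ('a poly fract \<times> 'a poly fract) ring" where
  "quadratic_field D =
     \<lparr>carrier = UNIV,
      mult = (\<lambda>(a, b) (c, d). (a * c + to_fract D * b * d, a * d + b * c)),
      one = (1, 0),
      ring.zero = (0, 0),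
      add = (\<lambda>(a, b) (c, d). (a + c, b + d))\<rparr>"

text \<open>
  The elements of \<open>A[\<surd>D]\<close> inside \<open>quadratic_field D\<close>. As a set of pairs this is independent
  of \<open>D\<close>; \<open>D\<close> enters only through the multiplication.
\<close>

definition quadratic_order :: "('a::field poly fract \<times> 'a poly fract) set" where
  "quadratic_order = {(to_fract a, to_fract b) |a b. True}"

lemma field_quadratic_field:
  assumes "\<nexists>c. to_fract D = c ^ 2"
  shows "field (quadratic_field D)"
proof -
  have nz: "a * a \<noteq> to_fract D * b * b" if "(a, b) \<noteq> (0, 0)" for a b
  proof
    assume eq: "a * a = to_fract D * b * b"
    show False
    proof (cases "b = 0")
      case True
      then show False using eq that by simp
    next
      case False
      then have "to_fract D = (a / b) ^ 2"
        using eq by (simp add: power2_eq_square field_simps)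
      then show False using assms by blast
    qed
  qed
  have "cring (quadratic_field D)"
  proof (rule cringI)
    show "abelian_group (quadratic_field D)"
    proof (rule abelian_groupI)
      fix x assume "x \<in> carrier (quadratic_field D)"
      show "\<exists>y\<in>carrier (quadratic_field D). y \<oplus>\<^bsub>quadratic_field D\<^esub> x = \<zero>\<^bsub>quadratic_field D\<^esub>"
        by (rule bexI[of _ "(- fst x, - snd x)"]) (auto simp: quadratic_field_def split: prod.splits)
    qed (auto simp: quadratic_field_def split: prod.splits)
    show "comm_monoid (quadratic_field D)"
      by (rule comm_monoidI) (auto simp: quadratic_field_def algebra_simps split: prod.splits)
  qed (auto simp: quadratic_field_def algebra_simps split: prod.splits)
  then show ?thesis
  proof (rule cring.cring_fieldI2)
    show "\<zero>\<^bsub>quadratic_field D\<^esub> \<noteq> \<one>\<^bsub>quadratic_field D\<^esub>"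
      by (simp add: quadratic_field_def)
    fix x assume "x \<noteq> \<zero>\<^bsub>quadratic_field D\<^esub>"
    then obtain a b where x: "x = (a, b)" and ab: "(a, b) \<noteq> (0, 0)"
      by (cases x) (auto simp: quadratic_field_def)
    define n where "n = a * a - to_fract D * b * b"
    have n: "n \<noteq> 0" using nz[OF ab] by (simp add: n_def)
    have "a * (a / n) + to_fract D * b * (- b / n) = n / n"
      by (simp only: n_def diff_divide_distrib) simp
    moreover have "a * (- b / n) + b * (a / n) = 0" by simp
    ultimately show "\<exists>y\<in>carrier (quadratic_field D). x \<otimes>\<^bsub>quadratic_field D\<^esub> y = \<one>\<^bsub>quadratic_field D\<^esub>"
      using n by (intro bexI[of _ "(a / n, - b / n)"]) (auto simp: quadratic_field_def x)
  qed
qed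

lemma subring_quadratic_order:
  fixes D :: "'a::field poly"
  assumes "\<nexists>c. to_fract D = c ^ 2"
  shows "subring quadratic_order (quadratic_field D)"
proof -
  interpret field "quadratic_field D" using assms by (rule field_quadratic_field)
  show ?thesis
  proof (rule subringI)
    show "\<one>\<^bsub>quadratic_field D\<^esub> \<in> quadratic_order"
      unfolding quadratic_field_def quadratic_order_def
      by (auto intro!: exI[of _ 1] exI[of _ 0] simp flip: to_fract_1 to_fract_0)
  next
    fix h :: "'a poly fract \<times> 'a poly fract"
    assume "h \<in> quadratic_order"
    then obtain a b :: "'a poly" where h: "h = (to_fract a, to_fract b)" by (auto simp: quadratic_order_def)
    have "(to_fract (- a), to_fract (- b)) \<oplus>\<^bsub>quadratic_field D\<^esub> h = \<zero>\<^bsub>quadratic_field D\<^esub>"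
      by (simp add: quadratic_field_def h)
    then have "\<ominus>\<^bsub>quadratic_field D\<^esub> h = (to_fract (- a), to_fract (- b))"
      by (intro minus_equality) (auto simp: quadratic_field_def)
    then show "\<ominus>\<^bsub>quadratic_field D\<^esub> h \<in> quadratic_order"
      unfolding quadratic_order_def by blast
  qed (auto simp: quadratic_field_def quadratic_order_def simp flip: to_fract_mult to_fract_add)
qed

lemma odd_degree_not_square:
  fixes D :: "'a::field poly"
  assumes "odd (degree D)"
  shows "\<nexists>c. to_fract D = c ^ 2"
proof
  assume "\<exists>c. to_fract D = c ^ 2"
  then obtain c where c: "to_fract D = c ^ 2" by blast
  obtain x y where xy: "c = Fract x y" "y \<noteq> 0" by (cases c)
  from c xy have "to_fract D * to_fract y ^ 2 = to_fract x ^ 2"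
    by (simp add: Fract_conv_to_fract field_simps)
  then have eq: "D * y ^ 2 = x ^ 2"
    by (simp add: power2_eq_square flip: to_fract_mult)
  have "D \<noteq> 0" using assms by auto
  then have "degree (D * y ^ 2) = degree D + 2 * degree y"
    using xy by (simp add: degree_mult_eq degree_power_eq)
  moreover have "degree (x ^ 2) = 2 * degree x"
    by (cases "x = 0") (simp_all add: degree_power_eq)
  ultimately have "degree D + 2 * degree y = 2 * degree x" using eq by simp
  then show False using assms by presburger
qed

lemma comm_group_picard_group_quadratic_order:
  fixes D :: "'a::field poly"
  assumes "odd (degree D)"
  shows "comm_group (picard_group (quadratic_field D) quadratic_order)"
proof -
  note sq = odd_degree_not_square[OF assms]
  interpret field "quadratic_field D" using sq by (rule field_quadratic_field)
  note sub = subring_quadratic_order[OF sq]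
  interpret G: comm_group "fractional_ideal_group (quadratic_field D) quadratic_order"
    using sub by (rule comm_group_fractional_ideal_group)
  have "subgroup (principal_fractional_ideals (quadratic_field D) quadratic_order)
      (fractional_ideal_group (quadratic_field D) quadratic_order)"
  proof (rule subgroup_principal_fractional_ideals[OF sub])
    fix x :: "'a poly fract \<times> 'a poly fract"
    obtain a b c d where x: "x = (Fract a b, Fract c d)" "b \<noteq> 0" "d \<noteq> 0"
      by (metis Fract_cases surj_pair)
    have "(to_fract (b * d), to_fract 0) \<otimes>\<^bsub>quadratic_field D\<^esub> x = (to_fract (d * a), to_fract (b * c))"
      using x by (simp add: quadratic_field_def Fract_conv_to_fract)
    moreover have "(to_fract (b * d), to_fract 0) \<in> quadratic_order - {\<zero>\<^bsub>quadratic_field D\<^esub>}"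
      using x unfolding quadratic_order_def by (auto simp: quadratic_field_def simp flip: to_fract_mult to_fract_0)
    moreover have "(to_fract (d * a), to_fract (b * c)) \<in> quadratic_order"
      unfolding quadratic_order_def by blast
    ultimately show "\<exists>e\<in>quadratic_order - {\<zero>\<^bsub>quadratic_field D\<^esub>}.
        e \<otimes>\<^bsub>quadratic_field D\<^esub> x \<in> quadratic_order"
      by metis
  qed
  then show ?thesis
    unfolding picard_group_def by (rule G.abelian_FactGroup)
qed

definition class_number :: "'a::field poly \<Rightarrow> nat" where
  "class_number D = Coset.order (picard_group (quadratic_field D) quadratic_order)"


section \<open>Absolute value, zeta function and Euler product\<close>

definition poly_abs :: "'a::{field, finite} poly \<Rightarrow> real" where
  "poly_abs f = (if f = 0 then 0 else real CARD('a) ^ degree f)"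

definition zeta_A :: "'a::{field, finite} itself \<Rightarrow> real \<Rightarrow> real" where
  "zeta_A _ s = (\<Sum>\<^sub>\<infinity>f\<in>{f :: 'a poly. lead_coeff f = 1}. poly_abs f powr (- s))"

text \<open>
  The infinite product is the limit of the finite partial products along the net of all finite
  sets of monic irreducible polynomials, as in the definition of \<^const>\<open>infsum\<close> for sums.
\<close>

definition euler_P :: "'a::{field, finite} itself \<Rightarrow> real \<Rightarrow> real" where
  "euler_P _ s =
     Lim (finite_subsets_at_top {p :: 'a poly. lead_coeff p = 1 \<and> irreducible p})
       (\<lambda>F. \<Prod>p\<in>F. 1 - 1 / ((poly_abs p + 1) * poly_abs p powr s))"

definition monic_squarefree :: "nat \<Rightarrow> 'a::field poly set" where
  "monic_squarefree n = {D. lead_coeff D = 1 \<and> squarefree D \<and> degree D = n}"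

end

theory Submission
  imports Defs
begin

text \<open>
  Every class of \<open>A[\<surd>D]\<close> contains exactly one ideal \<open>u A + (v + \<surd>D) A\<close> with \<open>u\<close> monic,
  \<open>deg v < deg u \<le> g\<close> and \<open>u\<close> dividing \<open>v\<^sup>2 - D\<close>: scale an ideal by an element of minimal norm.
  Writing \<open>D = v\<^sup>2 + u w\<close>, the sum of the class numbers counts the triples \<open>(u, v, w)\<close> with
  \<open>deg v < deg u \<le> g\<close>, \<open>u\<close> and \<open>w\<close> monic and \<open>deg u + deg w = 2 g + 1\<close>, for which \<open>v\<^sup>2 + u w\<close> is
  square-free. The triples are equidistributed modulo any fixed modulus, and a residue computation
  modulo \<open>P\<^sup>2\<close> gives the density \<open>(1 - |P|\<^sup>-\<^sup>2) (1 - 1 / ((|P| + 1) |P|\<^sup>2))\<close> at each \<open>P\<close>.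
  The first factors cancel against the density of the square-free polynomials themselves.
  The irreducible \<open>P\<close> of large degree \<open>k\<close> contribute a fraction \<open>O(|P|\<^sup>-\<^sup>2)\<close> each, plus a boundary
  term that is negligible because there are at most \<open>q ^ k / k\<close> of them.
\<close>

subsection \<open>Polynomials of bounded degree\<close>

text \<open>Odd degree is what makes reduction work. In the norm a^2 - D b^2 the two terms have
  degrees of different parity, so they never cancel, and the degree of the norm behaves like a size.
  An element with b nonzero has norm of degree at least 2 g + 1, above 2 deg u, so the elements of
  least norm in a reduced ideal are the constant multiples of u; this gives uniqueness.
  Square-freeness of D, together with 2 being nonzero, makes the ideals invertible.

  There are q^(2 g + 1 + m) triples with deg u = m. The sum over m \<le> g is a geometric series
  dominated by its top terms, the origin of q^(3 g + 1) and of q / (q - 1), the value of zeta_A(2).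
  Relative to the q^(2 g + 1) monic polynomials of degree 2 g + 1 this leaves q^g = sqrt |D| / sqrt
  q.

  The delicate range is deg u and deg P both near g. There the boundary term is about 1 / q^g of the
  box for each P, and the trivial count q^k of monic polynomials would keep the total bounded but
  not small. The factor 1 / k saved in the count of irreducibles makes it O(1 / g).\<close>

definition polys_below :: "nat \<Rightarrow> 'a::zero poly set" where
  "polys_below d = {f. f = 0 \<or> degree f < d}"

definition monics :: "nat \<Rightarrow> 'a::zero_neq_one poly set" where
  "monics d = {f. lead_coeff f = 1 \<and> degree f = d}"

text \<open>This is the effect of the separate clause for 0: since \<open>degree 0 = 0\<close>, the
  condition \<open>degree f < 0\<close> alone would leave nothing, and neither the count q^0 = 1 nor
  the remainder modulo a nonzero constant would fit.\<close>

lemma polys_below_0 [simp]: "polys_below 0 = {0}"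
  by (auto simp: polys_below_def)

lemma polys_below_Suc: "polys_below (Suc d) = (\<lambda>(a, p). pCons a p) ` (UNIV \<times> polys_below d)"
proof (intro equalityI subsetI)
  fix f :: "'a poly" assume f: "f \<in> polys_below (Suc d)"
  obtain a p where ap: "f = pCons a p" by (cases f)
  then have "p \<in> polys_below d" using f by (auto simp: polys_below_def split: if_splits)
  then show "f \<in> (\<lambda>(a, p). pCons a p) ` (UNIV \<times> polys_below d)" using ap by auto
qed (auto simp: polys_below_def split: if_splits)

lemma finite_polys_below [simp]: "finite (polys_below d :: 'a::{zero, finite} poly set)"
  by (induction d) (auto simp: polys_below_Suc)

lemma card_polys_below: "card (polys_below d :: 'a::{zero, finite} poly set) = CARD('a) ^ d"
proof (induction d)
  case (Suc d)
  have "inj_on (\<lambda>(a, p). pCons a p) (UNIV \<times> polys_below d :: ('a \<times> 'a poly) set)"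
    by (auto simp: inj_on_def)
  then show ?case using Suc by (simp add: polys_below_Suc card_image card_cartesian_product)
qed simp

lemma zero_in_polys_below [simp]: "0 \<in> polys_below d"
  by (simp add: polys_below_def)

lemma polys_below_add:
  "f \<in> polys_below d \<Longrightarrow> g \<in> polys_below d \<Longrightarrow> f + g \<in> polys_below d"
  by (cases "f = 0 \<or> g = 0") (auto simp: polys_below_def intro: degree_add_less)

lemma polys_below_uminus: "(f :: 'a::ab_group_add poly) \<in> polys_below d \<Longrightarrow> - f \<in> polys_below d"
  by (auto simp: polys_below_def)

lemma polys_below_diff:
  "(f :: 'a::ab_group_add poly) \<in> polys_below d \<Longrightarrow> g \<in> polys_below d \<Longrightarrow> f - g \<in> polys_below d"
  using polys_below_add[of f d "- g"] polys_below_uminus by auto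

lemma polys_below_mono: "d \<le> e \<Longrightarrow> polys_below d \<subseteq> polys_below e"
  by (auto simp: polys_below_def)

lemma monom_plus_in_monics:
  assumes "r \<in> polys_below d"
  shows "Polynomial.monom 1 d + r \<in> (monics d :: 'a::comm_semiring_1 poly set)"
proof (cases "r = 0")
  case False
  then have "degree r < degree (Polynomial.monom (1::'a) d)"
    using assms by (simp add: polys_below_def degree_monom_eq)
  then show ?thesis
    by (simp add: monics_def degree_add_eq_left lead_coeff_add_le degree_monom_eq coeff_eq_0)
qed (simp add: monics_def degree_monom_eq)

lemma monics_minus_monom:
  assumes "f \<in> monics d"
  shows "f - Polynomial.monom 1 d \<in> (polys_below d :: 'a::comm_ring_1 poly set)"
proof (cases "d = 0")
  case True
  then show ?thesis using assms by (auto simp: monics_def polys_below_def elim!: degree_eq_zeroE)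
next
  case False
  have "degree (f - Polynomial.monom 1 d) < d"
    if "f \<noteq> Polynomial.monom 1 d"
  proof -
    have "degree (f - Polynomial.monom 1 d) \<le> d"
      using assms by (intro degree_diff_le) (auto simp: monics_def degree_monom_le)
    moreover have "Polynomial.coeff (f - Polynomial.monom 1 d) d = 0" using assms by (auto simp: monics_def)
    ultimately show ?thesis
      using that by (metis eq_iff_diff_eq_0 le_neq_implies_less leading_coeff_0_iff)
  qed
  then show ?thesis by (auto simp: polys_below_def)
qed

lemma monics_eq_image: "monics d = (+) (Polynomial.monom 1 d) ` (polys_below d :: 'a::comm_ring_1 poly set)"
proof (intro equalityI subsetI)
  fix f :: "'a poly" assume "f \<in> monics d"
  then show "f \<in> (+) (Polynomial.monom 1 d) ` polys_below d"
    using monics_minus_monom[of f d] by (intro image_eqI[of _ _ "f - Polynomial.monom 1 d"]) auto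
qed (auto intro: monom_plus_in_monics)

lemma finite_monics [simp]: "finite (monics d :: 'a::{comm_ring_1, finite} poly set)"
  by (simp add: monics_eq_image)

lemma card_monics: "card (monics d :: 'a::{comm_ring_1, finite} poly set) = CARD('a) ^ d"
  by (simp add: monics_eq_image card_image card_polys_below)

lemma degree_monics: "f \<in> monics d \<Longrightarrow> degree f = d"
  by (simp add: monics_def)

lemma monics_nonzero: "f \<in> monics d \<Longrightarrow> f \<noteq> 0"
  by (auto simp: monics_def)

lemma lead_coeff_monics: "f \<in> monics d \<Longrightarrow> lead_coeff f = 1"
  by (auto simp: monics_def)

section \<open>Remainders and residue classes\<close>

lemma mod_in_polys_below:
  fixes f M :: "'a::field poly"
  assumes "M \<noteq> 0"
  shows "f mod M \<in> polys_below (degree M)"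
  using degree_mod_less[OF assms, of f] by (auto simp: polys_below_def)

lemma mod_eq_self_polys_below:
  fixes f M :: "'a::field poly"
  assumes "f \<in> polys_below (degree M)"
  shows "f mod M = f"
  using assms by (auto simp: polys_below_def mod_poly_less)

lemma dvd_polys_below_eq_0:
  fixes f M :: "'a::field poly"
  assumes "M dvd f" "f \<in> polys_below (degree M)"
  shows "f = 0"
  using assms by (metis dvd_imp_mod_0 mod_eq_self_polys_below)

text \<open>Division with remainder: the members are r + M k, with k running freely over the
  polynomials of degree below e - deg M. For e = deg M only k = 0 is left.\<close>

lemma card_residue_polys_below:
  fixes M :: "'a::{field, finite} poly"
  assumes M: "M \<noteq> 0" "degree M \<le> e" and r: "r \<in> polys_below (degree M)"
  shows "card {f \<in> polys_below e. f mod M = r} = CARD('a) ^ (e - degree M)"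
proof -
  have "{f \<in> polys_below e. f mod M = r} = (\<lambda>k. r + M * k) ` polys_below (e - degree M)"
  proof (intro equalityI subsetI)
    fix f assume f: "f \<in> {f \<in> polys_below e. f mod M = r}"
    then have eq: "f = r + M * (f div M)" using mod_mult_div_eq[of f M] by auto
    have "f div M \<in> polys_below (e - degree M)"
    proof (cases "f div M = 0")
      case False
      then have "degree (M * (f div M)) = degree M + degree (f div M)"
        using M by (simp add: degree_mult_eq)
      moreover have "M * (f div M) \<in> polys_below e"
      proof -
        have "M * (f div M) = f - r" using eq by (simp add: algebra_simps)
        moreover have "r \<in> polys_below e" using r polys_below_mono[OF M(2)] by blast
        ultimately show ?thesis using f by (simp add: polys_below_diff)
      qed
      ultimately show ?thesis using False M by (auto simp: polys_below_def)
    qed simp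
    with eq show "f \<in> (\<lambda>k. r + M * k) ` polys_below (e - degree M)" by blast
  next
    fix f assume "f \<in> (\<lambda>k. r + M * k) ` polys_below (e - degree M)"
    then obtain k where k: "k \<in> polys_below (e - degree M)" "f = r + M * k" by blast
    have "M * k \<in> polys_below e"
      using k M by (cases "k = 0") (auto simp: polys_below_def degree_mult_eq)
    then have "f \<in> polys_below e"
      using k r polys_below_mono[OF M(2)] by (auto intro: polys_below_add)
    then show "f \<in> {f \<in> polys_below e. f mod M = r}"
      using k r by (simp add: mod_eq_self_polys_below)
  qed
  moreover have "inj_on (\<lambda>k. r + M * k) (polys_below (e - degree M))"
    using M by (auto simp: inj_on_def)
  ultimately show ?thesis by (simp add: card_image card_polys_below)
qed

text \<open>Subtracting T^e makes a monic polynomial an arbitrary one of lower degree and shifts the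
  residue class by T^e, so counts of monics reduce to those of \<open>polys_below\<close>.\<close>

lemma residue_monics_eq_image:
  fixes M :: "'a::field poly"
  assumes M: "M \<noteq> 0" and r: "r \<in> polys_below (degree M)"
  shows "{f \<in> monics e. f mod M = r} =
    (+) (Polynomial.monom 1 e) ` {f \<in> polys_below e. f mod M = (r - Polynomial.monom 1 e) mod M}"
proof -
  have "(Polynomial.monom 1 e + f) mod M = r \<longleftrightarrow> f mod M = (r - Polynomial.monom 1 e) mod M" for f
  proof -
    have "(Polynomial.monom 1 e + f) mod M = r \<longleftrightarrow> (Polynomial.monom 1 e + f) mod M = r mod M"
      using r by (simp add: mod_eq_self_polys_below)
    also have "\<dots> \<longleftrightarrow> f mod M = (r - Polynomial.monom 1 e) mod M"
      by (simp add: mod_eq_dvd_iff algebra_simps)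
    finally show ?thesis .
  qed
  then show ?thesis unfolding monics_eq_image by auto
qed

lemma card_residue_monics:
  fixes M :: "'a::{field, finite} poly"
  assumes M: "M \<noteq> 0" "degree M \<le> e" and r: "r \<in> polys_below (degree M)"
  shows "card {f \<in> monics e. f mod M = r} = CARD('a) ^ (e - degree M)"
  unfolding residue_monics_eq_image[OF M(1) r]
  using M by (simp add: card_image card_residue_polys_below mod_in_polys_below)

lemma card_dvd_polys_below:
  fixes M :: "'a::{field, finite} poly"
  assumes M: "M \<noteq> 0" "degree M \<le> e"
  shows "card {f \<in> polys_below e. M dvd f} = CARD('a) ^ (e - degree M)"
  using card_residue_polys_below[OF M zero_in_polys_below] by (simp add: mod_eq_0_iff_dvd)

lemma card_dvd_monics:
  fixes M :: "'a::{field, finite} poly"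
  assumes M: "M \<noteq> 0" "degree M \<le> e"
  shows "card {f \<in> monics e. M dvd f} = CARD('a) ^ (e - degree M)"
  using card_residue_monics[OF M zero_in_polys_below] by (simp add: mod_eq_0_iff_dvd)

text \<open>Two such polynomials differ by a multiple of M of degree below deg M, hence by 0. In the
  sieve this is the case where p^2 is too large for equidistribution; it produces the boundary
  term.\<close>

lemma card_residue_monics_le_1:
  fixes M :: "'a::{field, finite} poly"
  assumes "e < degree M"
  shows "card {f \<in> monics e. f mod M = r} \<le> 1"
proof -
  have "f = g" if "f \<in> monics e" "g \<in> monics e" "f mod M = g mod M" for f g
  proof -
    have "M dvd f - g" using that by (simp add: mod_eq_dvd_iff)
    moreover have "f - g \<in> polys_below (degree M)"
      using that assms by (intro polys_below_diff) (auto simp: polys_below_def monics_def)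
    ultimately show "f = g" using dvd_polys_below_eq_0 by fastforce
  qed
  then show ?thesis by (auto simp: card_le_Suc0_iff_eq)
qed

subsection \<open>Divisibility of polynomials over a field\<close>

text \<open>An element of least degree divides all others, by division with remainder. It is applied
  to the ideals (a, b) and (u, 2 v, w), and to the second coordinates of an ideal of
  A[sqrt D].\<close>

lemma poly_ideal_generator:
  fixes S :: "'a::field poly set"
  assumes nz: "f0 \<in> S" "f0 \<noteq> 0"
    and add: "\<And>f g. f \<in> S \<Longrightarrow> g \<in> S \<Longrightarrow> f + g \<in> S"
    and mult: "\<And>c f. f \<in> S \<Longrightarrow> c * f \<in> S"
  obtains g where "g \<in> S" "g \<noteq> 0" "\<And>f. f \<in> S \<longleftrightarrow> g dvd f"
proof -
  obtain g where g: "g \<in> S" "g \<noteq> 0" and min: "\<And>f. f \<in> S \<Longrightarrow> f \<noteq> 0 \<Longrightarrow> degree g \<le> degree f"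
    using ex_has_least_nat[of "\<lambda>f. f \<in> S \<and> f \<noteq> 0" f0 degree] nz by blast
  have "g dvd f" if f: "f \<in> S" for f
  proof (rule ccontr)
    assume "\<not> g dvd f"
    then have r: "f mod g \<noteq> 0" by (simp add: mod_eq_0_iff_dvd)
    have "f mod g = f + (- (f div g)) * g" by (simp add: minus_div_mult_eq_mod[symmetric])
    then have "f mod g \<in> S" using add mult f g by metis
    then show False using min[of "f mod g"] r degree_mod_less[OF g(2), of f] by simp
  qed
  moreover have "f \<in> S" if "g dvd f" for f
    using that mult[OF g(1)] by (auto elim!: dvdE simp: mult.commute)
  ultimately show ?thesis using that[OF g] by blast
qed

text \<open>A generator of the ideal (a, b) is a common divisor, hence a unit when a and b are
  coprime.\<close>

lemma coprime_poly_iff_bezout: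
  fixes a b :: "'a::field poly"
  shows "coprime a b \<longleftrightarrow> (\<exists>s t. s * a + t * b = 1)"
proof
  assume cop: "coprime a b"
  then have nz: "a \<noteq> 0 \<or> b \<noteq> 0" by auto
  define S where "S = {s * a + t * b |s t. True}"
  have ab: "a \<in> S" "b \<in> S"
    unfolding S_def by (auto intro: exI[of _ 1] exI[of _ 0])
  have add: "f + g \<in> S" if fg: "f \<in> S" "g \<in> S" for f g
  proof -
    obtain s t s' t' where "f = s * a + t * b" "g = s' * a + t' * b"
      using fg by (auto simp: S_def)
    then have "f + g = (s + s') * a + (t + t') * b" by (simp add: algebra_simps)
    then show ?thesis unfolding S_def by blast
  qed
  have mult: "c * f \<in> S" if f: "f \<in> S" for c f
  proof -
    obtain s t where "f = s * a + t * b" using f by (auto simp: S_def)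
    then have "c * f = (c * s) * a + (c * t) * b" by (simp add: algebra_simps)
    then show ?thesis unfolding S_def by blast
  qed
  obtain f0 where "f0 \<in> S" "f0 \<noteq> 0" using nz ab by blast
  then obtain g where g: "\<And>f. f \<in> S \<longleftrightarrow> g dvd f"
    using poly_ideal_generator[OF _ _ add mult] by blast
  then have "g dvd 1" using cop ab by (blast intro: coprime_common_divisor)
  then have "1 \<in> S" using g by blast
  then show "\<exists>s t. s * a + t * b = 1" unfolding S_def by auto
next
  assume "\<exists>s t. s * a + t * b = 1"
  then show "coprime a b" by (metis coprimeI dvd_add dvd_mult)
qed

lemma coprime_poly_mult_right:
  fixes a b c :: "'a::field poly"
  assumes "coprime a b" "coprime a c"
  shows "coprime a (b * c)"
proof -
  obtain s t s' t' where st: "s * a + t * b = 1" "s' * a + t' * c = 1"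
    using assms by (auto simp: coprime_poly_iff_bezout)
  have "(s * (s' * a + t' * c) + t * b * s') * a + (t * t') * (b * c)
      = (s * a + t * b) * (s' * a + t' * c)" by (simp add: algebra_simps)
  then show ?thesis unfolding coprime_poly_iff_bezout using st by auto
qed

lemma coprime_poly_prod_right:
  fixes a :: "'a::field poly"
  assumes "\<And>i. i \<in> I \<Longrightarrow> coprime a (f i)"
  shows "coprime a (prod f I)"
  using assms by (induction I rule: infinite_finite_induct) (auto intro: coprime_poly_mult_right)

lemma coprime_poly_square:
  fixes a b :: "'a::field poly"
  assumes "coprime a b"
  shows "coprime (a ^ 2) (b ^ 2)"
  using assms by (simp add: power2_eq_square coprime_poly_mult_right coprime_commute)

lemma mult_dvd_poly_coprime:
  fixes a b c :: "'a::field poly"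
  assumes "coprime a b" "a dvd c" "b dvd c"
  shows "a * b dvd c"
proof -
  obtain s t where st: "s * a + t * b = 1" using assms by (auto simp: coprime_poly_iff_bezout)
  have "c = (s * a + t * b) * c" using st by simp
  also have "\<dots> = s * (a * c) + t * (b * c)" by (simp add: algebra_simps)
  finally have "c = s * (a * c) + t * (b * c)" .
  moreover have "a * b dvd a * c" "a * b dvd b * c"
    using assms by (auto simp: mult.commute intro: mult_dvd_mono)
  ultimately show ?thesis by (metis dvd_add dvd_mult)
qed

lemma dvd_mult_poly_coprime:
  fixes a b c :: "'a::field poly"
  assumes "coprime a b" "a dvd b * c"
  shows "a dvd c"
proof -
  obtain s t where st: "s * a + t * b = 1" using assms by (auto simp: coprime_poly_iff_bezout)
  have "c = (s * a + t * b) * c" using st by simp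
  also have "\<dots> = a * (s * c) + t * (b * c)" by (simp add: algebra_simps)
  finally have "c = a * (s * c) + t * (b * c)" .
  moreover have "a dvd a * (s * c) + t * (b * c)" using assms(2) by (intro dvd_add) auto
  ultimately show ?thesis by simp
qed

lemma irreducible_coprime_poly:
  fixes p :: "'a::field poly"
  assumes "irreducible p" "\<not> p dvd f"
  shows "coprime p f"
proof (rule coprimeI)
  fix c assume c: "c dvd p" "c dvd f"
  then obtain d where d: "p = c * d" by blast
  then have "c dvd 1 \<or> d dvd 1" using assms by (auto simp: irreducible_def)
  moreover have False if "d dvd 1"
  proof -
    have "p dvd c" using d that by (simp add: mult_unit_dvd_iff)
    then show False using c assms dvd_trans by blast
  qed
  ultimately show "c dvd 1" by blast
qed

lemma monic_dvd_antisym: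
  fixes f g :: "'a::field poly"
  assumes "f dvd g" "g dvd f" "lead_coeff f = 1" "lead_coeff g = 1"
  shows "f = g"
proof -
  have nz: "f \<noteq> 0" "g \<noteq> 0" using assms by auto
  have "degree f = degree g"
    using assms nz by (meson dvd_imp_degree_le eq_iff)
  moreover obtain c where c: "g = f * c" using assms by blast
  ultimately have "degree c = 0" using nz by (auto simp: degree_mult_eq)
  then obtain k where k: "c = [:k:]" by (auto elim: degree_eq_zeroE)
  have "k \<noteq> 0" using c k nz by auto
  then have "k = 1" using assms c k by simp
  then show ?thesis using c k by simp
qed

section \<open>Monic irreducible polynomials\<close>

definition monic_irreducibles :: "nat \<Rightarrow> 'a::field poly set" where
  "monic_irreducibles k = {p \<in> monics k. irreducible p}"

lemma finite_monic_irreducibles [simp]: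
  "finite (monic_irreducibles k :: 'a::{field, finite} poly set)"
  by (simp add: monic_irreducibles_def)

lemma irreducible_degree_pos:
  fixes p :: "'a::field poly"
  assumes "irreducible p"
  shows "degree p > 0"
  using assms by (metis gr0I irreducible_def is_unit_iff_degree)

lemma monic_irreducibles_coprime:
  fixes p p' :: "'a::field poly"
  assumes "irreducible p" "irreducible p'" "lead_coeff p = 1" "lead_coeff p' = 1" "p \<noteq> p'"
  shows "coprime p p'"
proof (rule irreducible_coprime_poly[OF assms(1)])
  show "\<not> p dvd p'"
  proof
    assume "p dvd p'"
    moreover from this have "p' dvd p"
      using assms by (metis irreducible_altdef irreducible_not_unit)
    ultimately show False using assms monic_dvd_antisym by blast
  qed
qed

lemma monic_irreducible_factor_exists:
  fixes f :: "'a::field poly"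
  assumes "\<not> f dvd 1" "f \<noteq> 0"
  shows "\<exists>p. irreducible p \<and> lead_coeff p = 1 \<and> p dvd f"
  using assms
proof (induction "degree f" arbitrary: f rule: less_induct)
  case less
  show ?case
  proof (cases "irreducible f")
    case True
    define c where "c = inverse (lead_coeff f)"
    have c: "c \<noteq> 0" using less by (simp add: c_def)
    have "f = Polynomial.smult (inverse c) (Polynomial.smult c f)" using c by simp
    then have "Polynomial.smult c f dvd f" using c by (simp add: smult_dvd)
    moreover have "irreducible (Polynomial.smult c f)"
    proof -
      have u: "[:c:] dvd 1" using c by (simp add: is_unit_const_poly_iff dvd_field_iff)
      have "Polynomial.smult c f = [:c:] * f" by simp
      then show ?thesis using True u irreducible_mult_unit_left by metis
    qed
    moreover have "lead_coeff (Polynomial.smult c f) = 1" using less by (simp add: c_def)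
    ultimately show ?thesis by blast
  next
    case False
    then obtain a b where ab: "f = a * b" "\<not> a dvd 1" "\<not> b dvd 1"
      using less by (auto simp: irreducible_def)
    have nz: "a \<noteq> 0" "b \<noteq> 0" using ab less by auto
    have "degree b > 0" using ab nz by (metis gr0I is_unit_iff_degree)
    then have "degree a < degree f" using ab nz by (simp add: degree_mult_eq)
    from less(1)[OF this ab(2) nz(1)] show ?thesis using ab by auto
  qed
qed

lemma not_squarefree_poly_iff:
  fixes D :: "'a::field poly"
  assumes "D \<noteq> 0"
  shows "\<not> squarefree D \<longleftrightarrow> (\<exists>p. irreducible p \<and> lead_coeff p = 1 \<and> p ^ 2 dvd D)"
proof
  assume "\<not> squarefree D"
  then obtain x where x: "x ^ 2 dvd D" "\<not> x dvd 1" by (auto simp: squarefree_def)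
  then have "x \<noteq> 0" using assms by auto
  then obtain p where "irreducible p" "lead_coeff p = 1" "p dvd x"
    using monic_irreducible_factor_exists x by blast
  then show "\<exists>p. irreducible p \<and> lead_coeff p = 1 \<and> p ^ 2 dvd D"
    using x by (meson dvd_power_same dvd_trans)
qed (auto simp: squarefree_def irreducible_def)

subsection \<open>Counting irreducible polynomials\<close>

text \<open>Fermat's argument in the field A/p: unless p divides X, multiplication by X permutes the
  nonzero residues. Their product is therefore unchanged modulo p when multiplied by X^(q^k - 1),
  and it is invertible modulo p.\<close>

lemma irreducible_dvd_X_power_minus_X:
  fixes p :: "'a::{field, finite} poly"
  assumes p: "irreducible p"
  shows "p dvd [:0, 1:] ^ (CARD('a) ^ degree p) - [:0, 1:]"
proof -
  define X :: "'a poly" where "X = [:0, 1:]"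
  define k where "k = degree p"
  define S :: "'a poly set" where "S = polys_below k - {0}"
  have fin: "finite S" by (simp add: S_def)
  have card: "card S = CARD('a) ^ k - 1" by (simp add: S_def card_Diff_singleton card_polys_below)
  have Xpow: "X ^ (CARD('a) ^ k) - X = X * (X ^ card S - 1)"
  proof -
    have "CARD('a) ^ k = Suc (card S)" by (simp add: card)
    then show ?thesis by (simp add: algebra_simps)
  qed
  have p0: "p \<noteq> 0" using p by auto
  have "p dvd X * (X ^ card S - 1)"
  proof (cases "p dvd X")
    case False
    then have cop: "coprime p X" by (rule irreducible_coprime_poly[OF p])
    define h where "h r = (X * r) mod p" for r
    have inj: "inj_on h S"
    proof (rule inj_onI)
      fix r s assume rs: "r \<in> S" "s \<in> S" "h r = h s"
      then have "p dvd X * (r - s)" by (simp add: h_def mod_eq_dvd_iff algebra_simps)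
      then have "p dvd r - s" using cop dvd_mult_poly_coprime by blast
      moreover have "r - s \<in> polys_below (degree p)"
        using rs by (auto simp: S_def k_def intro: polys_below_diff)
      ultimately show "r = s" using dvd_polys_below_eq_0 by fastforce
    qed
    have "h ` S \<subseteq> S"
    proof
      fix y assume "y \<in> h ` S"
      then obtain r where r: "r \<in> S" "y = h r" by blast
      have "\<not> p dvd r"
        using r dvd_polys_below_eq_0[of p r] by (auto simp: S_def k_def)
      then have "\<not> p dvd X * r" using cop dvd_mult_poly_coprime by blast
      then show "y \<in> S"
        using r mod_in_polys_below[OF p0] by (simp add: S_def k_def h_def mod_eq_0_iff_dvd)
    qed
    with inj fin have img: "h ` S = S" by (simp add: endo_inj_surj)
    have "(\<Prod>r\<in>S. X * r) mod p = (\<Prod>r\<in>S. h r) mod p"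
      unfolding h_def by (rule mod_prod_eq[symmetric])
    also have "(\<Prod>r\<in>S. h r) = \<Prod>S"
      using prod.reindex[OF inj, of "\<lambda>x. x"] img by simp
    finally have "p dvd (\<Prod>r\<in>S. X * r) - \<Prod>S" by (simp add: mod_eq_dvd_iff)
    also have "(\<Prod>r\<in>S. X * r) - \<Prod>S = \<Prod>S * (X ^ card S - 1)"
      by (simp add: prod.distrib algebra_simps)
    finally have "p dvd \<Prod>S * (X ^ card S - 1)" .
    moreover have "coprime p (\<Prod>S)"
    proof -
      have "coprime p r" if "r \<in> S" for r
        using that dvd_polys_below_eq_0[of p r]
        by (intro irreducible_coprime_poly[OF p]) (auto simp: S_def k_def)
      then show ?thesis using coprime_poly_prod_right[of S p "\<lambda>x. x"] by simp
    qed
    ultimately show ?thesis using dvd_mult_poly_coprime dvd_mult by blast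
  qed auto
  then have "p dvd X ^ (CARD('a) ^ k) - X" unfolding Xpow .
  then show ?thesis by (simp only: X_def k_def)
qed

lemma prod_coprime_dvd_poly:
  fixes f :: "'b \<Rightarrow> 'a::field poly"
  assumes "finite I" "\<And>i. i \<in> I \<Longrightarrow> f i dvd g"
    and "\<And>i j. i \<in> I \<Longrightarrow> j \<in> I \<Longrightarrow> i \<noteq> j \<Longrightarrow> coprime (f i) (f j)"
  shows "prod f I dvd g"
  using assms
proof (induction I rule: finite_induct)
  case (insert i I)
  have "coprime (f i) (prod f I)"
    using insert by (intro coprime_poly_prod_right) blast
  then have "f i * prod f I dvd g" using insert by (intro mult_dvd_poly_coprime) auto
  then show ?case using insert by simp
qed simp

text \<open>Distinct monic irreducibles of degree k are pairwise coprime divisors of X^(q^k) - X, so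
  their product has degree at most q^k.\<close>

lemma card_monic_irreducibles_le:
  "k * card (monic_irreducibles k :: 'a::{field, finite} poly set) \<le> CARD('a) ^ k"
proof (cases "k = 0")
  case False
  define X :: "'a poly" where "X = [:0, 1:]"
  define N where "N = CARD('a) ^ k"
  let ?S = "monic_irreducibles k :: 'a poly set"
  have "card {0, 1 :: 'a} \<le> CARD('a)" by (rule card_mono) auto
  then have "CARD('a) \<ge> 2" by simp
  then have "2 ^ 1 \<le> N"
    unfolding N_def using False
    by (meson le_trans power_increasing power_mono less_one not_less one_le_numeral zero_le)
  then have N: "N \<ge> 2" by simp
  have degX: "degree (X ^ N) = N" by (simp add: X_def degree_power_eq)
  have "degree X < degree (X ^ N)" using N unfolding degX by (simp add: X_def)
  then have deg: "degree (X ^ N - X) = N"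
    using degree_add_eq_left[of "- X" "X ^ N"] degX by simp
  then have nz: "X ^ N - X \<noteq> 0" using N by auto
  have "\<Prod>?S dvd X ^ N - X"
  proof (rule prod_coprime_dvd_poly)
    show "p dvd X ^ N - X" if "p \<in> ?S" for p
      using that irreducible_dvd_X_power_minus_X[of p]
      by (auto simp: monic_irreducibles_def monics_def X_def N_def)
    show "coprime p p'" if "p \<in> ?S" "p' \<in> ?S" "p \<noteq> p'" for p p'
      using that by (intro monic_irreducibles_coprime) (auto simp: monic_irreducibles_def monics_def)
  qed simp
  then have "degree (\<Prod>?S) \<le> N" using nz deg dvd_imp_degree_le by metis
  moreover have "degree (\<Prod>?S) = (\<Sum>p\<in>?S. degree p)"
    by (rule degree_prod_sum_eq) (auto simp: monic_irreducibles_def)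
  moreover have "(\<Sum>p\<in>?S. degree p) = (\<Sum>p\<in>?S. k)"
    by (rule sum.cong) (auto simp: monic_irreducibles_def monics_def)
  ultimately show ?thesis by (simp add: N_def mult.commute)
qed simp

subsection \<open>Residues modulo a product of coprime moduli\<close>

definition residue_triples :: "'a::field poly \<Rightarrow> ('a poly \<times> 'a poly \<times> 'a poly) set" where
  "residue_triples M = polys_below (degree M) \<times> polys_below (degree M) \<times> polys_below (degree M)"

definition mod_triple ::
  "'a::field poly \<Rightarrow> 'a poly \<times> 'a poly \<times> 'a poly \<Rightarrow> 'a poly \<times> 'a poly \<times> 'a poly" where
  "mod_triple M = (\<lambda>(u, v, w). (u mod M, v mod M, w mod M))"

text \<open>Polynomial expressions in u, v, w behave this way. Stating the sieve for such F lets one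
  count serve twice: for v^2 + u w, and for the projection to w, which counts square-free
  polynomials.\<close>

definition congruence_preserving :: "('a::field poly \<times> 'a poly \<times> 'a poly \<Rightarrow> 'a poly) \<Rightarrow> bool" where
  "congruence_preserving F \<longleftrightarrow>
     (\<forall>d u v w u' v' w'. d dvd u - u' \<longrightarrow> d dvd v - v' \<longrightarrow> d dvd w - w' \<longrightarrow>
        d dvd F (u, v, w) - F (u', v', w'))"

definition sifted ::
  "('a::field poly \<times> 'a poly \<times> 'a poly \<Rightarrow> 'a poly) \<Rightarrow> 'a poly set \<Rightarrow>
   ('a poly \<times> 'a poly \<times> 'a poly) set" where
  "sifted F P = {t. \<forall>p\<in>P. \<not> p ^ 2 dvd F t}"

lemma finite_residue_triples [simp]: "finite (residue_triples (M :: 'a::{field, finite} poly))"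
  by (simp add: residue_triples_def)

lemma card_residue_triples:
  "card (residue_triples (M :: 'a::{field, finite} poly)) = CARD('a) ^ (3 * degree M)"
  by (simp add: residue_triples_def card_cartesian_product card_polys_below power_add numeral_3_eq_3)

lemma mod_triple_in: "M \<noteq> 0 \<Longrightarrow> mod_triple M t \<in> residue_triples M"
  by (auto simp: mod_triple_def residue_triples_def mod_in_polys_below split: prod.splits)

lemma congruence_preserving_mod:
  fixes F :: "'a::field poly \<times> 'a poly \<times> 'a poly \<Rightarrow> 'a poly"
  assumes "congruence_preserving F" "d dvd M"
  shows "d dvd F (mod_triple M t) \<longleftrightarrow> d dvd F t"
proof -
  obtain u v w where t: "t = (u, v, w)" by (cases t)
  have "d dvd x mod M - x" for x
  proof -
    have "x mod M - x = - (M * (x div M))" by (simp add: minus_mult_div_eq_mod[symmetric])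
    then show ?thesis using assms(2) by simp
  qed
  then have "d dvd F (mod_triple M t) - F t"
    using assms(1) unfolding t mod_triple_def congruence_preserving_def prod.case by blast
  from dvd_add_right_iff[OF this, of "F t"] show ?thesis by simp
qed

lemma sifted_mod_triple_iff:
  assumes "congruence_preserving F" "\<And>p. p \<in> P \<Longrightarrow> p ^ 2 dvd M"
  shows "mod_triple M t \<in> sifted F P \<longleftrightarrow> t \<in> sifted F P"
  unfolding sifted_def using congruence_preserving_mod[OF assms(1,2)] by auto

text \<open>Chinese remainder theorem. Injectivity holds because M N divides a difference of degree
  below deg (M N); surjectivity follows by comparing cardinalities.\<close>

lemma bij_betw_mod_triple:
  fixes M N :: "'a::{field, finite} poly"
  assumes cop: "coprime M N" and nz: "M \<noteq> 0" "N \<noteq> 0"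
  shows "bij_betw (\<lambda>t. (mod_triple M t, mod_triple N t)) (residue_triples (M * N))
           (residue_triples M \<times> residue_triples N)"
proof -
  let ?h = "\<lambda>t. (mod_triple M t, mod_triple N t)"
  have deg: "degree (M * N) = degree M + degree N" using nz by (simp add: degree_mult_eq)
  have eq: "f = g" if "f \<in> polys_below (degree (M * N))" "g \<in> polys_below (degree (M * N))"
    "f mod M = g mod M" "f mod N = g mod N" for f g
  proof -
    have "M * N dvd f - g"
      using that cop by (intro mult_dvd_poly_coprime) (auto simp: mod_eq_dvd_iff)
    then show ?thesis using that polys_below_diff dvd_polys_below_eq_0 by fastforce
  qed
  have inj: "inj_on ?h (residue_triples (M * N))"
    by (rule inj_onI) (auto simp: residue_triples_def mod_triple_def intro: eq)
  have "?h ` residue_triples (M * N) \<subseteq> residue_triples M \<times> residue_triples N"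
    using nz by (auto simp: mod_triple_in)
  moreover have "card (?h ` residue_triples (M * N)) = card (residue_triples M \<times> residue_triples N)"
    using inj by (simp add: card_image card_cartesian_product card_residue_triples deg
        distrib_left power_add)
  ultimately have "?h ` residue_triples (M * N) = residue_triples M \<times> residue_triples N"
    by (intro card_subset_eq) auto
  with inj show ?thesis by (simp add: bij_betw_def)
qed

text \<open>Whether p^2 divides F t depends only on t modulo M for p in \<open>P\<close>, and modulo
  N for p in \<open>Q\<close>, so the Chinese remainder bijection carries the sifted set to a
  product.\<close>

lemma card_sifted_mult:
  fixes M N :: "'a::{field, finite} poly"
  assumes cop: "coprime M N" and nz: "M \<noteq> 0" "N \<noteq> 0" and F: "congruence_preserving F"
    and P: "\<And>p. p \<in> P \<Longrightarrow> p ^ 2 dvd M" and Q: "\<And>p. p \<in> Q \<Longrightarrow> p ^ 2 dvd N"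
  shows "card (residue_triples (M * N) \<inter> sifted F (P \<union> Q)) =
    card (residue_triples M \<inter> sifted F P) * card (residue_triples N \<inter> sifted F Q)"
proof -
  let ?h = "\<lambda>t. (mod_triple M t, mod_triple N t)"
  note bij = bij_betw_mod_triple[OF cop nz]
  have "bij_betw ?h (residue_triples (M * N) \<inter> sifted F (P \<union> Q))
      ((residue_triples M \<inter> sifted F P) \<times> (residue_triples N \<inter> sifted F Q))"
  proof (rule bij_betw_subset[OF bij])
    have iff: "t \<in> sifted F (P \<union> Q) \<longleftrightarrow> ?h t \<in> sifted F P \<times> sifted F Q" for t
      using sifted_mod_triple_iff[OF F P, of P t] sifted_mod_triple_iff[OF F Q, of Q t]
      by (auto simp: sifted_def)
    have img: "?h ` residue_triples (M * N) = residue_triples M \<times> residue_triples N"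
      using bij by (simp add: bij_betw_def)
    have "?h ` (residue_triples (M * N) \<inter> sifted F (P \<union> Q)) =
        ?h ` residue_triples (M * N) \<inter> (sifted F P \<times> sifted F Q)"
      using iff by (auto simp del: mem_Sigma_iff)
    then show "?h ` (residue_triples (M * N) \<inter> sifted F (P \<union> Q)) =
        (residue_triples M \<inter> sifted F P) \<times> (residue_triples N \<inter> sifted F Q)"
      unfolding img by auto
  qed auto
  then show ?thesis by (simp add: bij_betw_same_card card_cartesian_product)
qed

lemma card_sifted_prod:
  fixes P :: "'a::{field, finite} poly set"
  assumes "finite P" and irr: "\<And>p. p \<in> P \<Longrightarrow> irreducible p \<and> lead_coeff p = 1"
    and F: "congruence_preserving F"
  shows "card (residue_triples (\<Prod>p\<in>P. p ^ 2) \<inter> sifted F P) =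
    (\<Prod>p\<in>P. card (residue_triples (p ^ 2) \<inter> sifted F {p}))"
  using assms(1,2)
proof (induction P rule: finite_induct)
  case empty
  then show ?case by (simp add: residue_triples_def sifted_def)
next
  case (insert p P)
  have "p \<noteq> 0" "0 \<notin> P" using insert by (metis insertCI not_irreducible_zero)+
  then have nz: "p ^ 2 \<noteq> 0" "(\<Prod>p\<in>P. p ^ 2) \<noteq> 0" using insert(1) by auto
  have "coprime p p'" if "p' \<in> P" for p'
    using insert that by (intro monic_irreducibles_coprime) auto
  then have cop: "coprime (p ^ 2) (\<Prod>p\<in>P. p ^ 2)"
    by (intro coprime_poly_prod_right coprime_poly_square) auto
  have "card (residue_triples (p ^ 2 * (\<Prod>p\<in>P. p ^ 2)) \<inter> sifted F ({p} \<union> P)) =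
      card (residue_triples (p ^ 2) \<inter> sifted F {p}) *
      card (residue_triples (\<Prod>p\<in>P. p ^ 2) \<inter> sifted F P)"
    using insert by (intro card_sifted_mult cop nz F) (auto intro: dvd_prodI)
  then show ?case using insert by simp
qed

text \<open>Let M be the product of the p^2. As soon as every side of the box is at least deg M, all
  residue triples modulo M are hit equally often, so the proportion of survivors is exactly the
  product of the local ones. Here q^(6 deg p) is the number of residue triples modulo p^2.\<close>

lemma card_box_sifted:
  fixes P :: "'a::{field, finite} poly set"
  assumes P: "finite P" "\<And>p. p \<in> P \<Longrightarrow> irreducible p \<and> lead_coeff p = 1"
    and F: "congruence_preserving F"
    and le: "(\<Sum>p\<in>P. 2 * degree p) \<le> a" "(\<Sum>p\<in>P. 2 * degree p) \<le> b"
      "(\<Sum>p\<in>P. 2 * degree p) \<le> c"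
  shows "real (card (monics a \<times> polys_below b \<times> monics c \<inter> sifted F P)) =
    real CARD('a) ^ (a + b + c) *
    (\<Prod>p\<in>P. card (residue_triples (p ^ 2) \<inter> sifted F {p}) / real CARD('a) ^ (6 * degree p))"
proof -
  define q where "q = CARD('a)"
  have q: "q > 0" by (simp add: q_def)
  define M where "M = (\<Prod>p\<in>P. p ^ 2)"
  have "0 \<notin> P" using P(2) not_irreducible_zero by blast
  then have M: "M \<noteq> 0" using P(1) by (auto simp: M_def)
  have "degree M = (\<Sum>p\<in>P. degree (p ^ 2))"
    unfolding M_def using \<open>0 \<notin> P\<close> by (intro degree_prod_sum_eq) auto
  also have "\<dots> = (\<Sum>p\<in>P. 2 * degree p)"
    using \<open>0 \<notin> P\<close> by (intro sum.cong) (auto intro!: degree_power_eq)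
  finally have degM: "degree M = (\<Sum>p\<in>P. 2 * degree p)" .
  let ?B = "monics a \<times> polys_below b \<times> monics c :: ('a poly \<times> 'a poly \<times> 'a poly) set"
  have fibre: "card {t \<in> ?B. mod_triple M t = r} =
      q ^ (a - degree M) * q ^ (b - degree M) * q ^ (c - degree M)"
    if r: "r \<in> residue_triples M" for r
  proof -
    obtain x y z where xyz: "r = (x, y, z)" by (cases r)
    have "{t \<in> ?B. mod_triple M t = r} = {f \<in> monics a. f mod M = x} \<times>
        {f \<in> polys_below b. f mod M = y} \<times> {f \<in> monics c. f mod M = z}"
      by (auto simp: xyz mod_triple_def)
    then show ?thesis
      using r le degM M
      by (simp add: card_cartesian_product xyz residue_triples_def card_residue_monics
          card_residue_polys_below q_def)
  qed
  define X where "X = residue_triples M \<inter> sifted F P"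
  have "p ^ 2 dvd M" if "p \<in> P" for p
    using that P(1) by (auto simp: M_def intro: dvd_prodI)
  then have "?B \<inter> sifted F P = (\<Union>r\<in>X. {t \<in> ?B. mod_triple M t = r})"
    unfolding X_def using sifted_mod_triple_iff[OF F, of P M] mod_triple_in[OF M] by fastforce
  also have "card \<dots> = (\<Sum>r\<in>X. card {t \<in> ?B. mod_triple M t = r})"
    by (intro card_UN_disjoint) (auto simp: X_def)
  also have "\<dots> = (\<Sum>r\<in>X. q ^ (a - degree M) * q ^ (b - degree M) * q ^ (c - degree M))"
    by (intro sum.cong fibre) (auto simp: X_def)
  finally have 1: "card (?B \<inter> sifted F P) =
      card X * (q ^ (a - degree M) * q ^ (b - degree M) * q ^ (c - degree M))" by simp
  have "card X = (\<Prod>p\<in>P. card (residue_triples (p ^ 2) \<inter> sifted F {p}))"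
    unfolding X_def M_def by (rule card_sifted_prod[OF P F])
  moreover have "real q ^ (3 * degree M) = (\<Prod>p\<in>P. real q ^ (6 * degree p))"
    unfolding degM by (simp add: sum_distrib_left power_sum)
  moreover have "real q ^ (a + b + c) = real q ^ (a - degree M) * real q ^ (b - degree M) *
      real q ^ (c - degree M) * real q ^ (3 * degree M)"
  proof -
    have "a + b + c = (a - degree M) + (b - degree M) + (c - degree M) + 3 * degree M"
      using le degM by simp
    then show ?thesis by (metis power_add)
  qed
  moreover have "(\<Prod>p\<in>P. real q ^ (6 * degree p)) \<noteq> 0" using q P(1) by simp
  ultimately show ?thesis
    unfolding 1 by (simp add: prod_dividef q_def)
qed

subsection \<open>Local densities\<close>

definition disc_form :: "'a::field poly \<times> 'a poly \<times> 'a poly \<Rightarrow> 'a poly" where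
  "disc_form = (\<lambda>(u, v, w). v ^ 2 + u * w)"

lemma congruence_preserving_disc_form: "congruence_preserving disc_form"
proof -
  have "d dvd v ^ 2 + u * w - (v' ^ 2 + u' * w')"
    if "d dvd u - u'" "d dvd v - v'" "d dvd w - w'" for d u v w u' v' w' :: "'a poly"
  proof -
    have "v ^ 2 + u * w - (v' ^ 2 + u' * w') =
        (v - v') * (v + v') + (u - u') * w + u' * (w - w')"
      by (simp add: algebra_simps power2_eq_square)
    then show ?thesis using that by simp
  qed
  then show ?thesis by (simp add: congruence_preserving_def disc_form_def)
qed

lemma congruence_preserving_snd_snd: "congruence_preserving (\<lambda>t. snd (snd t))"
  by (simp add: congruence_preserving_def)

lemma card_residue_sifted_snd_snd:
  fixes p :: "'a::{field, finite} poly"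
  assumes p: "p \<noteq> 0"
  shows "real (card (residue_triples (p ^ 2) \<inter> sifted (\<lambda>t. snd (snd t)) {p})) =
    real CARD('a) ^ (6 * degree p) * (1 - 1 / real CARD('a) ^ (2 * degree p))"
proof -
  let ?R = "polys_below (degree (p ^ 2)) :: 'a poly set"
  have deg: "degree (p ^ 2) = 2 * degree p" using p by (simp add: degree_power_eq)
  have "residue_triples (p ^ 2) \<inter> sifted (\<lambda>t. snd (snd t)) {p} = ?R \<times> ?R \<times> (?R - {0})"
    using dvd_polys_below_eq_0[of "p ^ 2"] by (auto simp: residue_triples_def sifted_def)
  moreover have "real (card (?R - {0})) = real CARD('a) ^ (2 * degree p) - 1"
    by (simp add: card_Diff_singleton card_polys_below deg of_nat_diff)
  ultimately show ?thesis
    by (simp add: card_cartesian_product card_polys_below deg field_simps flip: power_add)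
qed

text \<open>Since u is invertible modulo M, the map sending w to x + u w permutes the
  residues.\<close>

lemma card_roots_linear_mod:
  fixes M :: "'a::{field, finite} poly"
  assumes M: "M \<noteq> 0" and u: "coprime M u"
  shows "card {w \<in> polys_below (degree M). M dvd x + u * w} = 1"
proof -
  let ?R = "polys_below (degree M) :: 'a poly set"
  define h where "h w = (x + u * w) mod M" for w
  have inj: "inj_on h ?R"
  proof (rule inj_onI)
    fix w w' assume w: "w \<in> ?R" "w' \<in> ?R" "h w = h w'"
    then have "M dvd u * (w - w')" by (simp add: h_def mod_eq_dvd_iff algebra_simps)
    then have "M dvd w - w'" using u dvd_mult_poly_coprime by blast
    then show "w = w'" using w polys_below_diff dvd_polys_below_eq_0 by fastforce
  qed
  moreover have "h ` ?R \<subseteq> ?R" using mod_in_polys_below[OF M] by (auto simp: h_def)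
  ultimately have img: "h ` ?R = ?R" by (simp add: endo_inj_surj)
  then obtain w where w: "w \<in> ?R" "h w = 0" by (metis image_iff zero_in_polys_below)
  have "{w \<in> ?R. M dvd x + u * w} = {w}"
    using w inj by (auto simp: h_def mod_eq_0_iff_dvd inj_on_def)
  then show ?thesis by simp
qed

lemma irreducible_dvd_power2_iff:
  fixes p :: "'a::field poly"
  assumes "irreducible p"
  shows "p dvd v ^ 2 \<longleftrightarrow> p dvd v" and "p ^ 2 dvd v ^ 2 \<longleftrightarrow> p dvd v"
proof -
  show "p dvd v ^ 2 \<longleftrightarrow> p dvd v"
    using irreducible_coprime_poly[OF assms] dvd_mult_poly_coprime
    by (metis dvd_mult power2_eq_square)
  then show "p ^ 2 dvd v ^ 2 \<longleftrightarrow> p dvd v"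
    by (metis dvd_power_same dvd_trans dvd_triv_left power2_eq_square)
qed

text \<open>As p divides u, it divides v^2 and so v; then v^2 drops out modulo p^2, and cancelling
  the single factor p of u leaves p | w.\<close>

lemma square_dvd_disc_form_iff:
  fixes p :: "'a::field poly"
  assumes p: "irreducible p" and u: "p dvd u" "\<not> p ^ 2 dvd u"
  shows "p ^ 2 dvd disc_form (u, v, w) \<longleftrightarrow> p dvd v \<and> p dvd w"
proof -
  have p0: "p \<noteq> 0" using p by auto
  obtain u' where u': "u = p * u'" using u by blast
  then have nd: "\<not> p dvd u'" using u by (auto simp: power2_eq_square mult_dvd_mono)
  have uw: "p ^ 2 dvd u * w \<longleftrightarrow> p dvd w"
  proof
    assume "p ^ 2 dvd u * w"
    then have "p dvd u' * w" using p0 by (simp add: u' power2_eq_square mult.assoc)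
    then show "p dvd w" using irreducible_coprime_poly[OF p nd] dvd_mult_poly_coprime by blast
  qed (simp add: u' power2_eq_square mult.assoc)
  show ?thesis
  proof
    assume *: "p ^ 2 dvd disc_form (u, v, w)"
    then have "p dvd v ^ 2 + u * w"
      using dvd_trans[of p "p ^ 2"] by (simp add: disc_form_def power2_eq_square)
    then have "p dvd v ^ 2" using u(1) by (simp add: dvd_add_left_iff)
    then have v: "p dvd v" using irreducible_dvd_power2_iff[OF p] by blast
    then have "p ^ 2 dvd v ^ 2" by (rule dvd_power_same)
    then show "p dvd v \<and> p dvd w" using v * uw by (simp add: disc_form_def dvd_add_right_iff)
  next
    assume "p dvd v \<and> p dvd w"
    then show "p ^ 2 dvd disc_form (u, v, w)"
      using uw by (simp add: disc_form_def dvd_power_same)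
  qed
qed

text \<open>A nonzero residue u admits Q^2 pairs (v, w), whether u is a unit (one w for each v) or
  exactly divisible by p (both v and w divisible by p); u = 0 admits Q^3. The total is (Q^2 - 1) Q^2
  + Q^3, and Q^2 is moved to the left to avoid truncated subtraction.\<close>

lemma card_residue_disc_form_dvd:
  fixes p :: "'a::{field, finite} poly"
  assumes p: "irreducible p"
  defines "Q \<equiv> CARD('a) ^ degree p"
  shows "card {t \<in> residue_triples (p ^ 2). p ^ 2 dvd disc_form t} + Q ^ 2 = Q ^ 4 + Q ^ 3"
proof -
  have p0: "p \<noteq> 0" using p by auto
  define R where "R = (polys_below (degree (p ^ 2)) :: 'a poly set)"
  have finR [simp]: "finite R" by (simp add: R_def)
  have deg: "degree (p ^ 2) = 2 * degree p" using p0 by (simp add: degree_power_eq)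
  have cardR: "card R = Q ^ 2"
    by (simp add: R_def Q_def card_polys_below deg mult.commute flip: power_mult)
  have cardD: "card {f \<in> R. p dvd f} = Q"
    using card_dvd_polys_below[OF p0, of "degree (p ^ 2)"] by (simp add: R_def deg Q_def)
  define c where "c u = card {(v, w) \<in> R \<times> R. p ^ 2 dvd disc_form (u, v, w)}" for u
  have c1: "c u = Q ^ 2" if "\<not> p dvd u" for u
  proof -
    have "coprime u p" using irreducible_coprime_poly[OF p that] by (simp add: coprime_commute)
    then have cop: "coprime (p ^ 2) u"
      by (simp add: coprime_poly_mult_right power2_eq_square coprime_commute)
    have "{(v, w) \<in> R \<times> R. p ^ 2 dvd disc_form (u, v, w)} =
        (SIGMA v:R. {w \<in> R. p ^ 2 dvd v ^ 2 + u * w})" by (auto simp: disc_form_def)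
    then show ?thesis
      using card_roots_linear_mod[OF _ cop] p0 by (simp add: c_def R_def cardR[unfolded R_def])
  qed
  have c2: "c u = Q ^ 2" if "p dvd u" "\<not> p ^ 2 dvd u" for u
  proof -
    have "{(v, w) \<in> R \<times> R. p ^ 2 dvd disc_form (u, v, w)} = {f \<in> R. p dvd f} \<times> {f \<in> R. p dvd f}"
      using square_dvd_disc_form_iff[OF p that] by auto
    then show ?thesis by (simp add: c_def card_cartesian_product cardD power2_eq_square)
  qed
  have c3: "c 0 = Q ^ 3"
  proof -
    have "{(v, w) \<in> R \<times> R. p ^ 2 dvd disc_form (0, v, w)} = {f \<in> R. p dvd f} \<times> R"
      using irreducible_dvd_power2_iff(2)[OF p] by (auto simp: disc_form_def)
    then show ?thesis
      by (simp add: c_def card_cartesian_product cardD cardR power2_eq_square power3_eq_cube)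
  qed
  have eq: "{t \<in> residue_triples (p ^ 2). p ^ 2 dvd disc_form t} =
      (SIGMA u:R. {(v, w) \<in> R \<times> R. p ^ 2 dvd disc_form (u, v, w)})"
    by (auto simp: residue_triples_def R_def)
  have fin: "finite {(v, w) \<in> R \<times> R. p ^ 2 dvd disc_form (u, v, w)}" for u
    by (rule finite_subset[of _ "R \<times> R"]) auto
  have "card {t \<in> residue_triples (p ^ 2). p ^ 2 dvd disc_form t} = (\<Sum>u\<in>R. c u)"
    unfolding eq c_def by (rule card_SigmaI) (simp, intro ballI fin)
  also have "\<dots> = c 0 + (\<Sum>u\<in>R - {0}. c u)"
    by (rule sum.remove) (simp_all add: R_def)
  also have "(\<Sum>u\<in>R - {0}. c u) = (\<Sum>u\<in>R - {0}. Q ^ 2)"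
  proof (rule sum.cong)
    fix u assume "u \<in> R - {0}"
    then have "\<not> p ^ 2 dvd u" using dvd_polys_below_eq_0[of "p ^ 2" u] by (auto simp: R_def)
    then show "c u = Q ^ 2" using c1 c2 by blast
  qed simp
  also have "\<dots> = (Q ^ 2 - 1) * Q ^ 2"
    using cardR by (simp add: card_Diff_singleton R_def)
  finally have "card {t \<in> residue_triples (p ^ 2). p ^ 2 dvd disc_form t} = Q ^ 3 + (Q ^ 2 - 1) * Q ^ 2"
    using c3 by simp
  moreover have "Q ^ 2 \<le> Q ^ 4" by (intro power_increasing) (simp_all add: Q_def)
  ultimately show ?thesis by (simp add: algebra_simps diff_mult_distrib flip: power_add)
qed

text \<open>The bad proportion is 1 / Q^2 + 1 / Q^3 - 1 / Q^4, that is 1 / Q^2 + (Q - 1) / Q^4. The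
  last fraction equals (1 - 1 / Q^2) / ((Q + 1) Q^2), so 1 - 1 / Q^2 can be split off; this is the
  origin of |P| + 1.\<close>

lemma card_residue_sifted_disc_form:
  fixes p :: "'a::{field, finite} poly"
  assumes p: "irreducible p"
  defines "Q \<equiv> real CARD('a) ^ degree p"
  shows "real (card (residue_triples (p ^ 2) \<inter> sifted disc_form {p})) = 
    real CARD('a) ^ (6 * degree p) *
      ((1 - 1 / real CARD('a) ^ (2 * degree p)) * (1 - 1 / ((Q + 1) * Q ^ 2)))"
proof -
  let ?B = "{t \<in> residue_triples (p ^ 2). p ^ 2 dvd disc_form t}"
  have p0: "p \<noteq> 0" using p by auto
  have Q: "Q > 0" by (simp add: Q_def)
  have Qpow: "real CARD('a) ^ (n * degree p) = Q ^ n" for n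
    by (simp add: Q_def mult.commute flip: power_mult)
  have "card (residue_triples (p ^ 2)) = CARD('a) ^ (6 * degree p)"
    using p0 by (simp add: card_residue_triples degree_power_eq)
  then have "real (card (residue_triples (p ^ 2))) = Q ^ 6"
    using Qpow by simp
  moreover have "residue_triples (p ^ 2) \<inter> sifted disc_form {p} = residue_triples (p ^ 2) - ?B"
    by (auto simp: sifted_def)
  moreover have "card ?B \<le> card (residue_triples (p ^ 2))" by (rule card_mono) auto
  ultimately have "real (card (residue_triples (p ^ 2) \<inter> sifted disc_form {p})) = Q ^ 6 - real (card ?B)"
    by (simp add: card_Diff_subset of_nat_diff)
  also have "real (card ?B) = Q ^ 4 + Q ^ 3 - Q ^ 2"
    using card_residue_disc_form_dvd[OF p, THEN arg_cong[of _ _ real]] by (simp add: Q_def)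
  also have "Q ^ 6 - (Q ^ 4 + Q ^ 3 - Q ^ 2) = Q ^ 6 * ((1 - 1 / Q ^ 2) * (1 - 1 / ((Q + 1) * Q ^ 2)))"
    using Q by (simp add: divide_simps) (simp add: algebra_simps eval_nat_numeral)
  finally show ?thesis using Qpow by simp
qed

subsection \<open>Values divisible by the square of a large irreducible polynomial\<close>

text \<open>If p does not divide u, then w is confined to one class modulo p^2, which leaves at most
  q^c / q^(2 k) + 1 choices for each (u, v); the extra 1 adds up to q^(2 m). If p divides u, it
  divides v too, and these two conditions alone save the factor q^(2 k). The 2 collects the two
  cases.\<close>

lemma card_square_dvd_disc_form_le:
  fixes p :: "'a::{field, finite} poly"
  assumes p: "irreducible p" "degree p = k"
  defines "q \<equiv> real CARD('a)"
  shows "real (card {t \<in> monics m \<times> polys_below m \<times> monics c. p ^ 2 dvd disc_form t}) \<le>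
    2 * q ^ (2 * m + c) / q ^ (2 * k) + q ^ (2 * m)"
proof -
  have p0: "p \<noteq> 0" using p by auto
  have q: "q > 0" by (simp add: q_def)
  have deg: "degree (p ^ 2) = 2 * k" using p0 p by (simp add: degree_power_eq)
  define M :: "'a poly set" where "M = monics m"
  define B :: "'a poly set" where "B = polys_below m"
  define C :: "'a poly set" where "C = monics c"
  have fin [simp]: "finite M" "finite B" "finite C" by (simp_all add: M_def B_def C_def)
  have cards: "real (card M) = q ^ m" "real (card B) = q ^ m" "real (card C) = q ^ c"
    by (simp_all add: M_def B_def C_def q_def card_monics card_polys_below)
  define S1 where "S1 = (SIGMA x:{u \<in> M. \<not> p dvd u} \<times> B. {w \<in> C. p ^ 2 dvd snd x ^ 2 + fst x * w})"
  define S2 where "S2 = {u \<in> M. p dvd u} \<times> {v \<in> B. p dvd v} \<times> C"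
  have fin1: "finite S1" and fin2: "finite S2" by (simp_all add: S1_def S2_def)
  have fibre: "real (card {w \<in> C. p ^ 2 dvd v ^ 2 + u * w}) \<le> q ^ c / q ^ (2 * k) + 1"
    if "\<not> p dvd u" for u v
  proof -
    have "coprime u p" using irreducible_coprime_poly[OF p(1) that] by (simp add: coprime_commute)
    then have cop: "coprime (p ^ 2) u"
      by (simp add: coprime_poly_mult_right power2_eq_square coprime_commute)
    obtain r where r: "{w \<in> polys_below (degree (p ^ 2)). p ^ 2 dvd v ^ 2 + u * w} = {r}"
      using card_roots_linear_mod[OF _ cop, of "v ^ 2"] p0 by (auto simp: card_1_singleton_iff)
    have "w mod p ^ 2 = r" if "p ^ 2 dvd v ^ 2 + u * w" for w
    proof -
      have "v ^ 2 + u * w = v ^ 2 + u * (w mod p ^ 2) + p ^ 2 * (u * (w div p ^ 2))"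
        by (simp add: algebra_simps flip: distrib_left)
      then have "p ^ 2 dvd v ^ 2 + u * (w mod p ^ 2)"
        using that by (metis dvd_add_left_iff dvd_triv_left)
      then show ?thesis using r mod_in_polys_below[of "p ^ 2" w] p0 by auto
    qed
    then have "{w \<in> C. p ^ 2 dvd v ^ 2 + u * w} \<subseteq> {w \<in> C. w mod p ^ 2 = r}" by auto
    then have "card {w \<in> C. p ^ 2 dvd v ^ 2 + u * w} \<le> card {w \<in> C. w mod p ^ 2 = r}"
      by (intro card_mono) auto
    moreover have "real (card {w \<in> C. w mod p ^ 2 = r}) \<le> q ^ c / q ^ (2 * k) + 1"
    proof (cases "2 * k \<le> c")
      case True
      have "r \<in> polys_below (degree (p ^ 2))" using r by blast
      then have "real (card {w \<in> C. w mod p ^ 2 = r}) = q ^ (c - 2 * k)"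
        using card_residue_monics[of "p ^ 2" c r] True p0 deg by (simp add: C_def q_def)
      also have "\<dots> = q ^ c / q ^ (2 * k)" using True q by (simp add: power_diff)
      finally show ?thesis by simp
    next
      case False
      then have "real (card {w \<in> C. w mod p ^ 2 = r}) \<le> 1"
        using card_residue_monics_le_1[of c "p ^ 2" r] deg by (simp add: C_def)
      moreover have "0 \<le> q ^ c / q ^ (2 * k)" using q by simp
      ultimately show ?thesis by linarith
    qed
    ultimately show ?thesis by linarith
  qed
  have "{t \<in> M \<times> B \<times> C. p ^ 2 dvd disc_form t} \<subseteq> (\<lambda>((u, v), w). (u, v, w)) ` S1 \<union> S2"
  proof
    fix t assume t: "t \<in> {t \<in> M \<times> B \<times> C. p ^ 2 dvd disc_form t}"
    then obtain u v w where uvw: "t = (u, v, w)" "u \<in> M" "v \<in> B" "w \<in> C"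
      "p ^ 2 dvd v ^ 2 + u * w" by (auto simp: disc_form_def)
    show "t \<in> (\<lambda>((u, v), w). (u, v, w)) ` S1 \<union> S2"
    proof (cases "p dvd u")
      case True
      have "p dvd v ^ 2 + u * w"
        using uvw(5) dvd_trans[of p "p ^ 2"] by (simp add: power2_eq_square)
      then have "p dvd v ^ 2" using True by (simp add: dvd_add_left_iff)
      then have "p dvd v" using irreducible_dvd_power2_iff[OF p(1)] by blast
      then show ?thesis using uvw True by (simp add: S2_def)
    next
      case False
      then have "((u, v), w) \<in> S1" using uvw by (simp add: S1_def)
      then show ?thesis using uvw(1) by force
    qed
  qed
  then have "card {t \<in> M \<times> B \<times> C. p ^ 2 dvd disc_form t} \<le>
      card ((\<lambda>((u, v), w). (u, v, w)) ` S1 \<union> S2)"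
    using fin1 fin2 by (intro card_mono) auto
  also have "\<dots> \<le> card ((\<lambda>((u, v), w). (u, v, w)) ` S1) + card S2" by (rule card_Un_le)
  also have "\<dots> \<le> card S1 + card S2" using card_image_le[OF fin1] by (intro add_right_mono)
  finally have le: "real (card {t \<in> M \<times> B \<times> C. p ^ 2 dvd disc_form t}) \<le>
      real (card S1) + real (card S2)" by linarith
  have "real (card S1) \<le> q ^ m * q ^ m * (q ^ c / q ^ (2 * k) + 1)"
  proof -
    let ?X = "{u \<in> M. \<not> p dvd u} \<times> B"
    have "card S1 = (\<Sum>x\<in>?X. card {w \<in> C. p ^ 2 dvd snd x ^ 2 + fst x * w})"
      unfolding S1_def by (subst card_SigmaI) auto
    then have "real (card S1) = (\<Sum>x\<in>?X. real (card {w \<in> C. p ^ 2 dvd snd x ^ 2 + fst x * w}))"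
      by simp
    also have "\<dots> \<le> (\<Sum>x\<in>?X. q ^ c / q ^ (2 * k) + 1)"
      by (intro sum_mono fibre) auto
    also have "\<dots> = real (card ?X) * (q ^ c / q ^ (2 * k) + 1)" by simp
    also have "\<dots> \<le> q ^ m * q ^ m * (q ^ c / q ^ (2 * k) + 1)"
    proof (rule mult_right_mono)
      have "card ?X \<le> card (M \<times> B)" by (intro card_mono) auto
      then have "real (card ?X) \<le> real (card (M \<times> B))" by (simp only: of_nat_le_iff)
      also have "\<dots> = q ^ m * q ^ m" by (simp add: card_cartesian_product cards)
      finally show "real (card ?X) \<le> q ^ m * q ^ m" .
    qed (use q in simp)
    finally show ?thesis .
  qed
  moreover have "real (card S2) \<le> q ^ (2 * m + c) / q ^ (2 * k)"
  proof (cases "k \<le> m")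
    case True
    then have "real (card S2) = q ^ (m - k) * q ^ (m - k) * q ^ c"
      using card_dvd_polys_below[OF p0, of m] card_dvd_monics[OF p0, of m] p(2) cards(3)
      by (simp add: S2_def card_cartesian_product M_def B_def q_def)
    also have "\<dots> = q ^ (2 * m + c) / q ^ (2 * k)"
      using True q by (simp add: power_diff power_add mult_2)
    finally show ?thesis by simp
  next
    case False
    have "u \<noteq> 0 \<and> degree u < degree p" if "u \<in> M" for u
      using that False p by (auto simp: M_def monics_def)
    then have "S2 = {}"
      using dvd_imp_degree_le[of p] unfolding S2_def by fastforce
    then show ?thesis using q by simp
  qed
  moreover have "q ^ m * q ^ m * (q ^ c / q ^ (2 * k) + 1) + q ^ (2 * m + c) / q ^ (2 * k) =
      2 * q ^ (2 * m + c) / q ^ (2 * k) + q ^ (2 * m)"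
  proof -
    define A where "A = q ^ m"
    define B where "B = q ^ c / q ^ (2 * k)"
    have "q ^ (2 * m) = A * A" by (simp only: A_def mult_2 power_add)
    moreover from this have "q ^ (2 * m + c) / q ^ (2 * k) = A * A * B"
      by (simp add: B_def power_add)
    ultimately show ?thesis
      unfolding times_divide_eq_right[symmetric] A_def[symmetric] B_def[symmetric]
      by (simp add: algebra_simps)
  qed
  ultimately show ?thesis using le by (simp add: M_def B_def C_def)
qed

subsection \<open>Ideals of a quadratic order\<close>

text \<open>Multiplication of elements a + b sqrt D with polynomial coordinates: the order without
  denominators. The link to \<open>quadratic_field\<close> is
  \<open>quadratic_embed\<close>.\<close>

definition qmul :: "'a::field poly \<Rightarrow> 'a poly \<times> 'a poly \<Rightarrow> 'a poly \<times> 'a poly \<Rightarrow> 'a poly \<times> 'a poly" where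
  "qmul D = (\<lambda>(a, b) (c, d). (a * c + D * b * d, a * d + b * c))"

definition qnorm :: "'a::field poly \<Rightarrow> 'a poly \<times> 'a poly \<Rightarrow> 'a poly" where
  "qnorm D = (\<lambda>(a, b). a ^ 2 - D * b ^ 2)"

text \<open>The A-module u A + (v + sqrt D) A. It is an ideal of A[sqrt D] when u divides v^2 -
  D.\<close>

definition mumford :: "'a::field poly \<Rightarrow> 'a poly \<Rightarrow> ('a poly \<times> 'a poly) set" where
  "mumford u v = {(u * x + v * y, y) |x y. True}"

text \<open>For square-free D of degree 2 g + 1 these are the reduced Mumford representations of
  divisor classes on the hyperelliptic curve y^2 = D of genus g.\<close>

definition mumford_reps :: "'a::field poly \<Rightarrow> nat \<Rightarrow> ('a poly \<times> 'a poly) set" where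
  "mumford_reps D g =
     {(u, v). lead_coeff u = 1 \<and> degree u \<le> g \<and> v \<in> polys_below (degree u) \<and> u dvd v ^ 2 - D}"

lemma qmul_commute: "qmul D x y = qmul D y x"
  by (cases x; cases y) (simp add: qmul_def algebra_simps)

lemma qmul_assoc: "qmul D (qmul D x y) z = qmul D x (qmul D y z)"
  by (cases x; cases y; cases z) (simp add: qmul_def algebra_simps)

lemma qmul_left_commute: "qmul D x (qmul D y z) = qmul D y (qmul D x z)"
  by (metis qmul_assoc qmul_commute)

lemma qmul_add: "qmul D x (y + z) = qmul D x y + qmul D x z"
  by (cases x; cases y; cases z) (simp add: qmul_def algebra_simps)

lemma qmul_diff: "qmul D x (y - z) = qmul D x y - qmul D x z"
  by (cases x; cases y; cases z) (simp add: qmul_def algebra_simps)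

lemma qmul_scalar: "qmul D (c, 0) (a, b) = (c * a, c * b)"
  by (simp add: qmul_def)

lemma qnorm_qmul: "qnorm D (qmul D x y) = qnorm D x * qnorm D y"
  by (cases x; cases y) (simp add: qnorm_def qmul_def algebra_simps power2_eq_square)

lemma mumford_iff: "(a, b) \<in> mumford u v \<longleftrightarrow> u dvd a - v * b"
proof
  assume "u dvd a - v * b"
  then obtain x where "a - v * b = u * x" by blast
  then have "(a, b) = (u * x + v * b, b)" by (simp add: algebra_simps)
  then show "(a, b) \<in> mumford u v" unfolding mumford_def by blast
qed (auto simp: mumford_def)

section \<open>Norms and reduced ideals in odd degree\<close>

context
  fixes D :: "'a::field poly"
  assumes odd: "odd (degree D)"
begin

lemma D_nonzero: "D \<noteq> 0"
  using odd by auto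

text \<open>The numbers 2 deg a and 2 deg b + deg D have different parity, so the leading terms of
  a^2 and D b^2 cannot cancel, and the degree of the norm is the larger of the two.\<close>

lemma degree_qnorm:
  assumes b: "b \<noteq> 0"
  shows "degree (qnorm D (a, b)) \<ge> 2 * degree b + degree D"
    and "qnorm D (a, b) \<noteq> 0"
    and "2 * degree a < N \<Longrightarrow> 2 * degree b + degree D < N \<Longrightarrow> degree (qnorm D (a, b)) < N"
proof -
  have degDb: "degree (D * b ^ 2) = 2 * degree b + degree D"
    using b D_nonzero by (simp add: degree_mult_eq degree_power_eq)
  have dega: "degree (a ^ 2) = 2 * degree a"
    by (cases "a = 0") (simp_all add: degree_power_eq)
  have ne: "degree (a ^ 2) \<noteq> degree (D * b ^ 2)"
    using odd unfolding dega degDb by presburger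
  have deg: "degree (qnorm D (a, b)) = max (2 * degree a) (2 * degree b + degree D)"
  proof (cases "degree (a ^ 2) < degree (D * b ^ 2)")
    case True
    then have "degree (a ^ 2 + - (D * b ^ 2)) = degree (- (D * b ^ 2))"
      by (intro degree_add_eq_right) simp
    then show ?thesis using True dega degDb by (simp add: qnorm_def)
  next
    case False
    then have "degree (- (D * b ^ 2) + a ^ 2) = degree (a ^ 2)"
      using ne by (intro degree_add_eq_right) simp
    then show ?thesis using False dega degDb by (simp add: qnorm_def)
  qed
  then show "degree (qnorm D (a, b)) \<ge> 2 * degree b + degree D" by simp
  have "degree (qnorm D (a, b)) > 0" using deg odd by (cases "degree D") auto
  then show "qnorm D (a, b) \<noteq> 0" by auto
  show "2 * degree a < N \<Longrightarrow> 2 * degree b + degree D < N \<Longrightarrow> degree (qnorm D (a, b)) < N"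
    using deg by simp
qed

lemma qnorm_eq_0_iff [simp]: "qnorm D x = 0 \<longleftrightarrow> x = 0"
proof -
  obtain a b where x: "x = (a, b)" by (cases x)
  show ?thesis
  proof (cases "b = 0")
    case True
    then show ?thesis by (auto simp: x qnorm_def zero_prod_def)
  qed (use degree_qnorm(2) in \<open>auto simp: x zero_prod_def\<close>)
qed

lemma qmul_eq_0_iff [simp]: "qmul D x y = 0 \<longleftrightarrow> x = 0 \<or> y = 0"
  using qnorm_qmul[of D x y] by (metis mult_eq_0_iff qnorm_eq_0_iff)

lemma qmul_cancel: "x \<noteq> 0 \<Longrightarrow> qmul D x y = qmul D x z \<Longrightarrow> y = z"
  using qmul_eq_0_iff[of x "y - z"] by (simp add: qmul_diff)

text \<open>Multiplying J by the conjugate of an element of least norm turns that element into its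
  norm n, a polynomial, which has least norm in the new ideal L. Hence n generates the intersection
  of L with A. If e generates the ideal of second coordinates, then n = e u, first coordinates are
  divisible by e as well, and L = e (u A + (v + sqrt D) A). Minimality of n bounds deg u.\<close>

lemma mumford_reduction:
  assumes g: "degree D = 2 * g + 1"
    and nz: "z0 \<in> J" "z0 \<noteq> 0"
    and add: "\<And>y z. y \<in> J \<Longrightarrow> z \<in> J \<Longrightarrow> y + z \<in> J"
    and mul: "\<And>y z. z \<in> J \<Longrightarrow> qmul D y z \<in> J"
  shows "\<exists>\<alpha> e u v. \<alpha> \<noteq> 0 \<and> e \<noteq> 0 \<and> (u, v) \<in> mumford_reps D g \<and>
    qmul D \<alpha> ` J = qmul D (e, 0) ` mumford u v"
proof -
  obtain \<beta> where \<beta>: "\<beta> \<in> J" "\<beta> \<noteq> 0"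
    and min: "\<And>z. z \<in> J \<Longrightarrow> z \<noteq> 0 \<Longrightarrow> degree (qnorm D \<beta>) \<le> degree (qnorm D z)"
    using ex_has_least_nat[of "\<lambda>z. z \<in> J \<and> z \<noteq> 0" z0 "\<lambda>z. degree (qnorm D z)"] nz by blast
  define n where "n = qnorm D \<beta>"
  have n0: "n \<noteq> 0" using \<beta> by (simp add: n_def)
  define \<alpha> where "\<alpha> = (fst \<beta>, - snd \<beta>)"
  have \<alpha>0: "\<alpha> \<noteq> 0" using \<beta> by (cases \<beta>) (auto simp: \<alpha>_def zero_prod_def)
  have N\<alpha>: "qnorm D \<alpha> = n" by (cases \<beta>) (simp add: \<alpha>_def n_def qnorm_def)
  have \<alpha>\<beta>: "qmul D \<alpha> \<beta> = (n, 0)"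
    by (cases \<beta>) (simp add: \<alpha>_def n_def qnorm_def qmul_def algebra_simps power2_eq_square)
  define L where "L = qmul D \<alpha> ` J"
  have Ladd: "y + z \<in> L" if "y \<in> L" "z \<in> L" for y z
    using that add unfolding L_def by (auto simp flip: qmul_add)
  have Lmul: "qmul D y z \<in> L" if z: "z \<in> L" for y z
  proof -
    obtain x where "x \<in> J" "z = qmul D \<alpha> x" using z by (auto simp: L_def)
    then have "qmul D y z = qmul D \<alpha> (qmul D y x)" "qmul D y x \<in> J"
      using mul by (auto simp: qmul_left_commute)
    then show ?thesis unfolding L_def by blast
  qed
  have Lscal: "(c * a, c * b) \<in> L" if "(a, b) \<in> L" for a b c
    using Lmul[OF that, of "(c, 0)"] by (simp add: qmul_scalar)
  have Ldiff: "(a - a', b - b') \<in> L" if "(a, b) \<in> L" "(a', b') \<in> L" for a b a' b'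
    using Ladd[OF that(1) Lscal[OF that(2), of "-1"]] by simp
  have Lroot: "(D * b, a) \<in> L" if "(a, b) \<in> L" for a b
    using Lmul[OF that, of "(0, 1)"] by (simp add: qmul_def)
  \<comment> \<open>Every norm in J gets multiplied by n, the norm of \<alpha>, and no nonzero
    element of J has norm of degree below deg n.\<close>
  have Lmin: "2 * degree n \<le> degree (qnorm D z)" if z: "z \<in> L" "z \<noteq> 0" for z
  proof -
    obtain x where x: "x \<in> J" "z = qmul D \<alpha> x" using z by (auto simp: L_def)
    then have x0: "x \<noteq> 0" using z \<alpha>0 by auto
    have "degree (qnorm D z) = degree n + degree (qnorm D x)"
      using x x0 n0 by (simp add: qnorm_qmul N\<alpha> degree_mult_eq)
    then show ?thesis using min[OF x(1) x0] by (simp add: n_def)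
  qed
  have nL: "(n, 0) \<in> L" unfolding L_def \<alpha>\<beta>[symmetric] using \<beta> by blast
  have Ldvd: "n dvd a" if a: "(a, 0) \<in> L" for a
  proof (rule ccontr)
    assume "\<not> n dvd a"
    then have r0: "a mod n \<noteq> 0" by (simp add: mod_eq_0_iff_dvd)
    have "(a - (a div n) * n, 0 - (a div n) * 0) \<in> L" by (intro Ldiff Lscal a nL)
    then have "(a mod n, 0) \<in> L" by (simp add: minus_div_mult_eq_mod)
    then have "2 * degree n \<le> degree (qnorm D (a mod n, 0))"
      using r0 by (intro Lmin) (auto simp: zero_prod_def)
    also have "\<dots> = 2 * degree (a mod n)" using r0 by (simp add: qnorm_def degree_power_eq)
    finally show False using degree_mod_less[OF n0, of a] r0 by simp
  qed
  define S where "S = {b. \<exists>a. (a, b) \<in> L}"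
  have "n \<in> S" using Lroot[OF nL] by (auto simp: S_def)
  moreover have "b + b' \<in> S" if "b \<in> S" "b' \<in> S" for b b'
    using that Ladd unfolding S_def by fastforce
  moreover have "c * b \<in> S" if "b \<in> S" for b c
    using that Lscal unfolding S_def by blast
  ultimately obtain e0 where e0: "\<And>b. b \<in> S \<longleftrightarrow> e0 dvd b"
    using n0 by (metis poly_ideal_generator)
  then obtain u0 where u0: "n = e0 * u0" using \<open>n \<in> S\<close> by blast
  \<comment> \<open>A constant is moved from u0 to e0 to make u monic.\<close>
  define l where "l = lead_coeff u0"
  have l: "l \<noteq> 0" using u0 n0 by (auto simp: l_def)
  define u where "u = [:inverse l:] * u0"
  define e where "e = [:l:] * e0"
  have eu: "n = e * u" using l by (simp add: u_def e_def u0)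
  then have ue0: "e \<noteq> 0" "u \<noteq> 0" using n0 by auto
  have lead: "lead_coeff u = 1" using l by (simp add: u_def l_def)
  have e: "b \<in> S \<longleftrightarrow> e dvd b" for b
    using e0 l by (simp add: e_def smult_dvd_iff)
  obtain c where c: "(c, e) \<in> L" using e[of e] by (auto simp: S_def)
  \<comment> \<open>The element u (c + e sqrt D) - n sqrt D lies in A because n = e u; so it is a
    multiple of n.\<close>
  have "(u * c - 0, u * e - n) \<in> L"
    using Lscal[OF c, of u] Lroot[OF nL] by (intro Ldiff) auto
  then have "n dvd u * c" by (intro Ldvd) (simp add: eu mult.commute)
  then have "u * e dvd u * c" by (simp add: eu mult.commute)
  then have "e dvd c" using ue0 by simp
  then obtain v0 where v0: "c = e * v0" by blast
  define v where "v = v0 mod u"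
  have vu: "v \<in> polys_below (degree u)" using mod_in_polys_below[OF ue0(2)] by (simp add: v_def)
  have evL: "(e * v, e) \<in> L"
  proof -
    have "(c - (v0 div u) * n, e - (v0 div u) * 0) \<in> L" by (intro Ldiff Lscal c nL)
    moreover have "c - (v0 div u) * n = e * (v0 - (v0 div u) * u)"
      by (simp add: v0 eu algebra_simps)
    ultimately show ?thesis by (simp add: v_def minus_div_mult_eq_mod)
  qed
  have img: "qmul D (e, 0) ` mumford u v = {(e * a, e * b) |a b. u dvd a - v * b}"
    using mumford_iff by (force simp: qmul_scalar image_iff)
  have Leq: "L = qmul D (e, 0) ` mumford u v"
  proof (intro equalityI subsetI)
    fix z assume "z \<in> L"
    moreover obtain a b where z: "z = (a, b)" by (cases z)
    ultimately have ab: "(a, b) \<in> L" by simp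
    then have "e dvd b" using e by (auto simp: S_def)
    then obtain y where y: "b = e * y" by blast
    have "(a - y * (e * v), b - y * e) \<in> L" by (intro Ldiff Lscal ab evL)
    then have "n dvd a - y * (e * v)" by (intro Ldvd) (simp add: y mult.commute)
    then obtain x where "a - y * (e * v) = n * x" by blast
    then have "a = e * (u * x + v * y)" by (simp add: eu algebra_simps)
    moreover have "u dvd u * x + v * y - v * y" by simp
    ultimately show "z \<in> qmul D (e, 0) ` mumford u v" unfolding img z y by blast
  next
    fix z assume "z \<in> qmul D (e, 0) ` mumford u v"
    then obtain a b x where z: "z = (e * a, e * b)" "a - v * b = u * x"
      unfolding img by blast
    have "(x * n, x * 0) + (b * (e * v), b * e) \<in> L" by (intro Ladd Lscal evL nL)
    moreover have "x * n + b * (e * v) = e * a" using z(2) by (simp add: eu algebra_simps)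
    ultimately show "z \<in> L" using z(1) by (simp add: mult.commute)
  qed
  have "(D * e, e * v) \<in> L" by (rule Lroot[OF evL])
  then obtain a b where ab: "D * e = e * a" "e * v = e * b" "u dvd a - v * b"
    unfolding Leq img by blast
  then have "u dvd D - v * v" using ue0(1) by (simp add: mult.commute)
  then have uv: "u dvd v ^ 2 - D" by (simp add: power2_eq_square dvd_diff_commute)
  \<comment> \<open>If deg u > g, both v^2 and D have degree below 2 deg u, and e (v + sqrt D) has a
    norm of smaller degree than n^2, the norm of n.\<close>
  have "degree u \<le> g"
  proof (rule ccontr)
    assume "\<not> degree u \<le> g"
    then have gu: "2 * g + 1 < 2 * degree u" by simp
    have "2 * degree v < 2 * degree u" using vu gu by (auto simp: polys_below_def)
    then have "degree (qnorm D (v, 1)) < 2 * degree u"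
      using gu g by (intro degree_qnorm(3)) auto
    moreover have "qnorm D (v, 1) \<noteq> 0" by (rule degree_qnorm(2)) simp
    moreover have "qnorm D (e * v, e) = e ^ 2 * qnorm D (v, 1)"
      by (simp add: qnorm_def algebra_simps power2_eq_square)
    ultimately have "degree (qnorm D (e * v, e)) < 2 * degree e + 2 * degree u"
      using ue0 by (simp add: degree_mult_eq degree_power_eq)
    also have "\<dots> = 2 * degree n" using ue0 by (simp add: eu degree_mult_eq)
    also have "\<dots> \<le> degree (qnorm D (e * v, e))"
      using ue0 by (intro Lmin evL) (simp add: zero_prod_def)
    finally show False by simp
  qed
  then have "(u, v) \<in> mumford_reps D g" using lead vu uv by (simp add: mumford_reps_def)
  then show ?thesis using \<alpha>0 ue0 Leq unfolding L_def by blast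
qed

text \<open>A nonzero second coordinate forces a norm of degree at least 2 g + 1 > 2 deg u. What
  remains are the multiples of u in A, and among these equality means a constant multiple.\<close>

lemma mumford_min_norm:
  assumes g: "degree D = 2 * g + 1" and uv: "(u, v) \<in> mumford_reps D g"
    and z: "z \<in> mumford u v" "z \<noteq> 0"
  shows "2 * degree u \<le> degree (qnorm D z)"
    and "degree (qnorm D z) = 2 * degree u \<Longrightarrow> \<exists>c. c \<noteq> 0 \<and> z = ([:c:] * u, 0)"
proof -
  obtain x y where xy: "z = (u * x + v * y, y)" using z by (auto simp: mumford_def)
  have u: "lead_coeff u = 1" "degree u \<le> g" using uv by (auto simp: mumford_reps_def)
  have big: "2 * degree u < degree (qnorm D z)" if "y \<noteq> 0"
    using degree_qnorm(1)[OF that, of "u * x + v * y"] u g xy by simp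
  have eq: "degree (qnorm D z) = 2 * degree u + 2 * degree x \<and> x \<noteq> 0" if "y = 0"
    using that xy z u by (auto simp: qnorm_def zero_prod_def degree_power_eq degree_mult_eq)
  show "2 * degree u \<le> degree (qnorm D z)" using big eq by fastforce
  assume "degree (qnorm D z) = 2 * degree u"
  then have "y = 0" "degree x = 0" "x \<noteq> 0" using big eq by fastforce+
  then show "\<exists>c. c \<noteq> 0 \<and> z = ([:c:] * u, 0)"
    using xy by (auto elim!: degree_eq_zeroE simp: mult.commute)
qed

text \<open>Elements of least norm must correspond, so \<alpha> u = c \<beta> u' with a constant c.
  After cancelling this relation, second coordinates show that u and u' divide each other, and first
  coordinates determine v modulo u.\<close>

lemma mumford_reps_unique:
  assumes g: "degree D = 2 * g + 1"
    and uv: "(u, v) \<in> mumford_reps D g" "(u', v') \<in> mumford_reps D g"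
    and nz: "\<alpha> \<noteq> 0" "\<beta> \<noteq> 0"
    and eq: "qmul D \<alpha> ` mumford u v = qmul D \<beta> ` mumford u' v'"
  shows "(u, v) = (u', v')"
proof -
  have u: "lead_coeff u = 1" "v \<in> polys_below (degree u)"
    and u': "lead_coeff u' = 1" "v' \<in> polys_below (degree u')"
    using uv by (auto simp: mumford_reps_def)
  then have u0: "u \<noteq> 0" "u' \<noteq> 0" by auto
  have memI: "(u, 0) \<in> mumford u v" "(u', 0) \<in> mumford u' v'" "(v, 1) \<in> mumford u v"
    "(v', 1) \<in> mumford u' v'" by (simp_all add: mumford_iff)
  obtain y where y: "y \<in> mumford u' v'" "qmul D \<alpha> (u, 0) = qmul D \<beta> y"
    using memI(1) eq by blast
  obtain x where x: "x \<in> mumford u v" "qmul D \<beta> (u', 0) = qmul D \<alpha> x"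
    using memI(2) eq by blast
  have u0': "(u, 0) \<noteq> (0 :: 'a poly \<times> 'a poly)" "(u', 0) \<noteq> (0 :: 'a poly \<times> 'a poly)"
    using u0 by (simp_all add: zero_prod_def)
  then have "qmul D \<alpha> (u, 0) \<noteq> 0" "qmul D \<beta> (u', 0) \<noteq> 0" using nz by simp_all
  then have xy0: "x \<noteq> 0" "y \<noteq> 0" using x y by auto
  have deg: "degree (qnorm D (qmul D s t)) = degree (qnorm D s) + degree (qnorm D t)"
    if "s \<noteq> 0" "t \<noteq> 0" for s t using that by (simp add: qnorm_qmul degree_mult_eq)
  have degu: "degree (qnorm D (t, 0)) = 2 * degree t" if "t \<noteq> 0" for t
    using that by (simp add: qnorm_def degree_power_eq)
  have 1: "degree (qnorm D \<alpha>) + 2 * degree u = degree (qnorm D \<beta>) + degree (qnorm D y)"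
    using arg_cong[OF y(2), of "\<lambda>z. degree (qnorm D z)"] nz u0 u0' xy0 degu
    by (simp add: deg)
  have 2: "degree (qnorm D \<beta>) + 2 * degree u' = degree (qnorm D \<alpha>) + degree (qnorm D x)"
    using arg_cong[OF x(2), of "\<lambda>z. degree (qnorm D z)"] nz u0 u0' xy0 degu
    by (simp add: deg)
  have "2 * degree u' \<le> degree (qnorm D y)" "2 * degree u \<le> degree (qnorm D x)"
    using mumford_min_norm(1)[OF g] uv x y xy0 by blast+
  \<comment> \<open>Adding 1 and 2 shows that the two lower bounds sum to an equality, so neither is
    strict.\<close>
  with 1 2 have "degree (qnorm D y) = 2 * degree u'" by linarith
  then obtain c where c: "c \<noteq> 0" "y = ([:c:] * u', 0)"
    using mumford_min_norm(2)[OF g uv(2) y(1) xy0(2)] by blast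
  \<comment> \<open>The factors \<alpha> and \<beta> are replaced by c u' and u, which lie in A and
    therefore act on each coordinate separately.\<close>
  have key: "qmul D ([:c:] * u', 0) s = qmul D (u, 0) t"
    if st: "qmul D \<alpha> s = qmul D \<beta> t" for s t
  proof (rule qmul_cancel[OF nz(2)])
    have "qmul D \<beta> (qmul D ([:c:] * u', 0) s) = qmul D (qmul D \<alpha> (u, 0)) s"
      using y(2) c by (simp add: qmul_assoc)
    also have "\<dots> = qmul D (u, 0) (qmul D \<alpha> s)" by (metis qmul_assoc qmul_commute)
    also have "\<dots> = qmul D \<beta> (qmul D (u, 0) t)" using st by (simp add: qmul_left_commute)
    finally show "qmul D \<beta> (qmul D ([:c:] * u', 0) s) = qmul D \<beta> (qmul D (u, 0) t)" .
  qed
  obtain t1 t2 where t: "(t1, t2) \<in> mumford u' v'" "qmul D \<alpha> (v, 1) = qmul D \<beta> (t1, t2)"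
    using memI(3) eq by (metis (no_types, lifting) imageE imageI surj_pair)
  from key[OF t(2)] have t12: "[:c:] * u' * v = u * t1" "[:c:] * u' = u * t2"
    unfolding qmul_scalar prod.inject by (auto simp only: mult_1_right)
  obtain s1 s2 where s: "(s1, s2) \<in> mumford u v" "qmul D \<alpha> (s1, s2) = qmul D \<beta> (v', 1)"
    using memI(4) eq by (metis (no_types, lifting) imageE imageI surj_pair)
  from key[OF s(2)] have "u = [:c:] * u' * s2"
    unfolding qmul_scalar prod.inject by (auto simp only: mult_1_right)
  then have "u' dvd u" by (metis dvd_triv_left mult.commute mult.left_commute)
  moreover have "u dvd u'"
  proof -
    have "u dvd [:c:] * u'" using t12(2) by simp
    then show ?thesis using c(1) by (simp add: dvd_smult_iff)
  qed
  ultimately have uu: "u = u'" using u(1) u'(1) monic_dvd_antisym by blast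
  have "u * t2 = u * [:c:]" using t12(2) uu by simp
  then have "t2 = [:c:]" using u0(1) by (simp only: mult_cancel_left) simp
  moreover have "u * t1 = u * ([:c:] * v)" using t12(1) unfolding uu by simp
  then have "t1 = [:c:] * v" using u0(1) by (simp only: mult_cancel_left) simp
  ultimately have "u dvd [:c:] * v - v' * [:c:]" using t(1) uu by (simp add: mumford_iff)
  also have "[:c:] * v - v' * [:c:] = [:c:] * (v - v')" by (simp add: smult_diff_right)
  finally have "u dvd v - v'" using c(1) by (simp add: dvd_smult_iff)
  moreover have "v - v' \<in> polys_below (degree u)" using u u' uu by (simp add: polys_below_diff)
  ultimately show ?thesis using uu dvd_polys_below_eq_0 by fastforce
qed

end

subsection \<open>The Picard group in terms of Mumford representations\<close>

lemma fractional_ideal_add: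
  "fractional_ideal K R I \<Longrightarrow> x \<in> I \<Longrightarrow> y \<in> I \<Longrightarrow> x \<oplus>\<^bsub>K\<^esub> y \<in> I"
  using subgroup.m_closed[of I "add_monoid K"] by (simp add: fractional_ideal_def)

lemma fractional_ideal_mult:
  "fractional_ideal K R I \<Longrightarrow> r \<in> R \<Longrightarrow> x \<in> I \<Longrightarrow> r \<otimes>\<^bsub>K\<^esub> x \<in> I"
  by (simp add: fractional_ideal_def)

context field
begin

context
  fixes S assumes S: "subring S R"
begin

lemma principal_times_ideal:
  assumes x: "x \<in> carrier R" and I: "fractional_ideal R S I"
  shows "((\<otimes>) x ` S) \<cdot> I = (\<otimes>) x ` I"
proof
  note Scar = subringE(1)[OF S]
  note Icar = fractional_ideal_carrier[OF S I]
  show "((\<otimes>) x ` S) \<cdot> I \<subseteq> (\<otimes>) x ` I"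
  proof
    fix s assume "s \<in> ((\<otimes>) x ` S) \<cdot> I"
    then show "s \<in> (\<otimes>) x ` I"
    proof induction
      case (prod i j)
      then obtain a where a: "a \<in> S" "i = x \<otimes> a" by auto
      have "a \<in> carrier R" "j \<in> carrier R" using a prod Scar Icar by auto
      then have "i \<otimes> j = x \<otimes> (a \<otimes> j)" using a x by (simp add: m_assoc)
      moreover have "a \<otimes> j \<in> I" using fractional_ideal_mult[OF I] a prod by blast
      ultimately show ?case by blast
    next
      case (sum s1 s2)
      then obtain a b where ab: "a \<in> I" "b \<in> I" "s1 = x \<otimes> a" "s2 = x \<otimes> b" by auto
      have "a \<in> carrier R" "b \<in> carrier R" using ab Icar by auto
      then have "s1 \<oplus> s2 = x \<otimes> (a \<oplus> b)" using ab x by (simp add: r_distr)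
      moreover have "a \<oplus> b \<in> I" using fractional_ideal_add[OF I] ab by blast
      ultimately show ?case by blast
    qed
  qed
  show "(\<otimes>) x ` I \<subseteq> ((\<otimes>) x ` S) \<cdot> I"
  proof
    fix s assume "s \<in> (\<otimes>) x ` I"
    then obtain a where a: "a \<in> I" "s = x \<otimes> a" by auto
    then have "s = (x \<otimes> \<one>) \<otimes> a" using x by simp
    moreover have "x \<otimes> \<one> \<in> (\<otimes>) x ` S" using subringE(3)[OF S] by blast
    ultimately show "s \<in> ((\<otimes>) x ` S) \<cdot> I" using a ideal_prod.prod by metis
  qed
qed

end

end

definition quadratic_embed :: "'a::field poly \<times> 'a poly \<Rightarrow> 'a poly fract \<times> 'a poly fract" where
  "quadratic_embed = (\<lambda>(a, b). (to_fract a, to_fract b))"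

lemma quadratic_order_eq_range: "quadratic_order = range quadratic_embed"
  by (auto simp: quadratic_order_def quadratic_embed_def image_iff)

lemma quadratic_embed_eq_iff [simp]: "quadratic_embed x = quadratic_embed y \<longleftrightarrow> x = y"
  by (cases x; cases y) (simp add: quadratic_embed_def)

lemma inj_quadratic_embed: "inj quadratic_embed"
  by (simp add: inj_def)

lemma carrier_quadratic_field [simp]: "carrier (quadratic_field D) = UNIV"
  by (simp add: quadratic_field_def)

lemma quadratic_embed_qmul:
  "quadratic_embed (qmul D x y) = quadratic_embed x \<otimes>\<^bsub>quadratic_field D\<^esub> quadratic_embed y"
  by (cases x; cases y) (simp add: quadratic_embed_def qmul_def quadratic_field_def)

lemma quadratic_embed_add:
  "quadratic_embed (x + y) = quadratic_embed x \<oplus>\<^bsub>quadratic_field D\<^esub> quadratic_embed y"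
  by (cases x; cases y) (simp add: quadratic_embed_def quadratic_field_def)

lemma quadratic_embed_zero: "quadratic_embed 0 = \<zero>\<^bsub>quadratic_field D\<^esub>"
  by (simp add: quadratic_embed_def quadratic_field_def zero_prod_def)

lemma quadratic_denominator:
  obtains \<delta> \<epsilon> where "\<delta> \<noteq> 0"
    "quadratic_embed \<delta> \<otimes>\<^bsub>quadratic_field D\<^esub> x = quadratic_embed (\<epsilon> :: 'a::field poly \<times> 'a poly)"
proof -
  obtain a b c d where x: "x = (Fract a b, Fract c d)" "b \<noteq> 0" "d \<noteq> 0"
    by (metis Fract_cases surj_pair)
  have "quadratic_embed (b * d, 0) \<otimes>\<^bsub>quadratic_field D\<^esub> x = quadratic_embed (d * a, b * c)"
    using x by (simp add: quadratic_field_def Fract_conv_to_fract quadratic_embed_def)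
  moreover have "(b * d, 0) \<noteq> (0 :: 'a poly \<times> 'a poly)" using x by (simp add: zero_prod_def)
  ultimately show ?thesis using that by blast
qed

abbreviation mumford_ideal ::
  "'a::field poly \<Rightarrow> 'a poly \<Rightarrow> ('a poly fract \<times> 'a poly fract) set" where
  "mumford_ideal u v \<equiv> quadratic_embed ` mumford u v"

lemma mumford_add: "x \<in> mumford u v \<Longrightarrow> y \<in> mumford u v \<Longrightarrow> x + y \<in> mumford u v"
proof -
  assume xy: "x \<in> mumford u v" "y \<in> mumford u v"
  obtain a b c d where ab: "x = (a, b)" "y = (c, d)" by (cases x; cases y)
  then have "u dvd (a - v * b) + (c - v * d)" using xy by (simp add: mumford_iff)
  also have "(a - v * b) + (c - v * d) = (a + c) - v * (b + d)" by (simp add: algebra_simps)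
  finally show ?thesis by (simp add: ab mumford_iff)
qed

text \<open>As v^2 = D modulo u, sending sqrt D to -v defines a ring homomorphism from A[sqrt D] to
  A/u, and \<open>mumford u v\<close> is its kernel.\<close>

lemma mumford_qmul:
  assumes u: "u dvd v ^ 2 - D" and y: "y \<in> mumford u v"
  shows "qmul D x y \<in> mumford u v"
proof -
  obtain a b c d where ab: "x = (a, b)" "y = (c, d)" by (cases x; cases y)
  have "u dvd c - v * d" using y by (simp add: ab mumford_iff)
  then have "u dvd (a - v * b) * (c - v * d) - (v ^ 2 - D) * (b * d)" using u by simp
  also have "\<dots> = (a * c + D * b * d) - v * (a * d + b * c)"
    by (simp add: algebra_simps power2_eq_square)
  finally show ?thesis by (simp add: ab mumford_iff qmul_def)
qed

section \<open>Invertible ideals and their classes for square-free D\<close>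

context
  fixes D :: "'a::field poly" and g :: nat
  assumes deg: "degree D = 2 * g + 1" and sqf: "squarefree D" and two: "(2 :: 'a) \<noteq> 0"
begin

lemma odd_degree: "odd (degree D)"
  using deg by simp

lemma field_K: "field (quadratic_field D)"
  using odd_degree_not_square[OF odd_degree] by (rule field_quadratic_field)

interpretation field "quadratic_field D"
  by (rule field_K)

lemma subring_order: "subring quadratic_order (quadratic_field D)"
  using odd_degree_not_square[OF odd_degree] by (rule subring_quadratic_order)

interpretation G: comm_group "fractional_ideal_group (quadratic_field D) quadratic_order"
  by (rule comm_group_fractional_ideal_group[OF subring_order])

lemma subgroup_principal:
  "subgroup (principal_fractional_ideals (quadratic_field D) quadratic_order) (fractional_ideal_group (quadratic_field D) quadratic_order)"
proof (rule subgroup_principal_fractional_ideals[OF subring_order])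
  fix x :: "'a poly fract \<times> 'a poly fract"
  obtain \<delta> \<epsilon> where "\<delta> \<noteq> 0" "quadratic_embed \<delta> \<otimes>\<^bsub>quadratic_field D\<^esub> x = quadratic_embed \<epsilon>"
    by (rule quadratic_denominator)
  then show "\<exists>d\<in>quadratic_order - {\<zero>\<^bsub>quadratic_field D\<^esub>}. d \<otimes>\<^bsub>quadratic_field D\<^esub> x \<in> quadratic_order"
    unfolding quadratic_order_eq_range quadratic_embed_zero[of D, symmetric]
    by (intro bexI[of _ "quadratic_embed \<delta>"]) auto
qed

lemma fractional_principal:
  assumes "x \<noteq> \<zero>\<^bsub>quadratic_field D\<^esub>"
  shows "fractional_ideal (quadratic_field D) quadratic_order ((\<otimes>\<^bsub>quadratic_field D\<^esub>) x ` quadratic_order)"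
proof -
  have "(\<otimes>\<^bsub>quadratic_field D\<^esub>) x ` quadratic_order \<in> principal_fractional_ideals (quadratic_field D) quadratic_order"
    unfolding principal_fractional_ideals_def carrier_quadratic_field using assms by blast
  then have "(\<otimes>\<^bsub>quadratic_field D\<^esub>) x ` quadratic_order \<in> carrier (fractional_ideal_group (quadratic_field D) quadratic_order)"
    using subgroup.subset[OF subgroup_principal] by blast
  then show ?thesis by (simp add: fractional_ideal_group_def invertible_fractional_ideal_def)
qed

lemma fractional_mumford_ideal:
  assumes u: "u \<noteq> 0" "u dvd v ^ 2 - D"
  shows "fractional_ideal (quadratic_field D) quadratic_order (mumford_ideal u v)"
  unfolding fractional_ideal_def
proof (intro conjI ballI)
  have u0: "(u, 0) \<in> mumford u v" by (simp add: mumford_iff)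
  show "subgroup (mumford_ideal u v) (add_monoid (quadratic_field D))"
  proof (rule add.subgroupI)
    show "mumford_ideal u v \<noteq> {}" using u0 by auto
  next
    fix x assume "x \<in> mumford_ideal u v"
    then obtain z where z: "z \<in> mumford u v" "x = quadratic_embed z" by blast
    have "- z \<in> mumford u v" using mumford_qmul[OF u(2) z(1), of "(-1, 0)"]
      by (cases z) (simp add: qmul_def)
    moreover have "\<ominus>\<^bsub>quadratic_field D\<^esub> x = quadratic_embed (- z)"
      using quadratic_embed_add[of "- z" z D]
      by (intro minus_equality) (simp_all add: z(2) quadratic_embed_zero[of D])
    ultimately show "\<ominus>\<^bsub>quadratic_field D\<^esub> x \<in> mumford_ideal u v" by blast
  next
    fix x y assume "x \<in> mumford_ideal u v" "y \<in> mumford_ideal u v"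
    then obtain z z' where "z \<in> mumford u v" "x = quadratic_embed z"
      "z' \<in> mumford u v" "y = quadratic_embed z'" by blast
    then show "x \<oplus>\<^bsub>quadratic_field D\<^esub> y \<in> mumford_ideal u v"
      using mumford_add[of z u v z'] by (simp add: imageI flip: quadratic_embed_add)
  qed auto
  show "r \<otimes>\<^bsub>quadratic_field D\<^esub> x \<in> mumford_ideal u v" if "r \<in> quadratic_order" "x \<in> mumford_ideal u v" for r x
    using that mumford_qmul[OF u(2)]
    by (auto simp: quadratic_order_eq_range simp flip: quadratic_embed_qmul)
  have "quadratic_embed (u, 0) \<noteq> \<zero>\<^bsub>quadratic_field D\<^esub>"
    using u by (simp add: quadratic_embed_zero[symmetric] zero_prod_def)
  then show "mumford_ideal u v \<noteq> {\<zero>\<^bsub>quadratic_field D\<^esub>}" using u0 by blast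
  show "\<exists>d\<in>quadratic_order - {\<zero>\<^bsub>quadratic_field D\<^esub>}. \<forall>x\<in>mumford_ideal u v. d \<otimes>\<^bsub>quadratic_field D\<^esub> x \<in> quadratic_order"
  proof (rule bexI[of _ "\<one>\<^bsub>quadratic_field D\<^esub>"])
    show "\<one>\<^bsub>quadratic_field D\<^esub> \<in> quadratic_order - {\<zero>\<^bsub>quadratic_field D\<^esub>}" using subringE(3)[OF subring_order] by simp
  qed (auto simp: quadratic_order_eq_range)
qed

text \<open>A generator h of the ideal (u, 2 v, w) divides v, because 2 is a nonzero constant; then
  h^2 divides v^2 - u w = D, so h is a unit.\<close>

lemma squarefree_bezout:
  assumes u: "u \<noteq> 0" and uw: "v ^ 2 - D = u * w"
  obtains a b c where "a * u + b * (2 * v) + c * w = 1"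
proof -
  define S where "S = {a * u + b * (2 * v) + c * w |a b c. True}"
  have memI: "a * u + b * (2 * v) + c * w \<in> S" for a b c unfolding S_def by blast
  have add: "s + t \<in> S" if st: "s \<in> S" "t \<in> S" for s t
  proof -
    obtain a b c a' b' c' where "s = a * u + b * (2 * v) + c * w" "t = a' * u + b' * (2 * v) + c' * w"
      using st by (auto simp: S_def)
    then have "s + t = (a + a') * u + (b + b') * (2 * v) + (c + c') * w"
      by (simp add: algebra_simps)
    then show ?thesis using memI by simp
  qed
  have mult: "d * s \<in> S" if s: "s \<in> S" for d s
  proof -
    obtain a b c where "s = a * u + b * (2 * v) + c * w" using s by (auto simp: S_def)
    then have "d * s = (d * a) * u + (d * b) * (2 * v) + (d * c) * w" by (simp add: algebra_simps)
    then show ?thesis using memI by simp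
  qed
  have mem: "u \<in> S" "2 * v \<in> S" "w \<in> S"
    using memI[of 1 0 0] memI[of 0 1 0] memI[of 0 0 1] by simp_all
  obtain h where h: "h \<in> S" "\<And>f. f \<in> S \<longleftrightarrow> h dvd f"
    using poly_ideal_generator[OF mem(1) u add mult] by blast
  have "2 * v = Polynomial.smult 2 v" by (simp add: numeral_poly)
  then have "h dvd v" using mem(2) h(2) two by (simp add: dvd_smult_iff)
  then have "h ^ 2 dvd v ^ 2" by (rule dvd_power_same)
  moreover have "h ^ 2 dvd u * w"
    using mem h(2) by (simp add: power2_eq_square mult_dvd_mono)
  ultimately have "h ^ 2 dvd v ^ 2 - u * w" by (rule dvd_diff)
  also have "v ^ 2 - u * w = D" by (simp flip: uw)
  finally have "h dvd 1" using sqf squarefreeD by blast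
  then have "1 \<in> S" using h(2) by blast
  then show ?thesis using that by (auto simp: S_def)
qed

text \<open>The product is generated by u^2, u (v + sqrt D), u (-v + sqrt D) and D - v^2 = -u w. All
  are multiples of u, and they combine to u times any element of the ideal (u, 2 v, w), which
  contains 1.\<close>

lemma mumford_ideal_prod_conjugate:
  assumes u: "u \<noteq> 0" "u dvd v ^ 2 - D"
  shows "mumford_ideal u v \<cdot>\<^bsub>quadratic_field D\<^esub> mumford_ideal u (- v) =
    (\<otimes>\<^bsub>quadratic_field D\<^esub>) (quadratic_embed (u, 0)) ` quadratic_order"
proof (intro equalityI subsetI)
  fix s assume "s \<in> mumford_ideal u v \<cdot>\<^bsub>quadratic_field D\<^esub> mumford_ideal u (- v)"
  then show "s \<in> (\<otimes>\<^bsub>quadratic_field D\<^esub>) (quadratic_embed (u, 0)) ` quadratic_order"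
  proof induction
    case (prod i j)
    then obtain a b c d where ij: "i = quadratic_embed (a, b)" "j = quadratic_embed (c, d)"
      and ab: "u dvd a - v * b" and cd: "u dvd c + v * d"
      by (auto simp: mumford_iff)
    have "u dvd (a - v * b) * c + v * b * (c + v * d) - (v ^ 2 - D) * (b * d)"
      by (intro dvd_add dvd_diff) (use ab cd u(2) in simp_all)
    also have "\<dots> = a * c + D * b * d" by (simp add: algebra_simps power2_eq_square)
    finally obtain r where r: "a * c + D * b * d = u * r" by blast
    have "u dvd (a - v * b) * d + b * (c + v * d)"
      by (intro dvd_add) (use ab cd in simp_all)
    also have "\<dots> = a * d + b * c" by (simp add: algebra_simps)
    finally obtain t where t: "a * d + b * c = u * t" by blast
    have "qmul D (a, b) (c, d) = qmul D (u, 0) (r, t)" using r t by (simp add: qmul_def)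
    then have "i \<otimes>\<^bsub>quadratic_field D\<^esub> j = quadratic_embed (u, 0) \<otimes>\<^bsub>quadratic_field D\<^esub> quadratic_embed (r, t)"
      unfolding ij by (metis quadratic_embed_qmul)
    then show ?case by (auto simp: quadratic_order_eq_range)
  next
    case (sum s1 s2)
    then obtain y z where yz: "s1 = quadratic_embed (u, 0) \<otimes>\<^bsub>quadratic_field D\<^esub> quadratic_embed y"
      "s2 = quadratic_embed (u, 0) \<otimes>\<^bsub>quadratic_field D\<^esub> quadratic_embed z"
      by (auto simp: quadratic_order_eq_range)
    have "s1 \<oplus>\<^bsub>quadratic_field D\<^esub> s2 = quadratic_embed (u, 0) \<otimes>\<^bsub>quadratic_field D\<^esub> quadratic_embed (y + z)"
      unfolding yz by (simp flip: quadratic_embed_qmul quadratic_embed_add add: qmul_add)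
    then show ?case by (auto simp: quadratic_order_eq_range)
  qed
next
  let ?P = "mumford_ideal u v \<cdot>\<^bsub>quadratic_field D\<^esub> mumford_ideal u (- v)"
  have u': "u dvd (- v) ^ 2 - D" using u by simp
  have fracP: "fractional_ideal (quadratic_field D) quadratic_order ?P"
    by (intro fractional_ideal_prod[OF subring_order] fractional_mumford_ideal u u')
  define T where "T = {z. quadratic_embed z \<in> ?P}"
  have Tadd: "y + z \<in> T" if "y \<in> T" "z \<in> T" for y z
    using that fractional_ideal_add[OF fracP] by (simp add: T_def quadratic_embed_add[of _ _ D])
  have Tmul: "qmul D y z \<in> T" if "z \<in> T" for y z
    using that fractional_ideal_mult[OF fracP]
    by (simp add: T_def quadratic_embed_qmul quadratic_order_eq_range)
  have Tprod: "qmul D y z \<in> T" if "y \<in> mumford u v" "z \<in> mumford u (- v)" for y z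
    unfolding T_def using that by (auto simp: quadratic_embed_qmul intro!: ideal_prod.prod)
  obtain w where w: "v ^ 2 - D = u * w" using u by blast
  obtain a b c where abc: "a * u + b * (2 * v) + c * w = 1"
    using squarefree_bezout[OF u(1) w] by blast
  have mem: "(u, 0) \<in> mumford u v" "(u, 0) \<in> mumford u (- v)" "(v, 1) \<in> mumford u v"
    "(- v, 1) \<in> mumford u (- v)" by (simp_all add: mumford_iff)
  \<comment> \<open>The two middle terms give b u (v + sqrt D) - b u (-v + sqrt D) = 2 b u v, and
    the last one -c (D - v^2) = c u w.\<close>
  define t where "t = qmul D (a, 0) (qmul D (u, 0) (u, 0)) + qmul D (b, 0) (qmul D (v, 1) (u, 0)) +
      qmul D (- b, 0) (qmul D (u, 0) (- v, 1)) + qmul D (- c, 0) (qmul D (v, 1) (- v, 1))"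
  have "t = (u * (a * u + b * (2 * v)) + c * (v ^ 2 - D), 0)"
    by (simp add: t_def qmul_def algebra_simps power2_eq_square)
  also have "\<dots> = (u * (a * u + b * (2 * v) + c * w), 0)"
    unfolding w by (simp add: algebra_simps)
  finally have "t = (u, 0)" by (simp add: abc)
  moreover have "t \<in> T" unfolding t_def by (intro Tadd Tmul Tprod mem)
  ultimately have uT: "(u, 0) \<in> T" by simp
  fix s assume "s \<in> (\<otimes>\<^bsub>quadratic_field D\<^esub>) (quadratic_embed (u, 0)) ` quadratic_order"
  then obtain z where "s = quadratic_embed (qmul D z (u, 0))"
    by (auto simp: quadratic_order_eq_range quadratic_embed_qmul qmul_commute[of _ _ "(u, 0)"]
        simp flip: quadratic_embed_qmul)
  then show "s \<in> ?P" using Tmul[OF uT, of z] by (simp add: T_def)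
qed

text \<open>The inverse is the conjugate ideal divided by u.\<close>

lemma mumford_ideal_in_carrier:
  assumes u: "u \<noteq> 0" "u dvd v ^ 2 - D"
  shows "mumford_ideal u v \<in> carrier (fractional_ideal_group (quadratic_field D) quadratic_order)"
proof -
  let ?I = "mumford_ideal u v" and ?I' = "mumford_ideal u (- v)"
  define x where "x = quadratic_embed (u, 0)"
  have x0: "x \<noteq> \<zero>\<^bsub>quadratic_field D\<^esub>"
    using u by (simp add: x_def quadratic_embed_zero[symmetric] zero_prod_def)
  then have xU: "x \<in> Units (quadratic_field D)" using field_Units by simp
  then have xi: "inv\<^bsub>quadratic_field D\<^esub> x \<otimes>\<^bsub>quadratic_field D\<^esub> x = \<one>\<^bsub>quadratic_field D\<^esub>" by simp
  then have xi0: "inv\<^bsub>quadratic_field D\<^esub> x \<noteq> \<zero>\<^bsub>quadratic_field D\<^esub>" by auto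
  define X where "X = (\<otimes>\<^bsub>quadratic_field D\<^esub>) (inv\<^bsub>quadratic_field D\<^esub> x) ` quadratic_order"
  have u': "u dvd (- v) ^ 2 - D" using u by simp
  have frac: "fractional_ideal (quadratic_field D) quadratic_order ?I" "fractional_ideal (quadratic_field D) quadratic_order ?I'"
    "fractional_ideal (quadratic_field D) quadratic_order X"
    unfolding X_def by (intro fractional_mumford_ideal u u' fractional_principal xi0)+
  have "?I \<cdot>\<^bsub>quadratic_field D\<^esub> (X \<cdot>\<^bsub>quadratic_field D\<^esub> ?I') = X \<cdot>\<^bsub>quadratic_field D\<^esub> (?I \<cdot>\<^bsub>quadratic_field D\<^esub> ?I')"
    by (metis carrier_quadratic_field ideal_prod_subset_assoc ideal_prod_subset_comm subset_UNIV)
  also have "\<dots> = X \<cdot>\<^bsub>quadratic_field D\<^esub> ((\<otimes>\<^bsub>quadratic_field D\<^esub>) x ` quadratic_order)"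
    unfolding x_def by (simp only: mumford_ideal_prod_conjugate[OF u])
  also have "\<dots> = (\<otimes>\<^bsub>quadratic_field D\<^esub>) (inv\<^bsub>quadratic_field D\<^esub> x \<otimes>\<^bsub>quadratic_field D\<^esub> x) ` quadratic_order"
    unfolding X_def by (rule principal_prod[OF subring_order]) auto
  also have "\<dots> = quadratic_order" unfolding xi by (simp add: image_def)
  finally have "?I \<cdot>\<^bsub>quadratic_field D\<^esub> (X \<cdot>\<^bsub>quadratic_field D\<^esub> ?I') = quadratic_order" .
  then show ?thesis
    using frac fractional_ideal_prod[OF subring_order]
    by (auto simp: fractional_ideal_group_def invertible_fractional_ideal_def)
qed

text \<open>A common denominator d makes J an ideal \<open>J0\<close> of A[sqrt D], to which
  reduction by an element of least norm applies; this yields x = e / (\<alpha> d).\<close>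

lemma fractional_ideal_eq_multiple_mumford:
  assumes J: "fractional_ideal (quadratic_field D) quadratic_order J"
  shows "\<exists>x u v. x \<noteq> \<zero>\<^bsub>quadratic_field D\<^esub> \<and> (u, v) \<in> mumford_reps D g \<and> J = (\<otimes>\<^bsub>quadratic_field D\<^esub>) x ` mumford_ideal u v"
proof -
  obtain d where d: "d \<in> quadratic_order - {\<zero>\<^bsub>quadratic_field D\<^esub>}"
    and dJ: "\<And>x. x \<in> J \<Longrightarrow> d \<otimes>\<^bsub>quadratic_field D\<^esub> x \<in> quadratic_order"
    using J unfolding fractional_ideal_def by blast
  define J0 where "J0 = {z. quadratic_embed z \<in> (\<otimes>\<^bsub>quadratic_field D\<^esub>) d ` J}"
  have Jadd: "x \<oplus>\<^bsub>quadratic_field D\<^esub> y \<in> J" if "x \<in> J" "y \<in> J" for x y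
    using that by (rule fractional_ideal_add[OF J])
  have Jmul: "r \<otimes>\<^bsub>quadratic_field D\<^esub> x \<in> J" if "r \<in> quadratic_order" "x \<in> J" for r x
    using that by (rule fractional_ideal_mult[OF J])
  obtain x0 where x0: "x0 \<in> J" "x0 \<noteq> \<zero>\<^bsub>quadratic_field D\<^esub>"
    using J fractional_ideal_zero[OF subring_order J] unfolding fractional_ideal_def by blast
  obtain z0 where z0: "d \<otimes>\<^bsub>quadratic_field D\<^esub> x0 = quadratic_embed z0"
    using dJ[OF x0(1)] unfolding quadratic_order_eq_range by blast
  have "d \<otimes>\<^bsub>quadratic_field D\<^esub> x0 \<noteq> \<zero>\<^bsub>quadratic_field D\<^esub>" using d x0 integral_iff[of d x0] by simp
  then have z0n: "z0 \<noteq> 0" unfolding z0 by (auto simp: quadratic_embed_zero[of D])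
  have z0J: "z0 \<in> J0" unfolding J0_def using x0 z0 by (metis (mono_tags) imageI mem_Collect_eq)
  have J0add: "y + z \<in> J0" if yz: "y \<in> J0" "z \<in> J0" for y z
  proof -
    obtain a b where ab: "a \<in> J" "b \<in> J" "quadratic_embed y = d \<otimes>\<^bsub>quadratic_field D\<^esub> a"
      "quadratic_embed z = d \<otimes>\<^bsub>quadratic_field D\<^esub> b" using yz by (auto simp: J0_def)
    then have "quadratic_embed (y + z) = d \<otimes>\<^bsub>quadratic_field D\<^esub> (a \<oplus>\<^bsub>quadratic_field D\<^esub> b)"
      by (simp add: quadratic_embed_add[of _ _ D] r_distr)
    then show ?thesis unfolding J0_def using Jadd ab by blast
  qed
  have J0mul: "qmul D y z \<in> J0" if z: "z \<in> J0" for y z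
  proof -
    obtain a where a: "a \<in> J" "quadratic_embed z = d \<otimes>\<^bsub>quadratic_field D\<^esub> a" using z by (auto simp: J0_def)
    then have "quadratic_embed (qmul D y z) = d \<otimes>\<^bsub>quadratic_field D\<^esub> (quadratic_embed y \<otimes>\<^bsub>quadratic_field D\<^esub> a)"
      by (simp add: quadratic_embed_qmul m_lcomm)
    then show ?thesis
      unfolding J0_def using Jmul[OF _ a(1), of "quadratic_embed y"]
      by (auto simp: quadratic_order_eq_range)
  qed
  obtain \<alpha> e u v where \<alpha>: "\<alpha> \<noteq> 0" "e \<noteq> 0" "(u, v) \<in> mumford_reps D g"
    and eq: "qmul D \<alpha> ` J0 = qmul D (e, 0) ` mumford u v"
    using mumford_reduction[OF odd_degree deg z0J z0n J0add J0mul] by blast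
  define c where "c = quadratic_embed \<alpha> \<otimes>\<^bsub>quadratic_field D\<^esub> d"
  define f where "f = quadratic_embed (e, 0)"
  have "quadratic_embed \<alpha> \<noteq> \<zero>\<^bsub>quadratic_field D\<^esub>" using \<alpha> by (simp add: quadratic_embed_zero[symmetric])
  then have "c \<noteq> \<zero>\<^bsub>quadratic_field D\<^esub>" using d integral_iff unfolding c_def by simp
  then have cU: "c \<in> Units (quadratic_field D)" using field_Units by simp
  then have ci: "inv\<^bsub>quadratic_field D\<^esub> c \<otimes>\<^bsub>quadratic_field D\<^esub> c = \<one>\<^bsub>quadratic_field D\<^esub>" by simp
  then have ci0: "inv\<^bsub>quadratic_field D\<^esub> c \<noteq> \<zero>\<^bsub>quadratic_field D\<^esub>" by auto
  have f0: "f \<noteq> \<zero>\<^bsub>quadratic_field D\<^esub>" using \<alpha> by (simp add: f_def quadratic_embed_zero[symmetric] zero_prod_def)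
  define x where "x = inv\<^bsub>quadratic_field D\<^esub> c \<otimes>\<^bsub>quadratic_field D\<^esub> f"
  have x: "x \<noteq> \<zero>\<^bsub>quadratic_field D\<^esub>" using ci0 f0 integral_iff by (simp add: x_def)
  have solve: "y = x \<otimes>\<^bsub>quadratic_field D\<^esub> s" if "c \<otimes>\<^bsub>quadratic_field D\<^esub> y = f \<otimes>\<^bsub>quadratic_field D\<^esub> s" for y s
  proof -
    have "y = inv\<^bsub>quadratic_field D\<^esub> c \<otimes>\<^bsub>quadratic_field D\<^esub> (c \<otimes>\<^bsub>quadratic_field D\<^esub> y)" using ci by (simp flip: m_assoc)
    then show ?thesis using that by (simp add: x_def m_assoc)
  qed
  have "J = (\<otimes>\<^bsub>quadratic_field D\<^esub>) x ` mumford_ideal u v"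
  proof (intro equalityI subsetI)
    fix y assume y: "y \<in> J"
    obtain z where z: "d \<otimes>\<^bsub>quadratic_field D\<^esub> y = quadratic_embed z"
      using dJ[OF y] unfolding quadratic_order_eq_range by blast
    then have "z \<in> J0" unfolding J0_def using y by (metis (mono_tags) imageI mem_Collect_eq)
    then obtain t where t: "t \<in> mumford u v" "qmul D \<alpha> z = qmul D (e, 0) t" using eq by blast
    have "c \<otimes>\<^bsub>quadratic_field D\<^esub> y = quadratic_embed (qmul D \<alpha> z)"
      by (simp add: c_def m_assoc z quadratic_embed_qmul)
    then have "y = x \<otimes>\<^bsub>quadratic_field D\<^esub> quadratic_embed t"
      by (intro solve) (simp add: t f_def quadratic_embed_qmul)
    then show "y \<in> (\<otimes>\<^bsub>quadratic_field D\<^esub>) x ` mumford_ideal u v" using t by blast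
  next
    fix s assume "s \<in> (\<otimes>\<^bsub>quadratic_field D\<^esub>) x ` mumford_ideal u v"
    then obtain t where t: "t \<in> mumford u v" "s = x \<otimes>\<^bsub>quadratic_field D\<^esub> quadratic_embed t" by blast
    then obtain z where z: "z \<in> J0" "qmul D (e, 0) t = qmul D \<alpha> z" using eq by blast
    then obtain y where y: "y \<in> J" "quadratic_embed z = d \<otimes>\<^bsub>quadratic_field D\<^esub> y" by (auto simp: J0_def)
    have "c \<otimes>\<^bsub>quadratic_field D\<^esub> y = quadratic_embed (qmul D \<alpha> z)"
      by (simp add: c_def m_assoc y quadratic_embed_qmul)
    then have "y = x \<otimes>\<^bsub>quadratic_field D\<^esub> quadratic_embed t"
      by (intro solve) (simp add: z(2)[symmetric] f_def quadratic_embed_qmul)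
    then show "s \<in> J" using t y by simp
  qed
  then show ?thesis using x \<alpha> by blast
qed

text \<open>Writing x = \<epsilon> / \<delta> and clearing the denominator reduces this to
  uniqueness for ideals of A[sqrt D].\<close>

lemma mumford_ideal_multiple_unique:
  assumes uv: "(u, v) \<in> mumford_reps D g" "(u', v') \<in> mumford_reps D g"
    and x: "x \<noteq> \<zero>\<^bsub>quadratic_field D\<^esub>" and eq: "mumford_ideal u' v' = (\<otimes>\<^bsub>quadratic_field D\<^esub>) x ` mumford_ideal u v"
  shows "(u, v) = (u', v')"
proof -
  obtain \<delta> \<epsilon> where \<delta>: "\<delta> \<noteq> 0" "quadratic_embed \<delta> \<otimes>\<^bsub>quadratic_field D\<^esub> x = quadratic_embed \<epsilon>"
    by (rule quadratic_denominator)
  have "quadratic_embed \<delta> \<noteq> \<zero>\<^bsub>quadratic_field D\<^esub>" using \<delta> by (simp add: quadratic_embed_zero[symmetric])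
  then have "quadratic_embed \<epsilon> \<noteq> \<zero>\<^bsub>quadratic_field D\<^esub>" using x integral_iff by (simp flip: \<delta>(2))
  then have \<epsilon>: "\<epsilon> \<noteq> 0" by (auto simp: quadratic_embed_zero[of D])
  have "quadratic_embed ` qmul D \<delta> ` mumford u' v' =
      (\<otimes>\<^bsub>quadratic_field D\<^esub>) (quadratic_embed \<delta>) ` mumford_ideal u' v'"
    by (simp add: image_image quadratic_embed_qmul)
  also have "\<dots> = (\<lambda>z. quadratic_embed \<delta> \<otimes>\<^bsub>quadratic_field D\<^esub> x \<otimes>\<^bsub>quadratic_field D\<^esub> quadratic_embed z) ` mumford u v"
    unfolding eq by (simp add: image_image m_assoc)
  also have "\<dots> = quadratic_embed ` qmul D \<epsilon> ` mumford u v"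
    by (simp add: image_image quadratic_embed_qmul \<delta>(2))
  finally have "qmul D \<epsilon> ` mumford u v = qmul D \<delta> ` mumford u' v'"
    by (simp only: inj_image_eq_iff[OF inj_quadratic_embed])
  then show ?thesis using mumford_reps_unique[OF odd_degree deg uv \<epsilon> \<delta>(1)] by blast
qed

theorem class_number_eq_card_mumford_reps: "class_number D = card (mumford_reps D g)"
proof -
  let ?G = "fractional_ideal_group (quadratic_field D) quadratic_order"
  let ?P = "principal_fractional_ideals (quadratic_field D) quadratic_order"
  note sub = subgroup_principal
  define \<Phi> where "\<Phi> = (\<lambda>(u, v). ?P #>\<^bsub>?G\<^esub> mumford_ideal u v)"
  have carrier: "mumford_ideal u v \<in> carrier ?G" if "(u, v) \<in> mumford_reps D g" for u v
    using that by (intro mumford_ideal_in_carrier) (auto simp: mumford_reps_def)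
  have times: "p \<otimes>\<^bsub>?G\<^esub> I = p \<cdot>\<^bsub>quadratic_field D\<^esub> I" for p I by (simp add: fractional_ideal_group_def)
  have coset_iff: "J \<in> ?P #>\<^bsub>?G\<^esub> I \<longleftrightarrow> (\<exists>x. x \<noteq> \<zero>\<^bsub>quadratic_field D\<^esub> \<and> J = (\<otimes>\<^bsub>quadratic_field D\<^esub>) x ` I)"
    if I: "I \<in> carrier ?G" for I J
  proof -
    have "fractional_ideal (quadratic_field D) quadratic_order I"
      using I by (simp add: fractional_ideal_group_def invertible_fractional_ideal_def)
    then have "((\<otimes>\<^bsub>quadratic_field D\<^esub>) x ` quadratic_order) \<cdot>\<^bsub>quadratic_field D\<^esub> I = (\<otimes>\<^bsub>quadratic_field D\<^esub>) x ` I" for x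
      by (intro principal_times_ideal[OF subring_order]) simp
    then show ?thesis
      unfolding r_coset_def principal_fractional_ideals_def times by fastforce
  qed
  have "inj_on \<Phi> (mumford_reps D g)"
  proof (rule inj_onI, clarify)
    fix u v u' v' assume uv: "(u, v) \<in> mumford_reps D g" "(u', v') \<in> mumford_reps D g"
      and eq: "\<Phi> (u, v) = \<Phi> (u', v')"
    have "mumford_ideal u' v' \<in> ?P #>\<^bsub>?G\<^esub> mumford_ideal u v"
      using G.rcos_self[OF carrier[OF uv(2)] sub] eq by (simp add: \<Phi>_def)
    then obtain x where "x \<noteq> \<zero>\<^bsub>quadratic_field D\<^esub>" "mumford_ideal u' v' = (\<otimes>\<^bsub>quadratic_field D\<^esub>) x ` mumford_ideal u v"
      unfolding coset_iff[OF carrier[OF uv(1)]] by (elim exE conjE)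
    from mumford_ideal_multiple_unique[OF uv this] show "u = u' \<and> v = v'" by simp
  qed
  moreover have "\<Phi> ` mumford_reps D g = rcosets\<^bsub>?G\<^esub> ?P"
  proof (intro equalityI subsetI)
    fix C assume "C \<in> \<Phi> ` mumford_reps D g"
    then show "C \<in> rcosets\<^bsub>?G\<^esub> ?P"
      using carrier by (auto simp: \<Phi>_def RCOSETS_def)
  next
    fix C assume "C \<in> rcosets\<^bsub>?G\<^esub> ?P"
    then obtain J where J: "J \<in> carrier ?G" "C = ?P #>\<^bsub>?G\<^esub> J" by (auto simp: RCOSETS_def)
    then have frac: "fractional_ideal (quadratic_field D) quadratic_order J"
      by (simp add: fractional_ideal_group_def invertible_fractional_ideal_def)
    obtain x u v where x: "x \<noteq> \<zero>\<^bsub>quadratic_field D\<^esub>" "(u, v) \<in> mumford_reps D g"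
      "J = (\<otimes>\<^bsub>quadratic_field D\<^esub>) x ` mumford_ideal u v"
      using fractional_ideal_eq_multiple_mumford[OF frac] by blast
    then have "J \<in> ?P #>\<^bsub>?G\<^esub> mumford_ideal u v" unfolding coset_iff[OF carrier[OF x(2)]] by (intro exI conjI)
    then have "C = \<Phi> (u, v)"
      using G.repr_independence[OF _ carrier[OF x(2)] sub] J by (simp add: \<Phi>_def)
    then show "C \<in> \<Phi> ` mumford_reps D g" using x by blast
  qed
  ultimately have "bij_betw \<Phi> (mumford_reps D g) (rcosets\<^bsub>?G\<^esub> ?P)" by (simp add: bij_betw_def)
  then have "card (mumford_reps D g) = card (rcosets\<^bsub>?G\<^esub> ?P)" by (rule bij_betw_same_card)
  then show ?thesis
    by (simp add: class_number_def picard_group_def Coset.order_def FactGroup_def)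
qed

end

subsection \<open>Averaging over discriminants\<close>

definition triple_box :: "nat \<Rightarrow> nat \<Rightarrow> ('a::field poly \<times> 'a poly \<times> 'a poly) set" where
  "triple_box n m = monics m \<times> polys_below m \<times> monics (n - m)"

lemma finite_triple_box [simp]: "finite (triple_box n m :: ('a::{field, finite} poly \<times> _) set)"
  by (simp add: triple_box_def)

lemma card_triple_box:
  assumes "m \<le> n"
  shows "card (triple_box n m :: ('a::{field, finite} poly \<times> _) set) = CARD('a) ^ (n + m)"
proof -
  have "card (triple_box n m :: ('a poly \<times> _) set) = CARD('a) ^ (m + (m + (n - m)))"
    by (simp only: triple_box_def card_cartesian_product card_monics card_polys_below power_add)
  moreover have "m + (m + (n - m)) = n + m" using assms by simp
  ultimately show ?thesis by (simp only:)
qed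

lemma monics_add:
  fixes f r :: "'a::comm_ring_1 poly"
  assumes "f \<in> monics n" "r \<in> polys_below n"
  shows "f + r \<in> monics n"
proof -
  obtain s where "s \<in> polys_below n" "f = Polynomial.monom 1 n + s"
    using assms(1) by (auto simp: monics_eq_image)
  then show ?thesis
    using assms(2) monom_plus_in_monics[of "s + r" n] polys_below_add by (metis add.assoc)
qed

lemma monics_mult:
  fixes f h :: "'a::field poly"
  assumes "f \<in> monics a" "h \<in> monics b"
  shows "f * h \<in> monics (a + b)"
proof -
  have "lead_coeff (f * h) = 1"
    by (simp only: lead_coeff_mult lead_coeff_monics[OF assms(1)] lead_coeff_monics[OF assms(2)] mult_1)
  moreover have "degree (f * h) = a + b"
    using degree_monics[OF assms(1)] degree_monics[OF assms(2)]
      monics_nonzero[OF assms(1)] monics_nonzero[OF assms(2)] by (simp add: degree_mult_eq)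
  ultimately show ?thesis by (simp add: monics_def)
qed

lemma monics_mult_cancel:
  fixes f h :: "'a::field poly"
  assumes "f \<in> monics a" "f * h \<in> monics n"
  shows "h \<in> monics (n - a)"
proof -
  have "lead_coeff f * lead_coeff h = 1"
    using lead_coeff_monics[OF assms(2)] by (simp only: lead_coeff_mult)
  moreover have "degree (f * h) = n" using assms by (simp add: degree_monics)
  ultimately show ?thesis
    using assms monics_nonzero[OF assms(2)] by (auto simp: monics_def degree_mult_eq)
qed

text \<open>For v nonzero, deg v^2 is at most 2 m - 2; hence the slack of 1 in the
  hypothesis.\<close>

lemma power2_in_polys_below:
  fixes v :: "'a::field poly"
  assumes "v \<in> polys_below m" "2 * m \<le> n + 1"
  shows "v ^ 2 \<in> polys_below n"
  using assms by (cases "v = 0") (auto simp: polys_below_def degree_power_eq)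

lemma disc_form_in_monics:
  assumes "t \<in> triple_box (2 * g + 1) m" "m \<le> g"
  shows "disc_form t \<in> monics (2 * g + 1)"
proof -
  obtain u v w where t: "t = (u, v, w)" by (cases t)
  then have "u \<in> monics m" "w \<in> monics (2 * g + 1 - m)" "v \<in> polys_below m"
    using assms(1) by (auto simp: triple_box_def)
  then have "u * w \<in> monics (m + (2 * g + 1 - m))" "v ^ 2 \<in> polys_below (2 * g + 1)"
    using assms(2) by (auto simp only: intro!: monics_mult power2_in_polys_below)
  then have "u * w + v ^ 2 \<in> monics (2 * g + 1)" using assms(2) by (intro monics_add) simp_all
  then show ?thesis by (simp add: t disc_form_def add.commute)
qed

lemma monic_squarefree_eq: "monic_squarefree n = {D \<in> monics n. squarefree D}"
  by (auto simp: monic_squarefree_def monics_def)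

lemma finite_mumford_reps [simp]: "finite (mumford_reps (D :: 'a::{field, finite} poly) g)"
proof (rule finite_subset)
  show "mumford_reps D g \<subseteq> (\<Union>m\<le>g. monics m \<times> polys_below m)"
    by (auto simp: mumford_reps_def monics_def)
qed auto

text \<open>Given (u, v), the polynomial w is recovered as (D - v^2) / u and D as v^2 + u w. For m
  \<le> g the degree of v^2 is below 2 g + 1, so D is monic of degree 2 g + 1 exactly when u w
  is.\<close>

lemma sum_class_number:
  assumes two: "(2 :: 'a::{field, finite}) \<noteq> 0"
  shows "(\<Sum>D\<in>(monic_squarefree (2 * g + 1) :: 'a poly set). class_number D) =
    (\<Sum>m\<le>g. card {t \<in> triple_box (2 * g + 1) m :: ('a poly \<times> _) set. squarefree (disc_form t)})"
proof -
  let ?n = "2 * g + 1"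
  let ?H = "monic_squarefree ?n :: 'a poly set"
  let ?X = "\<lambda>m. {t \<in> triple_box ?n m :: ('a poly \<times> _) set. squarefree (disc_form t)}"
  define \<phi> where "\<phi> = (\<lambda>(D, u, v). (u, v, (D - v ^ 2) div u) :: 'a poly \<times> 'a poly \<times> 'a poly)"
  define \<psi> where "\<psi> = (\<lambda>(u, v, w). (disc_form (u, v, w), u, v) :: 'a poly \<times> 'a poly \<times> 'a poly)"
  have finH: "finite ?H" by (simp add: monic_squarefree_eq)
  have "(\<Sum>D\<in>?H. class_number D) = (\<Sum>D\<in>?H. card (mumford_reps D g))"
    by (intro sum.cong class_number_eq_card_mumford_reps)
       (auto simp: monic_squarefree_def two)
  also have "\<dots> = card (SIGMA D:?H. mumford_reps D g)"
    using finH by simp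
  also have "\<dots> = card (\<Union>m\<le>g. ?X m)"
  proof (rule bij_betw_same_card[of \<phi>], rule bij_betw_byWitness[where f' = \<psi>])
    show "\<forall>x\<in>(SIGMA D:?H. mumford_reps D g). \<psi> (\<phi> x) = x"
    proof clarify
      fix D u v :: "'a poly" assume "(u, v) \<in> mumford_reps D g"
      then have "u dvd v ^ 2 - D" by (simp add: mumford_reps_def)
      then have "u dvd D - v ^ 2" by (simp add: dvd_diff_commute)
      then show "\<psi> (\<phi> (D, u, v)) = (D, u, v)" by (simp add: \<phi>_def \<psi>_def disc_form_def)
    qed
    show "\<forall>x\<in>(\<Union>m\<le>g. ?X m). \<phi> (\<psi> x) = x"
      by (auto simp: \<phi>_def \<psi>_def disc_form_def triple_box_def monics_def)
    show "\<phi> ` (SIGMA D:?H. mumford_reps D g) \<subseteq> (\<Union>m\<le>g. ?X m)"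
    proof (rule image_subsetI)
      fix x assume "x \<in> (SIGMA D:?H. mumford_reps D g)"
      then obtain D u v where x: "x = (D, u, v)" and D: "D \<in> ?H" and uv: "(u, v) \<in> mumford_reps D g"
        by auto
      define m where "m = degree u"
      have u: "u \<in> monics m" and v: "v \<in> polys_below m" and m: "m \<le> g"
        using uv by (auto simp: mumford_reps_def monics_def m_def)
      have "u dvd v ^ 2 - D" using uv by (simp add: mumford_reps_def)
      then have "u dvd D - v ^ 2" by (simp add: dvd_diff_commute)
      then obtain w where w: "D - v ^ 2 = u * w" by blast
      have "v ^ 2 \<in> polys_below ?n" using v m by (intro power2_in_polys_below) auto
      then have "D + - (v ^ 2) \<in> monics ?n"
        using D by (intro monics_add polys_below_uminus) (auto simp: monic_squarefree_eq)
      then have "u * w \<in> monics ?n" by (simp flip: w)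
      then have "w \<in> monics (?n - m)" using u monics_mult_cancel by blast
      moreover have "(D - v ^ 2) div u = w" using u monics_nonzero[OF u] by (simp add: w)
      moreover have "disc_form (u, v, w) = D" by (simp add: disc_form_def flip: w)
      ultimately have "\<phi> (D, u, v) \<in> ?X m"
        using u v D by (simp add: \<phi>_def triple_box_def monic_squarefree_eq)
      then show "\<phi> x \<in> (\<Union>m\<le>g. ?X m)" using m unfolding x by blast
    qed
    show "\<psi> ` (\<Union>m\<le>g. ?X m) \<subseteq> (SIGMA D:?H. mumford_reps D g)"
    proof (rule image_subsetI)
      fix x assume "x \<in> (\<Union>m\<le>g. ?X m)"
      then obtain m u v w where x: "x = (u, v, w)" and m: "m \<le> g"
        and t: "(u, v, w) \<in> triple_box ?n m" and sq: "squarefree (disc_form (u, v, w))"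
        by (cases x) auto
      have "disc_form (u, v, w) \<in> ?H"
        using disc_form_in_monics[OF t] m sq by (simp add: monic_squarefree_eq)
      moreover have "(u, v) \<in> mumford_reps (disc_form (u, v, w)) g"
        using t m by (auto simp: mumford_reps_def triple_box_def monics_def disc_form_def)
      ultimately show "\<psi> x \<in> (SIGMA D:?H. mumford_reps D g)"
        by (simp add: x \<psi>_def)
    qed
  qed
  also have "\<dots> = (\<Sum>m\<le>g. card (?X m))"
    by (intro card_UN_disjoint) (simp_all, auto simp: triple_box_def monics_def)
  finally show ?thesis .
qed

subsection \<open>The sieve\<close>

definition irreducibles_upto :: "nat \<Rightarrow> 'a::field poly set" where
  "irreducibles_upto K = (\<Union>k\<le>K. monic_irreducibles k)"

lemma finite_irreducibles_upto [simp]: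
  "finite (irreducibles_upto K :: 'a::{field, finite} poly set)"
  by (simp add: irreducibles_upto_def)

lemma irreducibles_upto_iff:
  "p \<in> irreducibles_upto K \<longleftrightarrow> irreducible p \<and> lead_coeff p = 1 \<and> degree p \<le> K"
  by (auto simp: irreducibles_upto_def monic_irreducibles_def monics_def)

lemma sum_irreducibles_upto:
  fixes f :: "'a::{field, finite} poly \<Rightarrow> real"
  shows "(\<Sum>p\<in>irreducibles_upto K. f p) = (\<Sum>k\<in>{0<..K}. \<Sum>p\<in>monic_irreducibles k. f p)"
proof -
  have "irreducibles_upto K = (\<Union>k\<in>{0<..K}. monic_irreducibles k :: 'a poly set)"
    using irreducible_degree_pos by (fastforce simp: irreducibles_upto_iff monic_irreducibles_def monics_def)
  also have "sum f \<dots> = (\<Sum>k\<in>{0<..K}. \<Sum>p\<in>monic_irreducibles k. f p)"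
    by (intro sum.UNION_disjoint) (simp_all, auto simp: monic_irreducibles_def monics_def)
  finally show ?thesis .
qed

text \<open>For deg p > g the square p^2 cannot divide a nonzero polynomial of degree at most 2 g +
  1. Beyond K only the degrees up to g remain, and a union bound handles them.\<close>

lemma card_squarefree_sieve:
  fixes F :: "'a::{field, finite} poly \<times> 'a poly \<times> 'a poly \<Rightarrow> 'a poly" and b :: "nat \<Rightarrow> real"
  assumes B: "finite B" and F: "\<And>t. t \<in> B \<Longrightarrow> F t \<noteq> 0 \<and> degree (F t) \<le> 2 * g + 1"
    and b: "\<And>k p. K < k \<Longrightarrow> k \<le> g \<Longrightarrow> p \<in> monic_irreducibles k \<Longrightarrow>
      real (card {t \<in> B. p ^ 2 dvd F t}) \<le> b k"
  shows "real (card {t \<in> B. squarefree (F t)}) \<le> real (card (B \<inter> sifted F (irreducibles_upto K)))"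
    and "real (card (B \<inter> sifted F (irreducibles_upto K))) \<le>
      real (card {t \<in> B. squarefree (F t)}) +
      (\<Sum>k\<in>{K<..g}. real (card (monic_irreducibles k :: 'a poly set)) * b k)"
proof -
  have "{t \<in> B. squarefree (F t)} \<subseteq> B \<inter> sifted F (irreducibles_upto K)"
    by (auto simp: sifted_def irreducibles_upto_iff squarefree_def irreducible_def)
  then show "real (card {t \<in> B. squarefree (F t)}) \<le> real (card (B \<inter> sifted F (irreducibles_upto K)))"
    using B by (simp add: card_mono)
  let ?T = "\<Union>k\<in>{K<..g}. \<Union>p\<in>monic_irreducibles k. {t \<in> B. p ^ 2 dvd F t}"
  have "B \<inter> sifted F (irreducibles_upto K) \<subseteq> {t \<in> B. squarefree (F t)} \<union> ?T"
  proof
    fix t assume t: "t \<in> B \<inter> sifted F (irreducibles_upto K)"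
    show "t \<in> {t \<in> B. squarefree (F t)} \<union> ?T"
    proof (cases "squarefree (F t)")
      case False
      then obtain p where p: "irreducible p" "lead_coeff p = 1" "p ^ 2 dvd F t"
        using not_squarefree_poly_iff F t by blast
      have "p \<notin> irreducibles_upto K" using t p by (auto simp: sifted_def)
      then have "K < degree p" using p by (auto simp: irreducibles_upto_iff)
      moreover have "degree (p ^ 2) \<le> 2 * g + 1"
        using dvd_imp_degree_le[OF p(3)] F t by fastforce
      then have "degree p \<le> g" using p(1) by (subst (asm) degree_power_eq) auto
      ultimately have "degree p \<in> {K<..g}" "p \<in> monic_irreducibles (degree p)"
        using p by (auto simp: monic_irreducibles_def monics_def)
      then show ?thesis using p(3) t by blast
    qed (use t in auto)
  qed
  then have "card (B \<inter> sifted F (irreducibles_upto K)) \<le> card ({t \<in> B. squarefree (F t)} \<union> ?T)"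
    using B by (intro card_mono) auto
  also have "\<dots> \<le> card {t \<in> B. squarefree (F t)} + card ?T" by (rule card_Un_le)
  finally have 1: "real (card (B \<inter> sifted F (irreducibles_upto K))) \<le>
      real (card {t \<in> B. squarefree (F t)}) + real (card ?T)" by linarith
  have "card ?T \<le> (\<Sum>k\<in>{K<..g}. card (\<Union>p\<in>monic_irreducibles k. {t \<in> B. p ^ 2 dvd F t}))"
    by (rule card_UN_le) simp
  also have "\<dots> \<le> (\<Sum>k\<in>{K<..g}. \<Sum>p\<in>monic_irreducibles k. card {t \<in> B. p ^ 2 dvd F t})"
    by (intro sum_mono card_UN_le) simp
  finally have "real (card ?T) \<le>
      real (\<Sum>k\<in>{K<..g}. \<Sum>p\<in>monic_irreducibles k. card {t \<in> B. p ^ 2 dvd F t})"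
    by (rule of_nat_mono)
  also have "\<dots> = (\<Sum>k\<in>{K<..g}. \<Sum>p\<in>monic_irreducibles k. real (card {t \<in> B. p ^ 2 dvd F t}))"
    by simp
  also have "\<dots> \<le> (\<Sum>k\<in>{K<..g}. \<Sum>p\<in>(monic_irreducibles k :: 'a poly set). b k)"
    by (intro sum_mono b) auto
  also have "\<dots> = (\<Sum>k\<in>{K<..g}. real (card (monic_irreducibles k :: 'a poly set)) * b k)" by simp
  finally show "real (card (B \<inter> sifted F (irreducibles_upto K))) \<le>
      real (card {t \<in> B. squarefree (F t)}) +
      (\<Sum>k\<in>{K<..g}. real (card (monic_irreducibles k :: 'a poly set)) * b k)"
    using 1 by linarith
qed

section \<open>Truncated Euler products\<close>

definition square_factor :: "'a::{field, finite} poly \<Rightarrow> real" where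
  "square_factor p = 1 - 1 / real CARD('a) ^ (2 * degree p)"

text \<open>The factor of P(2) at p, with natural exponents in place of \<open>powr\<close>;
  \<open>euler_P_2\<close> makes the link.\<close>

definition euler_factor :: "'a::{field, finite} poly \<Rightarrow> real" where
  "euler_factor p = 1 - 1 / ((real CARD('a) ^ degree p + 1) * (real CARD('a) ^ degree p) ^ 2)"

lemma card_triple_box_sifted:
  assumes K: "(\<Sum>p\<in>(irreducibles_upto K :: 'a::{field, finite} poly set). 2 * degree p) \<le> m"
    and m: "m \<le> g"
  shows "real (card (triple_box (2 * g + 1) m \<inter> sifted disc_form (irreducibles_upto K :: 'a poly set))) =
    real CARD('a) ^ (2 * g + 1 + m) * (\<Prod>p\<in>(irreducibles_upto K :: 'a poly set). square_factor p * euler_factor p)"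
proof -
  let ?P = "irreducibles_upto K :: 'a poly set"
  have nn: "m + m + (2 * g + 1 - m) = 2 * g + 1 + m" using m by simp
  have "real (card (triple_box (2 * g + 1) m \<inter> sifted disc_form ?P)) =
    real CARD('a) ^ (2 * g + 1 + m) *
    (\<Prod>p\<in>?P. card (residue_triples (p ^ 2) \<inter> sifted disc_form {p}) / real CARD('a) ^ (6 * degree p))"
    unfolding triple_box_def nn[symmetric]
    by (intro card_box_sifted congruence_preserving_disc_form)
       (use K m in \<open>auto simp: irreducibles_upto_iff\<close>)
  also have "(\<Prod>p\<in>?P. card (residue_triples (p ^ 2) \<inter> sifted disc_form {p}) / real CARD('a) ^ (6 * degree p)) =
      (\<Prod>p\<in>?P. square_factor p * euler_factor p)"
  proof (rule prod.cong)
    fix p assume "p \<in> ?P"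
    then have "irreducible p" by (simp add: irreducibles_upto_iff)
    then show "card (residue_triples (p ^ 2) \<inter> sifted disc_form {p}) / real CARD('a) ^ (6 * degree p) =
        square_factor p * euler_factor p"
      by (simp add: card_residue_sifted_disc_form square_factor_def euler_factor_def)
  qed simp
  finally show ?thesis .
qed

text \<open>Here u and v are dummies: the count of triples is applied to the projection to w, and
  the sizes q^n of the two free sides cancel.\<close>

lemma card_monics_sifted:
  assumes K: "(\<Sum>p\<in>(irreducibles_upto K :: 'a::{field, finite} poly set). 2 * degree p) \<le> n"
  shows "real (card {w \<in> monics n :: 'a poly set. \<forall>p\<in>irreducibles_upto K. \<not> p ^ 2 dvd w}) =
    real CARD('a) ^ n * (\<Prod>p\<in>(irreducibles_upto K :: 'a poly set). square_factor p)"
proof -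
  let ?P = "irreducibles_upto K :: 'a poly set"
  let ?W = "{w \<in> monics n. \<forall>p\<in>?P. \<not> p ^ 2 dvd w}"
  have "monics n \<times> polys_below n \<times> monics n \<inter> sifted (\<lambda>t. snd (snd t)) ?P =
      monics n \<times> polys_below n \<times> ?W" by (auto simp: sifted_def)
  then have "real CARD('a) ^ (n + n) * real (card ?W) =
      real (card (monics n \<times> polys_below n \<times> monics n \<inter> sifted (\<lambda>t. snd (snd t)) ?P))"
    by (simp add: card_cartesian_product card_monics card_polys_below power_add)
  also have "\<dots> = real CARD('a) ^ (n + n + n) *
    (\<Prod>p\<in>?P. card (residue_triples (p ^ 2) \<inter> sifted (\<lambda>t. snd (snd t)) {p}) / real CARD('a) ^ (6 * degree p))"
    using K congruence_preserving_snd_snd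
    by (subst card_box_sifted) (auto simp: irreducibles_upto_iff)
  also have "(\<Prod>p\<in>?P. card (residue_triples (p ^ 2) \<inter> sifted (\<lambda>t. snd (snd t)) {p}) / real CARD('a) ^ (6 * degree p)) =
      (\<Prod>p\<in>?P. square_factor p)"
  proof (rule prod.cong)
    fix p assume "p \<in> ?P"
    then have "p \<noteq> 0" by (auto simp: irreducibles_upto_iff)
    then show "card (residue_triples (p ^ 2) \<inter> sifted (\<lambda>t. snd (snd t)) {p}) / real CARD('a) ^ (6 * degree p) =
        square_factor p"
      by (simp add: card_residue_sifted_snd_snd square_factor_def)
  qed simp
  finally have "real CARD('a) ^ (n + n) * real (card ?W) =
      real CARD('a) ^ (n + n) * (real CARD('a) ^ n * (\<Prod>p\<in>?P. square_factor p))"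
    by (simp add: power_add)
  then show ?thesis by simp
qed

subsection \<open>Uniform error terms\<close>

lemma card_field_ge_2: "real CARD('a::{field, finite}) \<ge> 2"
proof -
  have "card {0, 1 :: 'a} \<le> CARD('a)" by (rule card_mono) auto
  then show ?thesis by simp
qed

lemma sum_inverse_powers:
  fixes q :: real
  assumes "q > 1" "K \<le> g"
  shows "(\<Sum>k\<in>{K<..g}. 1 / q ^ k) = (1 / q ^ K - 1 / q ^ g) / (q - 1)"
  using assms(2)
proof (induction g rule: dec_induct)
  case (step g)
  have "{K<..Suc g} = insert (Suc g) {K<..g}" using step by auto
  then have "(\<Sum>k\<in>{K<..Suc g}. 1 / q ^ k) = 1 / q ^ Suc g + (1 / q ^ K - 1 / q ^ g) / (q - 1)"
    using step by simp
  also have "\<dots> = (1 / q ^ K - 1 / q ^ Suc g) / (q - 1)"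
    using assms(1) by (simp add: field_simps)
  finally show ?case .
qed simp

lemma sum_inverse_powers_le:
  fixes q :: real
  assumes "q \<ge> 2"
  shows "(\<Sum>k\<in>{K<..g}. 1 / q ^ k) \<le> 1 / q ^ K / (q - 1)"
proof (cases "K \<le> g")
  case True
  then have "(\<Sum>k\<in>{K<..g}. 1 / q ^ k) = (1 / q ^ K - 1 / q ^ g) / (q - 1)"
    using assms by (intro sum_inverse_powers) auto
  also have "\<dots> \<le> 1 / q ^ K / (q - 1)" using assms by (intro divide_right_mono) auto
  finally show ?thesis .
qed (use assms in simp)

lemma card_monic_irreducibles_le_power:
  "real (card (monic_irreducibles k :: 'a::{field, finite} poly set)) \<le> real CARD('a) ^ k"
proof -
  have "card (monic_irreducibles k :: 'a poly set) \<le> card (monics k :: 'a poly set)"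
    by (rule card_mono) (auto simp: monic_irreducibles_def)
  then show ?thesis by (simp add: card_monics)
qed

text \<open>The bounds q^k / k for the numbers of irreducibles, summed over the relevant degrees and
  taken relative to q^g: this controls the boundary terms of the sieve as a fraction of the
  box.\<close>

definition irreducible_tail :: "real \<Rightarrow> nat \<Rightarrow> real" where
  "irreducible_tail q g = (\<Sum>k\<in>{0<..g}. q ^ k / real k) / q ^ g"

text \<open>The value at g + 1 is the value at g divided by q, plus 1 / (g + 1). With q \<ge> 3 the
  induction closes, since (3 / g) / 3 = 1 / g \<le> 2 / (g + 1).\<close>

lemma irreducible_tail_le:
  assumes "q \<ge> 3" "g \<ge> 1"
  shows "irreducible_tail q g \<le> 3 / real g"
  using assms(2)
proof (induction g rule: dec_induct)
  case base
  have "{0<..Suc 0} = {1}" by auto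
  then show ?case using assms(1) by (simp add: irreducible_tail_def)
next
  case (step g)
  have "{0<..Suc g} = insert (Suc g) {0<..g}" by auto
  then have "irreducible_tail q (Suc g) = irreducible_tail q g / q + 1 / real (Suc g)"
    using assms(1) by (simp add: irreducible_tail_def field_simps)
  also have "irreducible_tail q g / q \<le> (3 / real g) / 3"
    using assms(1) step by (intro frac_le) auto
  also have "(3 / real g) / 3 \<le> 2 / real (Suc g)" using step by (simp add: field_simps)
  finally show ?case by simp
qed

lemma irreducible_tail_nonneg: "q \<ge> 0 \<Longrightarrow> irreducible_tail q g \<ge> 0"
  by (simp add: irreducible_tail_def sum_nonneg)

lemma irreducible_tail_tendsto:
  assumes "q \<ge> 3"
  shows "irreducible_tail q \<longlonglongrightarrow> 0"
proof (rule tendsto_sandwich[OF _ _ tendsto_const])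
  show "\<forall>\<^sub>F g in sequentially. 0 \<le> irreducible_tail q g"
    using assms by (simp add: irreducible_tail_nonneg)
  show "\<forall>\<^sub>F g in sequentially. irreducible_tail q g \<le> 3 / real g"
    using eventually_ge_at_top[of 1] by eventually_elim (rule irreducible_tail_le[OF assms])
  show "(\<lambda>g. 3 / real g) \<longlonglongrightarrow> 0" by (rule lim_const_over_n)
qed

text \<open>The error is uniform in m, which only has to leave room for the modulus. Its first term
  comes from at most q^k irreducibles with proportion 2 / q^(2 k) each, its second from the boundary
  terms of at most q^k / k irreducibles.\<close>

lemma card_squarefree_disc_form_bounds:
  fixes K g m :: nat
  defines "q \<equiv> real CARD('a::{field, finite})"
  defines "N \<equiv> real (card {t \<in> triple_box (2 * g + 1) m :: ('a poly \<times> _) set. squarefree (disc_form t)})"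
  defines "c \<equiv> (\<Prod>p\<in>(irreducibles_upto K :: 'a poly set). square_factor p * euler_factor p)"
  assumes K: "(\<Sum>p\<in>(irreducibles_upto K :: 'a poly set). 2 * degree p) \<le> m" and m: "m \<le> g"
  shows "\<bar>N / q ^ (2 * g + 1 + m) - c\<bar> \<le> 2 / q ^ K + irreducible_tail q g"
proof -
  let ?B = "triple_box (2 * g + 1) m :: ('a poly \<times> _) set"
  let ?n = "2 * g + 1 + m"
  let ?\<pi> = "\<lambda>k. real (card (monic_irreducibles k :: 'a poly set))"
  have q2: "q \<ge> 2" unfolding q_def by (rule card_field_ge_2)
  then have q: "q > 0" by simp
  define b where "b k = 2 * q ^ ?n / q ^ (2 * k) + q ^ (2 * m)" for k
  have F: "disc_form t \<noteq> 0 \<and> degree (disc_form t) \<le> 2 * g + 1" if "t \<in> ?B" for t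
    using disc_form_in_monics[OF that m] monics_nonzero degree_monics by fastforce
  have nn: "2 * m + (2 * g + 1 - m) = ?n" using m by simp
  have b: "real (card {t \<in> ?B. p ^ 2 dvd disc_form t}) \<le> b k" if "p \<in> monic_irreducibles k" for k p
    using that card_square_dvd_disc_form_le[of p k m "2 * g + 1 - m"]
    unfolding b_def triple_box_def nn q_def by (simp add: monic_irreducibles_def monics_def)
  have sift: "real (card (?B \<inter> sifted disc_form (irreducibles_upto K))) = q ^ ?n * c"
    unfolding q_def c_def by (rule card_triple_box_sifted[OF K m])
  have up: "N \<le> q ^ ?n * c"
    unfolding N_def sift[symmetric] using F b by (intro card_squarefree_sieve(1)[where g = g and b = b]) auto
  have lo: "q ^ ?n * c \<le> N + (\<Sum>k\<in>{K<..g}. ?\<pi> k * b k)"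
    unfolding N_def sift[symmetric] using F b by (intro card_squarefree_sieve(2)) auto
  have tail_bound: "?\<pi> k * b k \<le> q ^ ?n * (2 * (1 / q ^ k) + q ^ k / real k / q ^ g)" if k: "k \<in> {K<..g}" for k
  proof -
    have "real (k * card (monic_irreducibles k :: 'a poly set)) \<le> real (CARD('a) ^ k)"
      using card_monic_irreducibles_le by (rule of_nat_mono)
    then have "?\<pi> k \<le> q ^ k / real k" using k by (simp add: field_simps q_def)
    then have "?\<pi> k * q ^ (2 * m) \<le> q ^ k / real k * q ^ (2 * m)"
      using q by (intro mult_right_mono) auto
    also have "\<dots> \<le> q ^ k / real k * (q ^ ?n / q ^ g)"
    proof (rule mult_left_mono)
      \<comment> \<open>Since 2 m + g \<le> 2 g + 1 + m, one boundary term is at most the fraction 1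
        / q^g of the box.\<close>
      have "q ^ (2 * m) * q ^ g \<le> q ^ ?n"
        unfolding power_add[symmetric] using q2 m by (intro power_increasing) auto
      then show "q ^ (2 * m) \<le> q ^ ?n / q ^ g" using q by (simp add: field_simps)
    qed (use q in simp)
    finally have A: "?\<pi> k * q ^ (2 * m) \<le> q ^ ?n * (q ^ k / real k / q ^ g)"
      by (simp add: mult.commute)
    have "?\<pi> k * (2 * q ^ ?n / q ^ (2 * k)) \<le> q ^ k * (2 * q ^ ?n / q ^ (2 * k))"
      using q card_monic_irreducibles_le_power by (intro mult_right_mono) (auto simp: q_def)
    also have "q ^ k * (2 * q ^ ?n / q ^ (2 * k)) = q ^ k * (2 * q ^ ?n / (q ^ k * q ^ k))"
      by (simp only: mult_2[of k] power_add[of q k k])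
    also have "\<dots> = q ^ ?n * (2 * (1 / q ^ k))"
      using q by simp
    finally have "?\<pi> k * (2 * q ^ ?n / q ^ (2 * k)) \<le> q ^ ?n * (2 * (1 / q ^ k))" .
    with A show ?thesis unfolding b_def distrib_left by (intro add_mono)
  qed
  have "(\<Sum>k\<in>{K<..g}. ?\<pi> k * b k) \<le> (\<Sum>k\<in>{K<..g}. q ^ ?n * (2 * (1 / q ^ k) + q ^ k / real k / q ^ g))"
    by (intro sum_mono tail_bound)
  also have "\<dots> = q ^ ?n * (2 * (\<Sum>k\<in>{K<..g}. 1 / q ^ k) + (\<Sum>k\<in>{K<..g}. q ^ k / real k / q ^ g))"
    by (simp only: sum_distrib_left[symmetric] sum.distrib)
  also have "\<dots> \<le> q ^ ?n * (2 / q ^ K + irreducible_tail q g)"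
  proof (intro mult_left_mono add_mono)
    have "(\<Sum>k\<in>{K<..g}. 1 / q ^ k) \<le> 1 / q ^ K / (q - 1)" using q2 by (rule sum_inverse_powers_le)
    also have "\<dots> \<le> 1 / q ^ K / 1" using q2 by (intro divide_left_mono) auto
    finally show "2 * (\<Sum>k\<in>{K<..g}. 1 / q ^ k) \<le> 2 / q ^ K" by simp
    have "(\<Sum>k\<in>{K<..g}. q ^ k / real k / q ^ g) \<le> (\<Sum>k\<in>{0<..g}. q ^ k / real k / q ^ g)"
      using q by (intro sum_mono2) auto
    also have "\<dots> = irreducible_tail q g" by (simp add: irreducible_tail_def sum_divide_distrib)
    finally show "(\<Sum>k\<in>{K<..g}. q ^ k / real k / q ^ g) \<le> irreducible_tail q g" .
  qed (use q in simp)
  finally have "q ^ ?n * c - N \<le> q ^ ?n * (2 / q ^ K + irreducible_tail q g)" using lo by linarith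
  then have "\<bar>N - q ^ ?n * c\<bar> \<le> q ^ ?n * (2 / q ^ K + irreducible_tail q g)" using up by linarith
  moreover have "N / q ^ ?n - c = (N - q ^ ?n * c) / q ^ ?n" using q by (simp add: field_simps)
  ultimately show ?thesis
    using q by (simp add: abs_divide pos_divide_le_eq mult.commute)
qed

text \<open>For single polynomials the divisibility counts are exact, because 2 k \<le> 2 g < 2 g +
  1. Without boundary terms the crude count q^k of irreducibles suffices.\<close>

lemma card_monic_squarefree_bounds:
  fixes K g :: nat
  defines "q \<equiv> real CARD('a::{field, finite})"
  defines "H \<equiv> real (card (monic_squarefree (2 * g + 1) :: 'a poly set))"
  defines "c \<equiv> (\<Prod>p\<in>(irreducibles_upto K :: 'a poly set). square_factor p)"
  assumes K: "(\<Sum>p\<in>(irreducibles_upto K :: 'a poly set). 2 * degree p) \<le> 2 * g + 1"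
  shows "\<bar>H / q ^ (2 * g + 1) - c\<bar> \<le> 1 / q ^ K"
proof -
  let ?n = "2 * g + 1"
  \<comment> \<open>Singletons in the first two coordinates let the sieve for triples act on single
    polynomials.\<close>
  let ?B = "{1} \<times> {0} \<times> monics ?n :: ('a poly \<times> 'a poly \<times> 'a poly) set"
  let ?F = "\<lambda>t. snd (snd t) :: 'a poly"
  let ?\<pi> = "\<lambda>k. real (card (monic_irreducibles k :: 'a poly set))"
  have q2: "q \<ge> 2" unfolding q_def by (rule card_field_ge_2)
  then have q: "q > 0" by simp
  have card_B: "card {t \<in> ?B. P (?F t)} = card {w \<in> monics ?n. P w}" for P
  proof -
    have "{t \<in> ?B. P (?F t)} = {1} \<times> {0} \<times> {w \<in> monics ?n. P w}" by auto
    then show ?thesis by (simp add: card_cartesian_product)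
  qed
  define b where "b k = q ^ ?n / q ^ (2 * k)" for k
  have F: "?F t \<noteq> 0 \<and> degree (?F t) \<le> ?n" if "t \<in> ?B" for t
    using that monics_nonzero degree_monics by fastforce
  have b: "real (card {t \<in> ?B. p ^ 2 dvd ?F t}) \<le> b k" if k: "k \<le> g" and "p \<in> monic_irreducibles k" for k p
  proof -
    have p: "p \<noteq> 0" "degree p = k" using that by (auto simp: monic_irreducibles_def monics_def)
    have deg: "degree (p ^ 2) = 2 * k" using p by (simp add: degree_power_eq)
    have "card {t \<in> ?B. p ^ 2 dvd ?F t} = CARD('a) ^ (?n - 2 * k)"
      unfolding card_B using p k deg by (subst card_dvd_monics) auto
    then have "real (card {t \<in> ?B. p ^ 2 dvd ?F t}) = q ^ (?n - 2 * k)" by (simp only: q_def of_nat_power)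
    also have "\<dots> = b k" unfolding b_def using q k by (intro power_diff) auto
    finally show ?thesis by simp
  qed
  have "?B \<inter> sifted ?F (irreducibles_upto K) = {t \<in> ?B. \<forall>p\<in>irreducibles_upto K. \<not> p ^ 2 dvd ?F t}"
    by (auto simp: sifted_def)
  then have sift: "real (card (?B \<inter> sifted ?F (irreducibles_upto K))) = q ^ ?n * c"
    unfolding q_def c_def
    by (simp only: card_B[of "\<lambda>w. \<forall>p\<in>irreducibles_upto K. \<not> p ^ 2 dvd w"] card_monics_sifted[OF K])
  have H: "H = real (card {t \<in> ?B. squarefree (?F t)})"
    unfolding H_def monic_squarefree_eq by (simp only: card_B)
  have up: "H \<le> q ^ ?n * c"
    unfolding H sift[symmetric] using F b by (intro card_squarefree_sieve(1)[where g = g and b = b]) auto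
  have lo: "q ^ ?n * c \<le> H + (\<Sum>k\<in>{K<..g}. ?\<pi> k * b k)"
    unfolding H sift[symmetric] using F b by (intro card_squarefree_sieve(2)) auto
  have "(\<Sum>k\<in>{K<..g}. ?\<pi> k * b k) \<le> (\<Sum>k\<in>{K<..g}. q ^ ?n * (1 / q ^ k))"
  proof (rule sum_mono)
    fix k
    have "?\<pi> k * b k \<le> q ^ k * b k"
      using q card_monic_irreducibles_le_power by (intro mult_right_mono) (auto simp: q_def b_def)
    also have "q ^ k * b k = q ^ k * (q ^ ?n / (q ^ k * q ^ k))"
      by (simp only: b_def mult_2[of k] power_add[of q k k])
    also have "\<dots> = q ^ ?n * (1 / q ^ k)" using q by simp
    finally show "?\<pi> k * b k \<le> q ^ ?n * (1 / q ^ k)" .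
  qed
  also have "\<dots> = q ^ ?n * (\<Sum>k\<in>{K<..g}. 1 / q ^ k)" by (simp only: sum_distrib_left)
  also have "\<dots> \<le> q ^ ?n * (1 / q ^ K)"
  proof (rule mult_left_mono)
    have "(\<Sum>k\<in>{K<..g}. 1 / q ^ k) \<le> 1 / q ^ K / (q - 1)" using q2 by (rule sum_inverse_powers_le)
    also have "\<dots> \<le> 1 / q ^ K / 1" using q2 by (intro divide_left_mono) auto
    finally show "(\<Sum>k\<in>{K<..g}. 1 / q ^ k) \<le> 1 / q ^ K" by simp
  qed (use q in simp)
  finally have "q ^ ?n * c - H \<le> q ^ ?n * (1 / q ^ K)" using lo by linarith
  then have "\<bar>H - q ^ ?n * c\<bar> \<le> q ^ ?n * (1 / q ^ K)" using up by linarith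
  moreover have "H / q ^ ?n - c = (H - q ^ ?n * c) / q ^ ?n" using q by (simp add: field_simps)
  ultimately show ?thesis
    using q by (simp add: abs_divide pos_divide_le_eq mult.commute)
qed

subsection \<open>Passage to the limit\<close>

text \<open>K is fixed first, to bring c K close to L and make A K small; only then does g grow. The
  bound may start at a g depending on K, because the sieve needs g large compared with the modulus
  belonging to K.\<close>

lemma tendsto_of_approximations:
  fixes x :: "nat \<Rightarrow> real"
  assumes c: "c \<longlonglongrightarrow> L" and A: "A \<longlonglongrightarrow> 0" and \<tau>: "\<tau> \<longlonglongrightarrow> 0"
    and bound: "\<And>K. \<forall>\<^sub>F g in sequentially. \<bar>x g - c K\<bar> \<le> A K + \<tau> g"
  shows "x \<longlonglongrightarrow> L"
proof (rule tendstoI)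
  fix e :: real assume e: "e > 0"
  have "\<forall>\<^sub>F K in sequentially. dist (c K) L < e / 3 \<and> dist (A K) 0 < e / 3"
    using tendstoD[OF c, of "e / 3"] tendstoD[OF A, of "e / 3"] e
    by (intro eventually_conj) auto
  then obtain K where K: "dist (c K) L < e / 3" "dist (A K) 0 < e / 3"
    using eventually_happens'[OF sequentially_bot] by blast
  have "\<forall>\<^sub>F g in sequentially. dist (\<tau> g) 0 < e / 3" using tendstoD[OF \<tau>, of "e / 3"] e by simp
  then show "\<forall>\<^sub>F g in sequentially. dist (x g) L < e"
    using bound[of K]
  proof eventually_elim
    case (elim g)
    have "dist (x g) L \<le> dist (x g) (c K) + dist (c K) L" by (rule dist_triangle)
    moreover have "dist (x g) (c K) \<le> dist (A K) 0 + dist (\<tau> g) 0"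
      using elim by (simp add: dist_real_def)
    ultimately show ?case using K elim by linarith
  qed
qed

text \<open>The partial products decrease as the finite set grows and are bounded below by 0, so the
  net converges to their infimum.\<close>

lemma prod_tendsto_finite_subsets:
  fixes a :: "'b \<Rightarrow> real"
  assumes a: "\<And>i. i \<in> I \<Longrightarrow> 0 \<le> a i \<and> a i \<le> 1"
  shows "\<exists>L. ((\<lambda>F. prod a F) \<longlongrightarrow> L) (finite_subsets_at_top I)"
proof -
  define V where "V = prod a ` {F. finite F \<and> F \<subseteq> I}"
  have bdd: "bdd_below V"
    unfolding V_def using a by (intro bdd_belowI[of _ 0]) (auto intro!: prod_nonneg)
  have ne: "V \<noteq> {}" unfolding V_def by blast
  have antimono: "prod a Y \<le> prod a X" if "finite Y" "X \<subseteq> Y" "Y \<subseteq> I" for X Y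
  proof -
    have "prod a Y = prod a X * prod a (Y - X)"
      using that by (metis prod.subset_diff mult.commute)
    also have "\<dots> \<le> prod a X * 1"
      using that a by (intro mult_left_mono prod_le_1 prod_nonneg) auto
    finally show ?thesis by simp
  qed
  have "((\<lambda>F. prod a F) \<longlongrightarrow> Inf V) (finite_subsets_at_top I)"
  proof (rule order_tendstoI)
    fix y assume "y < Inf V"
    moreover have "Inf V \<le> prod a F" if "finite F" "F \<subseteq> I" for F
      using that by (intro cInf_lower bdd) (auto simp: V_def)
    ultimately show "\<forall>\<^sub>F F in finite_subsets_at_top I. y < prod a F"
      by (intro eventually_finite_subsets_at_top_weakI) (rule less_le_trans)
  next
    fix y assume "Inf V < y"
    then obtain v where "v \<in> V" "v < y" using cInf_lessD[OF ne] by blast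
    then obtain X where X: "finite X" "X \<subseteq> I" "prod a X < y" by (auto simp: V_def)
    have "prod a F < y" if "finite F" "X \<subseteq> F" "F \<subseteq> I" for F
      using antimono[OF that] X(3) by simp
    with X show "\<forall>\<^sub>F F in finite_subsets_at_top I. prod a F < y"
      unfolding eventually_finite_subsets_at_top by blast
  qed
  then show ?thesis by blast
qed

text \<open>Weierstrass's product inequality: one more factor subtracts x i times a product that is
  at most 1.\<close>

lemma prod_one_minus_ge:
  fixes x :: "'b \<Rightarrow> real"
  assumes "finite F" "\<And>i. i \<in> F \<Longrightarrow> 0 \<le> x i \<and> x i \<le> 1"
  shows "1 - sum x F \<le> (\<Prod>i\<in>F. 1 - x i)"
  using assms
proof (induction F rule: finite_induct)
  case (insert i F)
  have P: "(\<Prod>i\<in>F. 1 - x i) \<le> 1" using insert by (intro prod_le_1) auto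
  have "x i * (\<Prod>i\<in>F. 1 - x i) \<le> x i * 1" using insert P by (intro mult_left_mono) auto
  then have "1 - sum x (insert i F) \<le> (\<Prod>i\<in>F. 1 - x i) - x i * (\<Prod>i\<in>F. 1 - x i)"
    using insert by simp
  then show ?case using insert by (simp add: algebra_simps)
qed simp

text \<open>Every finite set of monic irreducibles is exhausted once K passes its degrees. A limit
  along the net is thus also the limit over the degree cutoffs that the sieve uses.\<close>

lemma filterlim_irreducibles_upto:
  "filterlim irreducibles_upto
     (finite_subsets_at_top {p :: 'a::{field, finite} poly. lead_coeff p = 1 \<and> irreducible p}) sequentially"
  unfolding filterlim_iff eventually_finite_subsets_at_top
proof clarify
  fix P :: "'a poly set \<Rightarrow> bool" and X :: "'a poly set"
  assume X: "finite X" "X \<subseteq> {p. lead_coeff p = 1 \<and> irreducible p}"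
    and P: "\<forall>Y. finite Y \<and> X \<subseteq> Y \<and> Y \<subseteq> {p. lead_coeff p = 1 \<and> irreducible p} \<longrightarrow> P Y"
  show "\<forall>\<^sub>F K in sequentially. P (irreducibles_upto K)"
    using eventually_ge_at_top[of "Max (insert 0 (degree ` X))"]
  proof eventually_elim
    case (elim K)
    have "degree p \<le> K" if "p \<in> X" for p
      using that X(1) elim by (intro order_trans[OF Max_ge elim]) auto
    then have "X \<subseteq> irreducibles_upto K" using X(2) by (auto simp: irreducibles_upto_iff)
    then show ?case by (intro P[rule_format]) (auto simp: irreducibles_upto_iff)
  qed
qed

text \<open>
  A product of factors \<open>1 - O(|p| ^ (-2))\<close> is bounded away from \<open>0\<close> because there are at most
  \<open>q ^ k\<close> irreducible \<open>p\<close> of degree \<open>k\<close>, so that the subtracted terms sum to at most \<open>1 / (q - 1)\<close>.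
\<close>

lemma irreducible_prod_limit:
  fixes a :: "'a::{field, finite} poly \<Rightarrow> real"
  defines "I \<equiv> {p :: 'a poly. lead_coeff p = 1 \<and> irreducible p}"
  assumes card: "CARD('a) \<ge> 3"
    and a: "\<And>p. 1 - 1 / real CARD('a) ^ (2 * degree p) \<le> a p \<and> a p \<le> 1"
  obtains L where "((\<lambda>F. prod a F) \<longlongrightarrow> L) (finite_subsets_at_top I)"
    "(\<lambda>K. prod a (irreducibles_upto K)) \<longlonglongrightarrow> L" "L > 0"
proof -
  define q where "q = real CARD('a)"
  have q: "q \<ge> 3" using card by (simp add: q_def)
  have x: "0 \<le> 1 - a p \<and> 1 - a p \<le> 1 \<and> 1 - a p \<le> 1 / q ^ (2 * degree p)" for p
  proof -
    have "1 / q ^ (2 * degree p) \<le> 1" using q by simp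
    then show ?thesis using a[of p] unfolding q_def by (intro conjI) linarith+
  qed
  have "0 \<le> a p \<and> a p \<le> 1" for p using x[of p] by simp
  then obtain L where L: "((\<lambda>F. prod a F) \<longlongrightarrow> L) (finite_subsets_at_top I)"
    using prod_tendsto_finite_subsets[of I a] by blast
  have lim: "(\<lambda>K. prod a (irreducibles_upto K)) \<longlonglongrightarrow> L"
    using filterlim_compose[OF L[unfolded I_def] filterlim_irreducibles_upto] .
  have "1 / 2 \<le> prod a (irreducibles_upto K)" for K
  proof -
    have "(\<Sum>p\<in>irreducibles_upto K. 1 - a p) \<le> (\<Sum>p\<in>(irreducibles_upto K :: 'a poly set). 1 / q ^ (2 * degree p))"
      using x by (intro sum_mono) blast
    also have "\<dots> = (\<Sum>k\<in>{0<..K}. \<Sum>p\<in>(monic_irreducibles k :: 'a poly set). 1 / q ^ (2 * degree p))"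
      by (rule sum_irreducibles_upto)
    also have "\<dots> \<le> (\<Sum>k\<in>{0<..K}. 1 / q ^ k)"
    proof (rule sum_mono)
      fix k
      have "(\<Sum>p\<in>(monic_irreducibles k :: 'a poly set). 1 / q ^ (2 * degree p)) =
          (\<Sum>p\<in>(monic_irreducibles k :: 'a poly set). 1 / q ^ (2 * k))"
        by (intro sum.cong) (auto simp: monic_irreducibles_def monics_def)
      also have "\<dots> = real (card (monic_irreducibles k :: 'a poly set)) * (1 / q ^ (2 * k))" by simp
      also have "\<dots> \<le> q ^ k * (1 / q ^ (2 * k))"
        using card_monic_irreducibles_le_power q by (intro mult_right_mono) (auto simp: q_def)
      also have "\<dots> = 1 / q ^ k" using q unfolding mult_2[of k] power_add by simp
      finally show "(\<Sum>p\<in>(monic_irreducibles k :: 'a poly set). 1 / q ^ (2 * degree p)) \<le> 1 / q ^ k" .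
    qed
    also have "\<dots> \<le> 1 / q ^ 0 / (q - 1)" using q by (intro sum_inverse_powers_le) simp
    also have "\<dots> \<le> 1 / 2" using q by (simp add: field_simps)
    finally have "1 / 2 \<le> 1 - (\<Sum>p\<in>(irreducibles_upto K :: 'a poly set). 1 - a p)" by simp
    also have "\<dots> \<le> (\<Prod>p\<in>irreducibles_upto K. 1 - (1 - a p))"
      using x by (intro prod_one_minus_ge) auto
    finally show ?thesis by simp
  qed
  then have "1 / 2 \<le> L" using lim by (intro LIMSEQ_le_const) auto
  then show ?thesis using that L lim by force
qed

section \<open>The constants P(2) and zeta_A(2)\<close>

lemma square_factor_bounds:
  "1 - 1 / real CARD('a) ^ (2 * degree p) \<le> square_factor (p :: 'a::{field, finite} poly) \<and> square_factor p \<le> 1"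
  by (simp add: square_factor_def)

lemma euler_factor_bounds:
  "1 - 1 / real CARD('a) ^ (2 * degree p) \<le> euler_factor (p :: 'a::{field, finite} poly) \<and> euler_factor p \<le> 1"
proof -
  define Q where "Q = real CARD('a) ^ degree p"
  have Q: "Q > 0" by (simp add: Q_def)
  have "1 / ((Q + 1) * Q ^ 2) \<le> 1 / Q ^ 2"
    using Q by (intro frac_le) (auto simp: algebra_simps)
  moreover have "real CARD('a) ^ (2 * degree p) = Q ^ 2"
    by (simp add: Q_def mult.commute flip: power_mult)
  ultimately show ?thesis using Q by (simp add: euler_factor_def flip: Q_def)
qed

lemma euler_P_2:
  assumes "CARD('a::{field, finite}) \<ge> 3"
  shows "(\<lambda>K. prod euler_factor (irreducibles_upto K :: 'a poly set)) \<longlonglongrightarrow> euler_P TYPE('a) 2"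
    and "euler_P TYPE('a) 2 > 0"
proof -
  let ?I = "{p :: 'a poly. lead_coeff p = 1 \<and> irreducible p}"
  obtain L where L: "((\<lambda>F. prod euler_factor F) \<longlongrightarrow> L) (finite_subsets_at_top ?I)"
    "(\<lambda>K. prod euler_factor (irreducibles_upto K :: 'a poly set)) \<longlonglongrightarrow> L" "L > 0"
    using irreducible_prod_limit[OF assms euler_factor_bounds] by blast
  let ?e = "\<lambda>p :: 'a poly. 1 - 1 / ((poly_abs p + 1) * poly_abs p powr 2)"
  have factor: "?e p = euler_factor p" if "p \<noteq> 0" for p
    using that by (simp add: poly_abs_def euler_factor_def)
  have "prod ?e F = prod euler_factor F" if "F \<subseteq> ?I" for F
    by (intro prod.cong refl factor) (use that in force)
  then have "\<forall>\<^sub>F F in finite_subsets_at_top ?I. prod euler_factor F = prod ?e F"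
    by (intro eventually_finite_subsets_at_top_weakI) simp
  from Lim_transform_eventually[OF L(1) this]
  have "euler_P TYPE('a) 2 = L"
    unfolding euler_P_def by (intro tendsto_Lim) simp_all
  with L show "(\<lambda>K. prod euler_factor (irreducibles_upto K :: 'a poly set)) \<longlonglongrightarrow> euler_P TYPE('a) 2"
    "euler_P TYPE('a) 2 > 0" by simp_all
qed

text \<open>Grouped by degree, the q^n monic polynomials of degree n contribute q^n / q^(2 n), and a
  geometric series remains.\<close>

lemma zeta_A_2: "zeta_A TYPE('a::{field, finite}) 2 = real CARD('a) / (real CARD('a) - 1)"
proof -
  define q where "q = real CARD('a)"
  have q: "q \<ge> 2" unfolding q_def by (rule card_field_ge_2)
  let ?M = "monics :: nat \<Rightarrow> 'a poly set"
  have abs: "poly_abs f powr - 2 = 1 / q ^ (2 * n)" if "f \<in> ?M n" for f n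
  proof -
    have "f \<noteq> 0" using that by (rule monics_nonzero)
    then have "poly_abs f = q ^ n" using that by (simp add: poly_abs_def q_def monics_def)
    then show ?thesis using q by (simp add: powr_minus_divide mult.commute flip: power_mult)
  qed
  have inner: "((\<lambda>f. poly_abs f powr - 2) has_sum (1 / q) ^ n) (?M n)" for n
  proof -
    have "(\<Sum>f\<in>?M n. poly_abs f powr - 2) = (\<Sum>f\<in>?M n. 1 / q ^ (2 * n))"
      by (intro sum.cong abs) simp_all
    also have "\<dots> = q ^ n * (1 / q ^ (2 * n))" by (simp add: card_monics q_def)
    also have "\<dots> = (1 / q) ^ n" using q unfolding mult_2[of n] power_add by (simp add: power_divide)
    finally show ?thesis using has_sum_finite[OF finite_monics] by metis
  qed
  have "(\<lambda>n. (1 / q) ^ n) sums (1 / (1 - 1 / q))" using q by (intro geometric_sums) simp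
  then have outer: "((\<lambda>n. (1 / q) ^ n) has_sum (1 / (1 - 1 / q))) UNIV"
    using q by (intro sums_nonneg_imp_has_sum) auto
  have "((\<lambda>(n, f). poly_abs f powr - 2) has_sum (1 / (1 - 1 / q))) (SIGMA n:UNIV. ?M n)"
  proof (rule has_sum_SigmaI[where g = "\<lambda>n. (1 / q) ^ n"])
    show "(\<lambda>(n, f). poly_abs f powr - 2) summable_on (SIGMA n:UNIV. ?M n)"
    proof (rule summable_on_SigmaI[where g = "\<lambda>n. (1 / q) ^ n"])
      show "(\<lambda>n. (1 / q) ^ n) summable_on UNIV" using outer by (rule has_sum_imp_summable)
    qed (use inner in simp_all)
  qed (use inner outer in simp_all)
  moreover have "bij_betw snd (SIGMA n:UNIV. ?M n) {f :: 'a poly. lead_coeff f = 1}"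
    by (rule bij_betw_byWitness[where f' = "\<lambda>f. (degree f, f)"]) (auto simp: monics_def)
  ultimately have "((\<lambda>f. poly_abs f powr - 2) has_sum (1 / (1 - 1 / q))) {f :: 'a poly. lead_coeff f = 1}"
    using has_sum_reindex_bij_betw[of snd "SIGMA n:UNIV. ?M n" "{f :: 'a poly. lead_coeff f = 1}"
        "\<lambda>f. poly_abs f powr - 2" "1 / (1 - 1 / q)"] by (simp add: case_prod_unfold)
  then have "zeta_A TYPE('a) 2 = 1 / (1 - 1 / q)"
    unfolding zeta_A_def by (rule infsumI)
  also have "\<dots> = q / (q - 1)" using q by (simp add: field_simps)
  finally show ?thesis by (simp add: q_def)
qed

section \<open>Asymptotics of the two counts and of their quotient\<close>

lemma card_monic_squarefree_limit:
  assumes "CARD('a::{field, finite}) \<ge> 3"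
    and E: "(\<lambda>K. prod square_factor (irreducibles_upto K :: 'a poly set)) \<longlonglongrightarrow> E"
  shows "(\<lambda>g. real (card (monic_squarefree (2 * g + 1) :: 'a poly set)) / real CARD('a) ^ (2 * g + 1))
    \<longlonglongrightarrow> E"
proof (rule tendsto_of_approximations[OF E _ tendsto_const])
  show "(\<lambda>K. 1 / real CARD('a) ^ K) \<longlonglongrightarrow> 0"
    using assms(1) by (intro LIMSEQ_divide_realpow_zero) simp
  fix K
  show "\<forall>\<^sub>F g in sequentially.
      \<bar>real (card (monic_squarefree (2 * g + 1) :: 'a poly set)) / real CARD('a) ^ (2 * g + 1) -
       prod square_factor (irreducibles_upto K :: 'a poly set)\<bar> \<le> 1 / real CARD('a) ^ K + 0"
    using eventually_ge_at_top[of "\<Sum>p\<in>(irreducibles_upto K :: 'a poly set). 2 * degree p"]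
  proof eventually_elim
    case (elim g)
    then have "(\<Sum>p\<in>(irreducibles_upto K :: 'a poly set). 2 * degree p) \<le> 2 * g + 1" by linarith
    from card_monic_squarefree_bounds[OF this] show ?case by simp
  qed
qed

text \<open>The degree of u is indexed from the top as g - j, so that for fixed j the box outgrows
  every fixed modulus.\<close>

lemma card_squarefree_disc_form_limit:
  fixes j :: nat
  assumes "CARD('a::{field, finite}) \<ge> 3"
    and c: "(\<lambda>K. \<Prod>p\<in>(irreducibles_upto K :: 'a poly set). square_factor p * euler_factor p) \<longlonglongrightarrow> c"
  shows "(\<lambda>g. real (card {t \<in> triple_box (2 * g + 1) (g - j) :: ('a poly \<times> _) set. squarefree (disc_form t)}) /
    real CARD('a) ^ (2 * g + 1 + (g - j))) \<longlonglongrightarrow> c"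
proof (rule tendsto_of_approximations[OF c])
  have "(\<lambda>K. 2 / real CARD('a) ^ K) \<longlonglongrightarrow> 0"
    using assms(1) by (intro LIMSEQ_divide_realpow_zero) simp
  then show "(\<lambda>K. 2 / real CARD('a) ^ K) \<longlonglongrightarrow> 0" .
  show "irreducible_tail (real CARD('a)) \<longlonglongrightarrow> 0"
    using assms(1) by (intro irreducible_tail_tendsto) simp
  fix K
  show "\<forall>\<^sub>F g in sequentially.
      \<bar>real (card {t \<in> triple_box (2 * g + 1) (g - j) :: ('a poly \<times> _) set. squarefree (disc_form t)}) /
        real CARD('a) ^ (2 * g + 1 + (g - j)) -
       (\<Prod>p\<in>(irreducibles_upto K :: 'a poly set). square_factor p * euler_factor p)\<bar>
      \<le> 2 / real CARD('a) ^ K + irreducible_tail (real CARD('a)) g"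
    using eventually_ge_at_top[of "(\<Sum>p\<in>(irreducibles_upto K :: 'a poly set). 2 * degree p) + j"]
  proof eventually_elim
    case (elim g)
    then have "(\<Sum>p\<in>(irreducibles_upto K :: 'a poly set). 2 * degree p) \<le> g - j" by linarith
    from card_squarefree_disc_form_bounds[OF this] show ?case by simp
  qed
qed

text \<open>The box with m = g - j has q^(3 g + 1) / q^j elements, and for each j the proportion of
  square-free values tends to c. Tannery's theorem with majorant 1 / q^j exchanges limit and sum,
  leaving c times a geometric series.\<close>

lemma sum_class_number_limit:
  assumes card: "CARD('a::{field, finite}) \<ge> 3" and two: "(2 :: 'a) \<noteq> 0"
    and c: "(\<lambda>K. \<Prod>p\<in>(irreducibles_upto K :: 'a poly set). square_factor p * euler_factor p) \<longlonglongrightarrow> c"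
  defines "q \<equiv> real CARD('a)"
  shows "(\<lambda>g. (\<Sum>D\<in>(monic_squarefree (2 * g + 1) :: 'a poly set). real (class_number D)) / q ^ (3 * g + 1))
    \<longlonglongrightarrow> c * (q / (q - 1))"
proof -
  have q: "q \<ge> 3" using card by (simp add: q_def)
  define N where "N g m =
    real (card {t \<in> triple_box (2 * g + 1) m :: ('a poly \<times> _) set. squarefree (disc_form t)})" for g m
  \<comment> \<open>The value 0 for j > g, where \<open>g - j\<close> would be truncated, turns the
    finite sum over m into an infinite series over j.\<close>
  define a where "a j g = (if j \<le> g then (1 / q) ^ j * (N g (g - j) / q ^ (2 * g + 1 + (g - j))) else 0)" for j g
  have lim: "(a j \<longlongrightarrow> (1 / q) ^ j * c) sequentially" for j
  proof (rule Lim_transform_eventually)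
    show "(\<lambda>g. (1 / q) ^ j * (N g (g - j) / q ^ (2 * g + 1 + (g - j)))) \<longlonglongrightarrow> (1 / q) ^ j * c"
      unfolding N_def q_def by (intro tendsto_mult tendsto_const card_squarefree_disc_form_limit card c)
    show "\<forall>\<^sub>F g in sequentially. (1 / q) ^ j * (N g (g - j) / q ^ (2 * g + 1 + (g - j))) = a j g"
      using eventually_ge_at_top[of j] by eventually_elim (simp add: a_def)
  qed
  have bound: "norm (a j g) \<le> (1 / q) ^ j" for j g
  proof (cases "j \<le> g")
    case True
    have "N g (g - j) \<le> real (card (triple_box (2 * g + 1) (g - j) :: ('a poly \<times> _) set))"
      unfolding N_def of_nat_le_iff by (intro card_mono) auto
    also have "\<dots> = q ^ (2 * g + 1 + (g - j))" unfolding q_def by (subst card_triple_box) auto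
    finally have "N g (g - j) / q ^ (2 * g + 1 + (g - j)) \<le> 1" using q by simp
    moreover have "N g (g - j) \<ge> 0" by (simp add: N_def)
    ultimately have "(1 / q) ^ j * (N g (g - j) / q ^ (2 * g + 1 + (g - j))) \<le> (1 / q) ^ j * 1"
      using q by (intro mult_left_mono) auto
    then show ?thesis using q True \<open>N g (g - j) \<ge> 0\<close> by (simp add: a_def)
  qed (use q in \<open>simp add: a_def\<close>)
  have summable: "summable (\<lambda>j. (1 / q) ^ j)" using q by (intro summable_geometric) simp
  have "\<forall>\<^sub>F (j, g) in at_top \<times>\<^sub>F sequentially. norm (a j g) \<le> (1 / q) ^ j"
    using bound by (intro always_eventually) auto
  from tannerys_theorem[where a = a, OF lim this summable sequentially_bot]
  have "(\<lambda>g. \<Sum>j. a j g) \<longlonglongrightarrow> (\<Sum>j. (1 / q) ^ j * c)" by blast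
  also have "(\<Sum>j. (1 / q) ^ j * c) = c * (q / (q - 1))"
  proof -
    have "(\<Sum>j. (1 / q) ^ j * c) = (\<Sum>j. (1 / q) ^ j) * c" using summable by (rule suminf_mult2[symmetric])
    also have "(\<Sum>j. (1 / q) ^ j) = 1 / (1 - 1 / q)" using q by (intro suminf_geometric) simp
    also have "\<dots> = q / (q - 1)" using q by (simp add: field_simps)
    finally show ?thesis by (simp add: mult.commute)
  qed
  also have "(\<lambda>g. \<Sum>j. a j g) =
      (\<lambda>g. (\<Sum>D\<in>(monic_squarefree (2 * g + 1) :: 'a poly set). real (class_number D)) / q ^ (3 * g + 1))"
  proof
    fix g
    have "(\<Sum>j. a j g) = (\<Sum>j\<le>g. a j g)"
      by (rule suminf_finite) (auto simp: a_def)
    also have "\<dots> = (\<Sum>j\<le>g. N g (g - j) / q ^ (3 * g + 1))"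
    proof (rule sum.cong)
      fix j assume "j \<in> {..g}"
      then have "3 * g + 1 = j + (2 * g + 1 + (g - j))" by simp
      then have e: "q ^ (3 * g + 1) = q ^ j * q ^ (2 * g + 1 + (g - j))" by (metis power_add)
      have "a j g = (1 / q) ^ j * (N g (g - j) / q ^ (2 * g + 1 + (g - j)))"
        using \<open>j \<in> {..g}\<close> by (simp add: a_def)
      then show "a j g = N g (g - j) / q ^ (3 * g + 1)"
        unfolding e by (simp only: power_one_over) simp
    qed simp
    also have "\<dots> = (\<Sum>m\<le>g. N g m / q ^ (3 * g + 1))"
      by (rule sum.reindex_bij_witness[of _ "\<lambda>m. g - m" "\<lambda>j. g - j"]) auto
    also have "\<dots> = real (\<Sum>D\<in>(monic_squarefree (2 * g + 1) :: 'a poly set). class_number D) / q ^ (3 * g + 1)"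
      unfolding sum_class_number[OF two] by (simp add: N_def sum_divide_distrib)
    finally show "(\<Sum>j. a j g) =
        (\<Sum>D\<in>(monic_squarefree (2 * g + 1) :: 'a poly set). real (class_number D)) / q ^ (3 * g + 1)"
      by simp
  qed
  finally show ?thesis .
qed

text \<open>Adding 1 permutes the field, so comparing the sums of all x and of all x + 1 shows that
  q times 1 is 0. With 2 = 0 and q odd this would give 1 = 0.\<close>

lemma two_nonzero_of_odd_card:
  assumes "odd CARD('a::{field, finite})"
  shows "(2 :: 'a) \<noteq> 0"
proof
  assume two: "(2 :: 'a) = 0"
  obtain k where k: "CARD('a) = 2 * k + 1" using assms by (elim oddE)
  have "bij (\<lambda>x :: 'a. x + 1)" by (rule bij_betw_byWitness[where f' = "\<lambda>x. x - 1"]) auto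
  then have "(\<Sum>x\<in>(UNIV :: 'a set). x + 1) = (\<Sum>x\<in>UNIV. x)"
    by (rule sum.reindex_bij_betw)
  then have "of_nat CARD('a) = (0 :: 'a)" by (simp add: sum.distrib)
  then show False using two by (simp add: k)
qed

theorem theorem4:
  assumes "CARD('a::{field, finite}) mod 4 = 1"
  shows "(\<lambda>g. (\<Sum>D\<in>(monic_squarefree (2 * g + 1) :: 'a poly set). real (class_number D)) /
              real (card (monic_squarefree (2 * g + 1) :: 'a poly set)))
         \<sim>[sequentially]
         (\<lambda>g. sqrt (real CARD('a) ^ (2 * g + 1)) / sqrt (real CARD('a)) *
              zeta_A TYPE('a) 2 * euler_P TYPE('a) 2)"
proof -
  define q where "q = real CARD('a)"
  have "CARD('a) \<ge> 2" using card_field_ge_2[where 'a = 'a] by simp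
  \<comment> \<open>The bounds for the Euler products and for \<open>irreducible_tail\<close> rest
    on q \<ge> 3.\<close>
  then have card: "CARD('a) \<ge> 3" using assms by (cases "CARD('a) = 2") auto
  then have q: "q \<ge> 3" by (simp add: q_def)
  have "odd CARD('a)" using assms by presburger
  then have two: "(2 :: 'a) \<noteq> 0" by (rule two_nonzero_of_odd_card)
  let ?P = "euler_P TYPE('a) 2"
  let ?z = "zeta_A TYPE('a) 2"
  \<comment> \<open>E is the density of the square-free polynomials. It occurs in numerator and
    denominator and cancels; its positivity permits the division.\<close>
  obtain E where E: "(\<lambda>K. prod square_factor (irreducibles_upto K :: 'a poly set)) \<longlonglongrightarrow> E" "E > 0"
    using irreducible_prod_limit[OF card square_factor_bounds] by blast
  note P = euler_P_2[OF card]
  have "(\<lambda>K. \<Prod>p\<in>(irreducibles_upto K :: 'a poly set). square_factor p * euler_factor p) \<longlonglongrightarrow> E * ?P"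
    unfolding prod.distrib by (intro tendsto_mult E P)
  note S = sum_class_number_limit[OF card two this]
  note H = card_monic_squarefree_limit[OF card E(1)]
  have z: "?z = q / (q - 1)" unfolding q_def by (rule zeta_A_2)
  then have z0: "?z > 0" using q by simp
  define s where "s g = (\<Sum>D\<in>(monic_squarefree (2 * g + 1) :: 'a poly set). real (class_number D))" for g
  define h where "h g = real (card (monic_squarefree (2 * g + 1) :: 'a poly set))" for g
  have "(\<lambda>g. (s g / q ^ (3 * g + 1)) / (h g / q ^ (2 * g + 1)) / (?z * ?P)) \<longlonglongrightarrow>
      (E * ?P * ?z) / E / (?z * ?P)"
    using S H E(2) P(2) z0 unfolding z s_def h_def q_def by (intro tendsto_divide tendsto_const) auto
  also have "(E * ?P * ?z) / E / (?z * ?P) = 1" using E P z0 by simp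
  also have "(\<lambda>g. (s g / q ^ (3 * g + 1)) / (h g / q ^ (2 * g + 1)) / (?z * ?P)) =
      (\<lambda>g. (s g / h g) / (sqrt (q ^ (2 * g + 1)) / sqrt q * ?z * ?P))"
  proof
    fix g
    have "sqrt (q ^ (2 * g + 1)) = sqrt ((q ^ g) ^ 2) * sqrt q"
      by (simp add: real_sqrt_mult power_mult mult.commute)
    then have root: "sqrt (q ^ (2 * g + 1)) / sqrt q = q ^ g" using q by simp
    \<comment> \<open>The sum of class numbers is normalised by q^(3 g + 1) and the number of D by
      q^(2 g + 1); their quotient q^g is sqrt |D| / sqrt q.\<close>
    have "q ^ (3 * g + 1) = q ^ g * q ^ (2 * g + 1)" by (simp flip: power_add)
    then show "(s g / q ^ (3 * g + 1)) / (h g / q ^ (2 * g + 1)) / (?z * ?P) =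
        (s g / h g) / (sqrt (q ^ (2 * g + 1)) / sqrt q * ?z * ?P)"
      unfolding root using q by (simp add: field_simps)
  qed
  finally have "(\<lambda>g. (s g / h g) / (sqrt (q ^ (2 * g + 1)) / sqrt q * ?z * ?P)) \<longlonglongrightarrow> 1" .
  then show ?thesis
    unfolding s_def h_def q_def by (rule asymp_equivI')
qed

end
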